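(* Let $k\ge 0$ be an integer and let $T\subset\mathbb R^3$ be a polyhedron. Then $$\mathbf P_{\mathrm{div},T}^k(\underline{\mathbf I}_{\mathrm{div},T}^k\mathbf v)=\boldsymbol\pi_{\mathcal P,T}^k\mathbf v\qquad\forall\mathbf v\in\boldsymbol{\mathcal{RT}}^k(T).$$
   Context: Geometry. A polyhedron $T$ is a connected set that is the interior of a finite union of tetrahedra; $T$ is assumed simply connected with connected Lipschitz-continuous boundary. $\mathcal F_T$ is its set of planar polygonal faces; each face $F$ has a fixed unit normal $\mathbf n_F$, and $\omega_{TF}=1$ if $\mathbf n_F$ points out of $T$, $-1$ otherwise. Polynomials. $\mathcal P^\ell(X)$: restrictions to $X$ (face or polyhedron) of polynomials of total degree $\le\ell$, $\mathcal P^{-1}(X)=\{0\}$; $\mathcal P^{0,\ell}(X)$: its zero-average subspace; $\pi_{\mathcal P,X}^\ell$: $L^2$-orthogonal projector on $\mathcal P^\ell(X)$; $\boldsymbol\pi_{\mathcal P,T}^\ell$: its component-wise version on $\mathcal P^\ell(T)^3$. $\mathcal P^\ell(\mathcal F_T)$: functions on $\partial T$ that are in $\mathcal P^\ell(F)$ on each face $F$, without continuity. $\boldsymbol{\mathcal G}^\ell(T)=\mathbf{grad}\,\mathcal P^{\ell+1}(T)$, and $\boldsymbol{\mathcal G}^\ell(T)^\perp$ is its $L^2$-orthogonal complement in $\mathcal P^\ell(T)^3$; the $L^2$-orthogonal projectors on these spaces are $\boldsymbol\pi_{\mathcal G,T}^\ell$ and $\boldsymbol\pi_{\mathcal G,T}^{\perp,\ell}$.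 With $\overline{\mathbf x}_T=\frac1{|T|}\int_T\mathbf x\,d\mathbf x$, $\boldsymbol{\mathcal{RT}}^k(T)=\mathcal P^k(T)^3+(\mathbf x-\overline{\mathbf x}_T)\mathcal P^k(T)$. Space, interpolator, operators. $\underline{\mathbf X}_{\mathrm{div},T}^k=\big(\boldsymbol{\mathcal G}^{k-1}(T)\oplus\boldsymbol{\mathcal G}^k(T)^\perp\big)\times\mathcal P^k(\mathcal F_T)$, elements $\underline{\mathbf v}_T=(\mathbf v_T=\mathbf v_{\mathcal G,T}+\mathbf v_{\mathcal G,T}^\perp,v_{\partial T})$, $v_F=(v_{\partial T})_{|F}$. For $\mathbf v\in C^0(\overline T)^3$, $\underline{\mathbf I}_{\mathrm{div},T}^k\mathbf v=\big(\boldsymbol\pi_{\mathcal G,T}^{k-1}\mathbf v+\boldsymbol\pi_{\mathcal G,T}^{\perp,k}\mathbf v,(\pi_{\mathcal P,F}^k(\mathbf v\cdot\mathbf n_F))_{F\in\mathcal F_T}\big)$. $D_T^k\underline{\mathbf v}_T\in\mathcal P^k(T)$ is defined by $\int_TD_T^k\underline{\mathbf v}_T\,q_T=-\int_T\mathbf v_T\cdot\mathbf{grad}\,q_T+\sum_{F\in\mathcal F_T}\omega_{TF}\int_Fv_Fq_T$ for all $q_T\in\mathcal P^k(T)$. The vector potential $\mathbf P_{\mathrm{div},T}^k\underline{\mathbf v}_T\in\mathcal P^k(T)^3$ is the unique polynomial such that $$\int_T\mathbf P_{\mathrm{div},T}^k\underline{\mathbf v}_T\cdot\mathbf{grad}\,q_T=-\int_TD_T^k\underline{\mathbf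 v}_T\,q_T+\sum_{F\in\mathcal F_T}\omega_{TF}\int_Fv_Fq_T\quad\forall q_T\in\mathcal P^{0,k+1}(T),$$ $$\int_T\mathbf P_{\mathrm{div},T}^k\underline{\mathbf v}_T\cdot\mathbf w_T=\int_T\mathbf v_{\mathcal G,T}^\perp\cdot\mathbf w_T\quad\forall\mathbf w_T\in\boldsymbol{\mathcal G}^k(T)^\perp.$$ *)

theory Defs
  imports "HOL-Analysis.Analysis"
begin

section \<open>Geometry\<close>

text \<open>Locally, and up to a rotation, the set is the strict subgraph of a Lipschitz function
  defined on the hyperplane orthogonal to the unit vector \<open>e\<close>.\<close>

definition lipschitz_boundary :: "'a::euclidean_space set \<Rightarrow> bool" where
  "lipschitz_boundary T \<longleftrightarrow>
     (\<forall>x\<in>frontier T. \<exists>U e \<gamma> L. open U \<and> x \<in> U \<and> norm e = 1 \<and>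
        L-lipschitz_on {y. y \<bullet> e = 0} \<gamma> \<and>
        T \<inter> U = {y \<in> U. y \<bullet> e < \<gamma> (y - (y \<bullet> e) *\<^sub>R e)})"

text \<open>The constant \<^const>\<open>polyhedron\<close> of the library denotes finite intersections of
  half-spaces; the domains considered here need not be convex.\<close>

definition polyhedral_domain :: "(real^3) set \<Rightarrow> bool" where
  "polyhedral_domain T \<longleftrightarrow>
     (\<exists>\<T>. finite \<T> \<and> (\<forall>S\<in>\<T>. 3 simplex S) \<and> T = interior (\<Union>\<T>)) \<and>
     T \<noteq> {} \<and> connected T \<and> simply_connected T \<and>
     connected (frontier T) \<and> lipschitz_boundary T"

text \<open>Faces are relatively open in their plane.\<close>

definition planar_polygon :: "(real^3) set \<Rightarrow> bool" where
  "planar_polygon F \<longleftrightarrow> connected F \<and>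
     (\<exists>\<T>. finite \<T> \<and> (\<forall>S\<in>\<T>. 2 simplex S) \<and> aff_dim (\<Union>\<T>) = 2 \<and> F = rel_interior (\<Union>\<T>))"

text \<open>Two faces may be coplanar, as happens for the faces of a non-matching mesh; the
  decomposition of the boundary into maximal flat pieces is one instance.\<close>

definition face_set :: "(real^3) set \<Rightarrow> (real^3) set set \<Rightarrow> bool" where
  "face_set T \<F> \<longleftrightarrow> finite \<F> \<and> (\<forall>F\<in>\<F>. planar_polygon F) \<and>
     pairwise disjnt \<F> \<and> (\<Union>F\<in>\<F>. closure F) = frontier T"

definition unit_normal :: "(real^3) set \<Rightarrow> real^3 \<Rightarrow> bool" where
  "unit_normal F \<nu> \<longleftrightarrow> norm \<nu> = 1 \<and> (\<forall>x\<in>F. \<forall>y\<in>F. (x - y) \<bullet> \<nu> = 0)"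

definition points_out :: "(real^3) set \<Rightarrow> (real^3) set \<Rightarrow> real^3 \<Rightarrow> bool" where
  "points_out T F \<nu> \<longleftrightarrow> (\<forall>x\<in>F. \<forall>\<^sub>F t in at_right 0. x + t *\<^sub>R \<nu> \<notin> closure T)"

definition orientation :: "(real^3) set \<Rightarrow> ((real^3) set \<Rightarrow> real^3) \<Rightarrow> (real^3) set \<Rightarrow> real" where
  "orientation T n F = (if points_out T F (n F) then 1 else - 1)"

text \<open>The area measure on a planar set: two-dimensional Lebesgue measure, transported by an
  isometric parametrisation of the plane. It does not depend on the parametrisation, because
  Lebesgue measure is invariant under the isometries of the Euclidean plane.\<close>

definition plane_param :: "(real^3) set \<Rightarrow> real^2 \<Rightarrow> real^3" where
  "plane_param F = (SOME \<phi>. (\<forall>s t. dist (\<phi> s) (\<phi> t) = dist s t) \<and> range \<phi> = affine hull F)"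

definition area_on :: "(real^3) set \<Rightarrow> (real^3) measure" where
  "area_on F = restrict_space (distr lborel borel (plane_param F)) F"


section \<open>Polynomial spaces\<close>

text \<open>A function on \<open>X\<close> is encoded by its extension by \<^const>\<open>undefined\<close>, as produced by
  \<^const>\<open>restrict\<close>, so that equality in HOL is equality on \<open>X\<close>. Degrees are integers, and
  for a negative degree the sum over multi-indices is empty.\<close>

definition polys :: "int \<Rightarrow> (real^3 \<Rightarrow> real) set" where
  "polys l = {p. \<exists>c. p = (\<lambda>x. \<Sum>\<alpha> | int (\<Sum>i\<in>UNIV. \<alpha> i) \<le> l. c \<alpha> * (\<Prod>i\<in>UNIV. (x $ i) ^ \<alpha> i))}"

definition P :: "int \<Rightarrow> (real^3) set \<Rightarrow> (real^3 \<Rightarrow> real) set" where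
  "P l X = (\<lambda>p. restrict p X) ` polys l"

definition P0 :: "int \<Rightarrow> (real^3) set \<Rightarrow> (real^3 \<Rightarrow> real) set" where
  "P0 l T = {q \<in> P l T. (\<integral>x. q x \<partial>lebesgue_on T) = 0}"

definition Pvec :: "int \<Rightarrow> (real^3) set \<Rightarrow> (real^3 \<Rightarrow> real^3) set" where
  "Pvec l T = {v \<in> extensional T. \<forall>i. (\<lambda>x\<in>T. v x $ i) \<in> P l T}"

definition grad :: "(real^3) set \<Rightarrow> (real^3 \<Rightarrow> real) \<Rightarrow> real^3 \<Rightarrow> real^3" where
  "grad T q = (\<lambda>x\<in>T. THE D. GDERIV q x :> D)"

definition G :: "int \<Rightarrow> (real^3) set \<Rightarrow> (real^3 \<Rightarrow> real^3) set" where
  "G l T = grad T ` P (l + 1) T"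

definition Gperp :: "int \<Rightarrow> (real^3) set \<Rightarrow> (real^3 \<Rightarrow> real^3) set" where
  "Gperp l T = {w \<in> Pvec l T. \<forall>g\<in>G l T. (\<integral>x. w x \<bullet> g x \<partial>lebesgue_on T) = 0}"

definition barycenter :: "(real^3) set \<Rightarrow> real^3" where
  "barycenter T = (1 / measure lebesgue T) *\<^sub>R (\<integral>x. x \<partial>lebesgue_on T)"

definition RT :: "int \<Rightarrow> (real^3) set \<Rightarrow> (real^3 \<Rightarrow> real^3) set" where
  "RT k T = {\<lambda>x\<in>T. p x + q x *\<^sub>R (x - barycenter T) | p q. p \<in> Pvec k T \<and> q \<in> P k T}"

definition L2_proj ::
    "'a measure \<Rightarrow> ('a \<Rightarrow> 'b::real_inner) set \<Rightarrow> ('a \<Rightarrow> 'b) \<Rightarrow> 'a \<Rightarrow> 'b" where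
  "L2_proj M V f = (THE p. p \<in> V \<and> (\<forall>w\<in>V. (\<integral>x. (f x - p x) \<bullet> w x \<partial>M) = 0))"

definition proj_Pvec :: "int \<Rightarrow> (real^3) set \<Rightarrow> (real^3 \<Rightarrow> real^3) \<Rightarrow> real^3 \<Rightarrow> real^3" where
  "proj_Pvec l T v = (\<lambda>x\<in>T. \<chi> i. L2_proj (lebesgue_on T) (P l T) (\<lambda>y. v y $ i) x)"

text \<open>The continuous extension to \<^term>\<open>closure T\<close> of a function on the open set \<open>T\<close>. It gives
  elements of \<^term>\<open>P l T\<close> and \<^term>\<open>RT k T\<close> their boundary values.\<close>

definition closure_ext ::
    "(real^3) set \<Rightarrow> (real^3 \<Rightarrow> 'b::t2_space) \<Rightarrow> real^3 \<Rightarrow> 'b" where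
  "closure_ext T f = (\<lambda>x\<in>closure T. Lim (at x within T) f)"


section \<open>Discrete space, interpolator and operators\<close>

text \<open>An element is a pair consisting of a function on \<open>T\<close> and of a family, indexed by the faces,
  of functions on the faces. The operators below are meaningful on this space.\<close>

type_synonym ddr_div = "(real^3 \<Rightarrow> real^3) \<times> ((real^3) set \<Rightarrow> real^3 \<Rightarrow> real)"

definition X_div :: "int \<Rightarrow> (real^3) set \<Rightarrow> (real^3) set set \<Rightarrow> ddr_div set" where
  "X_div k T \<F> = {\<lambda>x\<in>T. a x + b x | a b. a \<in> G (k - 1) T \<and> b \<in> Gperp k T} \<times> (\<Pi>\<^sub>E F\<in>\<F>. P k F)"

definition Gperp_part :: "int \<Rightarrow> (real^3) set \<Rightarrow> (real^3 \<Rightarrow> real^3) \<Rightarrow> real^3 \<Rightarrow> real^3" where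
  "Gperp_part k T v =
     (THE b. b \<in> Gperp k T \<and> (\<exists>a\<in>G (k - 1) T. v = (\<lambda>x\<in>T. a x + b x)))"

definition I_div :: "int \<Rightarrow> (real^3) set \<Rightarrow> (real^3) set set \<Rightarrow> ((real^3) set \<Rightarrow> real^3) \<Rightarrow>
    (real^3 \<Rightarrow> real^3) \<Rightarrow> ddr_div" where
  "I_div k T \<F> n v =
     (\<lambda>x\<in>T. L2_proj (lebesgue_on T) (G (k - 1) T) v x + L2_proj (lebesgue_on T) (Gperp k T) v x,
      \<lambda>F\<in>\<F>. L2_proj (area_on F) (P k F) (\<lambda>x. v x \<bullet> n F))"

definition boundary_term :: "(real^3) set \<Rightarrow> (real^3) set set \<Rightarrow> ((real^3) set \<Rightarrow> real^3) \<Rightarrow>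
    ddr_div \<Rightarrow> (real^3 \<Rightarrow> real) \<Rightarrow> real" where
  "boundary_term T \<F> n v q =
     (\<Sum>F\<in>\<F>. orientation T n F * (\<integral>x. snd v F x * closure_ext T q x \<partial>area_on F))"

definition D_div :: "int \<Rightarrow> (real^3) set \<Rightarrow> (real^3) set set \<Rightarrow> ((real^3) set \<Rightarrow> real^3) \<Rightarrow>
    ddr_div \<Rightarrow> real^3 \<Rightarrow> real" where
  "D_div k T \<F> n v = (THE d. d \<in> P k T \<and>
     (\<forall>q\<in>P k T. (\<integral>x. d x * q x \<partial>lebesgue_on T) =
        - (\<integral>x. fst v x \<bullet> grad T q x \<partial>lebesgue_on T) + boundary_term T \<F> n v q))"

definition P_div :: "int \<Rightarrow> (real^3) set \<Rightarrow> (real^3) set set \<Rightarrow> ((real^3) set \<Rightarrow> real^3) \<Rightarrow>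
    ddr_div \<Rightarrow> real^3 \<Rightarrow> real^3" where
  "P_div k T \<F> n v = (THE p. p \<in> Pvec k T \<and>
     (\<forall>q\<in>P0 (k + 1) T. (\<integral>x. p x \<bullet> grad T q x \<partial>lebesgue_on T) =
        - (\<integral>x. D_div k T \<F> n v x * q x \<partial>lebesgue_on T) + boundary_term T \<F> n v q) \<and>
     (\<forall>w\<in>Gperp k T. (\<integral>x. p x \<bullet> w x \<partial>lebesgue_on T) =
        (\<integral>x. Gperp_part k T (fst v) x \<bullet> w x \<partial>lebesgue_on T)))"

end

theory Submission
  imports Defs
begin

text \<open>Integration by parts on \<open>T\<close> turns the definition of \<open>D\<^sub>T\<close> applied to an interpolate into
  \<open>D\<^sub>T (I v) = div v\<close>: for \<open>v\<close> in the Raviart-Thomas space, \<open>div v\<close> has degree \<open>k\<close>, and so has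
  \<open>v \<bullet> n\<^sub>F\<close> on each face, because \<open>x \<bullet> n\<^sub>F\<close> is constant there. A second integration by parts shows
  that the vector potential of \<open>I v\<close> has the same moments as \<open>v\<close> against gradients of polynomials
  of degree \<open>k + 1\<close>, and it has the same moments against their orthogonal complement by
  construction; hence it is the orthogonal projection of \<open>v\<close>.

  Integration by parts is derived from Fubini's theorem: on almost every line in a coordinate
  direction, \<open>T\<close> is bounded by finitely many points in the interior of faces that the line crosses
  transversally, and near such a point \<open>T\<close> is a half ball, so that the orientation of the face
  gives the sign of the boundary contribution. The points of a face are then integrated over
  its projection, with the component of the normal as Jacobian.\<close>

section \<open>Polynomials in three variables\<close>

text \<open>The operators are definite descriptions over functions that are \<open>undefined\<close>
  off their domain. The proof works with polynomials on the whole space and passes to a cell or a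
  face by \<open>restrict\<close>; each description is then settled by existence plus definiteness
  of an inner product.

  The degrees are tight. \<open>D_div\<close> tests with gradients of degree \<open>k - 1\<close>,
  on which the projected cell unknown acts like \<open>v\<close>. \<open>P_div\<close> tests with
  polynomials of degree \<open>k + 1\<close>, beyond the reach of the face projections and of the
  definition of \<open>D_div\<close>; here it is essential that both reproduce the normal components
  and the divergence of a Raviart-Thomas field exactly.

  A face has one sign, defined by a condition on all its points, whereas integration by parts needs
  the side of \<open>T\<close> near each point. The Lipschitz boundary prevents \<open>T\<close>
  from lying on both sides of a face, and connectedness of the face makes the side constant.\<close>

lemma finite_multiindices: "finite {\<alpha>::3 \<Rightarrow> nat. int (\<Sum>i\<in>UNIV. \<alpha> i) \<le> l}"
proof (rule finite_subset)
  have "\<alpha> i \<le> nat l" if "int (\<Sum>i\<in>UNIV. \<alpha> i) \<le> l" for \<alpha> :: "3 \<Rightarrow> nat" and i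
  proof -
    have "\<alpha> i \<le> (\<Sum>i\<in>UNIV. \<alpha> i)" by (rule member_le_sum) auto
    then show ?thesis using that by linarith
  qed
  then show "{\<alpha>::3 \<Rightarrow> nat. int (\<Sum>i\<in>UNIV. \<alpha> i) \<le> l} \<subseteq> (\<Pi>\<^sub>E i\<in>UNIV. {..nat l})"
    by (auto simp: PiE_def)
  show "finite (\<Pi>\<^sub>E i\<in>(UNIV::3 set). {..nat l})" by (intro finite_PiE) auto
qed

lemma polys_monom:
  assumes "int (\<Sum>i\<in>UNIV. \<alpha> i) \<le> l"
  shows "(\<lambda>x. c * (\<Prod>i\<in>UNIV. (x $ i) ^ \<alpha> i)) \<in> polys l"
proof -
  have "(\<Sum>\<beta> | int (\<Sum>i\<in>UNIV. \<beta> i) \<le> l.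
      (if \<beta> = \<alpha> then c else 0) * (\<Prod>i\<in>UNIV. (x $ i) ^ \<beta> i)) =
      c * (\<Prod>i\<in>UNIV. (x $ i) ^ \<alpha> i)" for x :: "real^3"
    using finite_multiindices assms
    by (simp add: if_distrib[of "\<lambda>y. y * _"] sum.delta cong: if_cong)
  then show ?thesis
    unfolding polys_def by (intro CollectI exI[of _ "\<lambda>\<beta>. if \<beta> = \<alpha> then c else 0"]) auto
qed

lemma polys_zero: "(\<lambda>x. 0) \<in> polys l"
  unfolding polys_def by (intro CollectI exI[of _ "\<lambda>_. 0"]) auto

lemma polys_add: "p \<in> polys l \<Longrightarrow> q \<in> polys l \<Longrightarrow> (\<lambda>x. p x + q x) \<in> polys l"
  unfolding polys_def
proof clarify
  fix c d :: "(3 \<Rightarrow> nat) \<Rightarrow> real"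
  show "\<exists>e. (\<lambda>x. (\<Sum>\<alpha> | int (\<Sum>i\<in>UNIV. \<alpha> i) \<le> l. c \<alpha> * (\<Prod>i\<in>UNIV. (x $ i) ^ \<alpha> i)) +
      (\<Sum>\<alpha> | int (\<Sum>i\<in>UNIV. \<alpha> i) \<le> l. d \<alpha> * (\<Prod>i\<in>UNIV. (x $ i) ^ \<alpha> i))) =
      (\<lambda>x. \<Sum>\<alpha> | int (\<Sum>i\<in>UNIV. \<alpha> i) \<le> l. e \<alpha> * (\<Prod>i\<in>UNIV. (x $ i) ^ \<alpha> i))"
    by (intro exI[of _ "\<lambda>\<alpha>. c \<alpha> + d \<alpha>"]) (simp add: sum.distrib algebra_simps)
qed

lemma polys_cmult: "p \<in> polys l \<Longrightarrow> (\<lambda>x. a * p x) \<in> polys l"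
  unfolding polys_def
proof clarify
  fix c :: "(3 \<Rightarrow> nat) \<Rightarrow> real"
  show "\<exists>e. (\<lambda>x. a * (\<Sum>\<alpha> | int (\<Sum>i\<in>UNIV. \<alpha> i) \<le> l. c \<alpha> * (\<Prod>i\<in>UNIV. (x $ i) ^ \<alpha> i))) =
      (\<lambda>x. \<Sum>\<alpha> | int (\<Sum>i\<in>UNIV. \<alpha> i) \<le> l. e \<alpha> * (\<Prod>i\<in>UNIV. (x $ i) ^ \<alpha> i))"
    by (intro exI[of _ "\<lambda>\<alpha>. a * c \<alpha>"]) (simp add: sum_distrib_left mult.assoc)
qed

lemma polys_diff: "p \<in> polys l \<Longrightarrow> q \<in> polys l \<Longrightarrow> (\<lambda>x. p x - q x) \<in> polys l"
  using polys_add[OF _ polys_cmult[of q l "-1"], of p] by simp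

lemma polys_sum: "(\<And>j. j \<in> J \<Longrightarrow> p j \<in> polys l) \<Longrightarrow> (\<lambda>x. \<Sum>j\<in>J. p j x) \<in> polys l"
  by (induction J rule: infinite_finite_induct) (auto simp: polys_zero polys_add)

lemma polys_const: "0 \<le> l \<Longrightarrow> (\<lambda>x. c) \<in> polys l"
  using polys_monom[of "\<lambda>_. 0" l c] by simp

text \<open>Partial sums over finite sets of multi-indices are again in \<open>polys l\<close>, so
  the additive case may assume membership of both summands. Coefficients sit in the monomial case,
  which saves a case for scalar multiples.\<close>

lemma polys_induct [consumes 1, case_names zero add monom]:
  assumes "p \<in> polys l"
    and zero: "Q (\<lambda>x. 0)"
    and add: "\<And>p q. p \<in> polys l \<Longrightarrow> q \<in> polys l \<Longrightarrow> Q p \<Longrightarrow> Q q \<Longrightarrow> Q (\<lambda>x. p x + q x)"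
    and monom: "\<And>c \<alpha>. int (\<Sum>i\<in>UNIV. \<alpha> i) \<le> l \<Longrightarrow> Q (\<lambda>x. c * (\<Prod>i\<in>UNIV. (x $ i) ^ \<alpha> i))"
  shows "Q p"
proof -
  obtain c where p: "p = (\<lambda>x. \<Sum>\<alpha> | int (\<Sum>i\<in>UNIV. \<alpha> i) \<le> l. c \<alpha> * (\<Prod>i\<in>UNIV. (x $ i) ^ \<alpha> i))"
    using assms(1) unfolding polys_def by auto
  have "A \<subseteq> {\<alpha>. int (\<Sum>i\<in>UNIV. \<alpha> i) \<le> l} \<Longrightarrow>
      Q (\<lambda>x. \<Sum>\<alpha>\<in>A. c \<alpha> * (\<Prod>i\<in>UNIV. (x $ i) ^ \<alpha> i))" if "finite A" for A
    using that
  proof (induction A)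
    case (insert \<alpha> A)
    then have "\<forall>\<beta>\<in>insert \<alpha> A. int (\<Sum>i\<in>UNIV. \<beta> i) \<le> l" by auto
    then show ?case using insert
      by (auto intro!: add monom polys_monom polys_sum)
  qed (simp add: zero)
  then show ?thesis unfolding p using finite_multiindices by blast
qed

lemma polys_mono:
  assumes "p \<in> polys l" "l \<le> m" shows "p \<in> polys m"
  using assms(1)
  by (induction rule: polys_induct) (use assms(2) in \<open>auto intro!: polys_zero polys_add polys_monom\<close>)

lemma prod_3: "(\<Prod>i\<in>UNIV. f (i::3)) = f 1 * (f 2 * f 3)"
  for f :: "3 \<Rightarrow> 'a::comm_monoid_mult"
  unfolding UNIV_3 by simp

text \<open>The change of degree when one exponent is replaced, written with additions only because
  subtraction on \<open>nat\<close> would truncate.\<close>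

lemma sum_fun_upd:
  fixes \<alpha> :: "'i::finite \<Rightarrow> nat"
  shows "(\<Sum>j\<in>UNIV. (\<alpha>(i := m)) j) + \<alpha> i = (\<Sum>j\<in>UNIV. \<alpha> j) + m"
  using sum.remove[of UNIV i \<alpha>] sum.remove[of UNIV i "\<alpha>(i := m)"] by simp

lemma polys_coord:
  assumes "p \<in> polys l" shows "(\<lambda>x. x $ i * p x) \<in> polys (l + 1)"
  using assms
proof (induction rule: polys_induct)
  case (monom c \<alpha>)
  have "(\<lambda>x. x $ i * (c * (\<Prod>j\<in>UNIV. (x $ j) ^ \<alpha> j))) =
      (\<lambda>x. c * (\<Prod>j\<in>UNIV. (x $ j) ^ (\<alpha>(i := Suc (\<alpha> i))) j))"
    by (rule ext) (simp add: prod.remove[OF finite UNIV_I, of _ i] mult.left_commute)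
  moreover have "int (\<Sum>j\<in>UNIV. (\<alpha>(i := Suc (\<alpha> i))) j) \<le> l + 1"
    using sum_fun_upd[of \<alpha> i "Suc (\<alpha> i)"] monom by linarith
  ultimately show ?case by (simp only: polys_monom)
qed (auto simp: polys_zero polys_add distrib_left)

lemma polys_continuous: "p \<in> polys l \<Longrightarrow> continuous_on S p"
  by (induction rule: polys_induct) (auto intro!: continuous_intros)

lemma GDERIV_coord: "GDERIV (\<lambda>x. x $ i) x :> axis i 1"
  unfolding gderiv_def by (simp add: inner_axis) (rule bounded_linear_imp_has_derivative, rule bounded_linear_vec_nth)

lemma GDERIV_unique:
  assumes "GDERIV f x :> D" "GDERIV f x :> E" shows "D = E"
proof -
  have "(\<lambda>h. h \<bullet> D) = (\<lambda>h. h \<bullet> E)" using assms unfolding gderiv_def by (rule has_derivative_unique)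
  then have "h \<bullet> (D - E) = 0" for h by (simp add: inner_diff_right fun_eq_iff)
  from this[of "D - E"] show ?thesis by simp
qed

lemma GDERIV_power: "GDERIV (\<lambda>x. (x $ i) ^ m) x :> (real m * (x $ i) ^ (m - 1)) *\<^sub>R axis i 1"
  by (rule GDERIV_DERIV_compose[OF GDERIV_coord]) (auto intro!: derivative_eq_intros)

text \<open>Provides a gradient on the whole space together with the drop in degree;
  \<open>GDERIV_unique\<close> later identifies it with any other gradient. For \<open>l = 0\<close>
  the bound is \<open>- 1\<close>, which leaves only the zero polynomial.\<close>

lemma polys_gderiv:
  assumes "p \<in> polys l"
  shows "\<exists>g. (\<forall>i. (\<lambda>x. g x $ i) \<in> polys (l - 1)) \<and> (\<forall>x. GDERIV p x :> g x)"
  using assms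
proof (induction rule: polys_induct)
  case zero
  show ?case by (intro exI[of _ "\<lambda>x. 0"]) (auto simp: polys_zero GDERIV_const)
next
  case (add p q)
  then obtain g h where "\<forall>i. (\<lambda>x. g x $ i) \<in> polys (l - 1)" "\<forall>x. GDERIV p x :> g x"
    "\<forall>i. (\<lambda>x. h x $ i) \<in> polys (l - 1)" "\<forall>x. GDERIV q x :> h x" by auto
  then show ?case
    by (intro exI[of _ "\<lambda>x. g x + h x"]) (auto intro: polys_add GDERIV_add)
next
  case (monom c \<alpha>)
  \<comment> \<open>If \<open>\<alpha> i = 0\<close>, truncated subtraction does not lower the
    exponent, but then the factor \<open>real (\<alpha> i)\<close> vanishes.\<close>
  define d where "d i x = (c * real (\<alpha> i)) *
    (\<Prod>j\<in>UNIV. (x $ j) ^ (\<alpha>(i := \<alpha> i - 1)) j)" for i :: 3 and x :: "real^3"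
  have "d i \<in> polys (l - 1)" for i
  proof (cases "\<alpha> i = 0")
    case True
    then have "d i = (\<lambda>x. 0)" by (simp add: d_def fun_eq_iff)
    then show ?thesis by (simp add: polys_zero)
  next
    case False
    have "int (\<Sum>j\<in>UNIV. (\<alpha>(i := \<alpha> i - 1)) j) \<le> l - 1"
      using sum_fun_upd[of \<alpha> i "\<alpha> i - 1"] monom False by linarith
    then show ?thesis unfolding d_def by (rule polys_monom)
  qed
  moreover have "GDERIV (\<lambda>x. c * (\<Prod>i\<in>UNIV. (x $ i) ^ \<alpha> i)) x :> (\<chi> i. d i x)" for x
  proof -
    have "GDERIV (\<lambda>x. c * ((x $ 1) ^ \<alpha> 1 * ((x $ 2) ^ \<alpha> 2 * (x $ 3) ^ \<alpha> 3))) x :> (\<chi> i. d i x)"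
      by (rule GDERIV_subst, (rule GDERIV_mult GDERIV_const GDERIV_power)+)
        (simp add: vec_eq_iff forall_3 d_def prod_3 axis_def)
    then show ?thesis by (simp add: prod_3)
  qed
  ultimately show ?case by (intro exI[of _ "\<lambda>x. \<chi> i. d i x"]) auto
qed

section \<open>Orthogonal projections on spaces of continuous functions\<close>

text \<open>The members are functions on the whole space, from which the discrete spaces arise by
  \<open>restrict\<close>; continuity up to the boundary is thereby built in.\<close>

definition continuous_subspace :: "('a::topological_space \<Rightarrow> 'b::real_normed_vector) set \<Rightarrow> bool" where
  "continuous_subspace W \<longleftrightarrow> (\<forall>p\<in>W. continuous_on UNIV p) \<and> (\<lambda>x. 0) \<in> W \<and>
     (\<forall>p\<in>W. \<forall>q\<in>W. (\<lambda>x. p x + q x) \<in> W) \<and> (\<forall>c. \<forall>p\<in>W. (\<lambda>x. c *\<^sub>R p x) \<in> W)"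

lemma continuous_subspaceD:
  assumes "continuous_subspace W"
  shows "p \<in> W \<Longrightarrow> continuous_on UNIV p" and "(\<lambda>x. 0) \<in> W"
    and "p \<in> W \<Longrightarrow> q \<in> W \<Longrightarrow> (\<lambda>x. p x + q x) \<in> W"
    and "p \<in> W \<Longrightarrow> (\<lambda>x. c *\<^sub>R p x) \<in> W"
    and "p \<in> W \<Longrightarrow> q \<in> W \<Longrightarrow> (\<lambda>x. p x - q x) \<in> W"
proof -
  show "p \<in> W \<Longrightarrow> q \<in> W \<Longrightarrow> (\<lambda>x. p x - q x) \<in> W"
  proof -
    assume "p \<in> W" "q \<in> W"
    then have "(\<lambda>x. p x + (- 1) *\<^sub>R q x) \<in> W" using assms unfolding continuous_subspace_def by fast
    then show ?thesis by simp
  qed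
qed (use assms in \<open>auto simp: continuous_subspace_def\<close>)

text \<open>Collects what cell and face integrals have in common. Definiteness is pointwise on
  \<open>X\<close> instead of almost everywhere, as equality of restricted functions requires; it
  holds because a cell is open in space and a face in its plane.\<close>

locale continuous_L2 =
  fixes M :: "'a::euclidean_space measure" and X :: "'a set"
  assumes space_eq: "space M = X"
    and integrable: "\<And>g::'a \<Rightarrow> real. continuous_on UNIV g \<Longrightarrow> integrable M g"
    and definite: "\<And>(g::'a \<Rightarrow> real) x. continuous_on UNIV g \<Longrightarrow> (\<And>y. 0 \<le> g y) \<Longrightarrow>
      (\<integral>y. g y \<partial>M) = 0 \<Longrightarrow> x \<in> X \<Longrightarrow> g x = 0"
begin

lemma integral_cong_X: "(\<And>x. x \<in> X \<Longrightarrow> f x = g x) \<Longrightarrow> (\<integral>x. f x \<partial>M) = (\<integral>x. g x \<partial>M)"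
  by (rule Bochner_Integration.integral_cong) (auto simp: space_eq)

lemma integrable_inner:
  fixes f g :: "'a \<Rightarrow> 'b::euclidean_space"
  assumes "continuous_on UNIV f" "continuous_on UNIV g"
  shows "integrable M (\<lambda>x. f x \<bullet> g x)"
  by (intro integrable continuous_intros assms)

lemma inner_zero_imp_zero:
  fixes f :: "'a \<Rightarrow> 'b::euclidean_space"
  assumes "continuous_on UNIV f" "(\<integral>x. f x \<bullet> f x \<partial>M) = 0" "x \<in> X"
  shows "f x = 0"
  using definite[of "\<lambda>x. f x \<bullet> f x" x] assms by (auto intro!: continuous_intros)

text \<open>Gram-Schmidt, one function at a time, for families that may be linearly dependent. The
  induction hypothesis is used twice: to make the new function orthogonal to the earlier ones, and
  to do the same with \<open>f\<close>.\<close>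

lemma projection_exists:
  fixes b :: "'j \<Rightarrow> 'a \<Rightarrow> 'b::euclidean_space"
  assumes "finite J" and b: "\<And>j. j \<in> J \<Longrightarrow> continuous_on UNIV (b j)" and "continuous_on UNIV f"
  shows "\<exists>c. \<forall>j\<in>J. (\<integral>x. (f x - (\<Sum>i\<in>J. c i *\<^sub>R b i x)) \<bullet> b j x \<partial>M) = 0"
  using assms
proof (induction J arbitrary: f)
  case (insert m J)
  obtain c where c: "\<forall>j\<in>J. (\<integral>x. (b m x - (\<Sum>i\<in>J. c i *\<^sub>R b i x)) \<bullet> b j x \<partial>M) = 0"
    using insert.IH[of "b m"] insert.prems by blast
  obtain d where d: "\<forall>j\<in>J. (\<integral>x. (f x - (\<Sum>i\<in>J. d i *\<^sub>R b i x)) \<bullet> b j x \<partial>M) = 0"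
    using insert.IH[of f] insert.prems by blast
  define r where "r x = b m x - (\<Sum>i\<in>J. c i *\<^sub>R b i x)" for x
  define e where "e x = f x - (\<Sum>i\<in>J. d i *\<^sub>R b i x)" for x
  have cont: "continuous_on UNIV r" "continuous_on UNIV e"
    unfolding r_def[abs_def] e_def[abs_def] using insert.prems by (auto intro!: continuous_intros)
  \<comment> \<open>If \<open>r\<close> has norm zero, it vanishes on \<open>X\<close>: there
    \<open>b m\<close> is a combination of the earlier functions, and the coefficient 0 is as good
    as any other.\<close>
  define t where "t = (if (\<integral>x. r x \<bullet> r x \<partial>M) = 0 then 0 else (\<integral>x. e x \<bullet> r x \<partial>M) / (\<integral>x. r x \<bullet> r x \<partial>M))"
  define h where "h x = e x - t *\<^sub>R r x" for x
  have conth: "continuous_on UNIV h"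
    unfolding h_def[abs_def] using cont by (auto intro!: continuous_intros)
  have hb: "(\<integral>x. h x \<bullet> b j x \<partial>M) = 0" if "j \<in> J" for j
  proof -
    have "(\<integral>x. h x \<bullet> b j x \<partial>M) = (\<integral>x. e x \<bullet> b j x - t * (r x \<bullet> b j x) \<partial>M)"
      by (simp add: h_def inner_diff_left)
    also have "\<dots> = (\<integral>x. e x \<bullet> b j x \<partial>M) - t * (\<integral>x. r x \<bullet> b j x \<partial>M)"
      using integrable_inner[OF cont(1), of "b j"] integrable_inner[OF cont(2), of "b j"]
        insert.prems that by (subst Bochner_Integration.integral_diff) auto
    finally show ?thesis using c d that by (simp add: e_def r_def)
  qed
  have er: "(\<integral>x. e x \<bullet> r x \<partial>M) = 0" if "(\<integral>x. r x \<bullet> r x \<partial>M) = 0"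
  proof -
    have "r x = 0" if "x \<in> X" for x
      using inner_zero_imp_zero[OF cont(1)] \<open>(\<integral>x. r x \<bullet> r x \<partial>M) = 0\<close> that by blast
    then have "(\<integral>x. e x \<bullet> r x \<partial>M) = (\<integral>x. 0 \<partial>M)" by (intro integral_cong_X) auto
    then show ?thesis by simp
  qed
  have hr: "(\<integral>x. h x \<bullet> r x \<partial>M) = 0"
  proof -
    have "(\<integral>x. h x \<bullet> r x \<partial>M) = (\<integral>x. e x \<bullet> r x - t * (r x \<bullet> r x) \<partial>M)"
      by (simp add: h_def inner_diff_left)
    also have "\<dots> = (\<integral>x. e x \<bullet> r x \<partial>M) - t * (\<integral>x. r x \<bullet> r x \<partial>M)"
      using integrable_inner[OF cont(1) cont(1)] integrable_inner[OF cont(2) cont(1)]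
      by (subst Bochner_Integration.integral_diff) auto
    finally show ?thesis using er by (auto simp: t_def)
  qed
  have "(\<integral>x. h x \<bullet> b m x \<partial>M) = (\<integral>x. h x \<bullet> r x + (\<Sum>i\<in>J. c i * (h x \<bullet> b i x)) \<partial>M)"
    by (simp add: r_def inner_diff_right inner_sum_right)
  also have "\<dots> = 0"
    using hr hb integrable_inner[OF conth cont(1)] integrable_inner[OF conth] insert.prems
    by (subst Bochner_Integration.integral_add) auto
  finally have hm: "(\<integral>x. h x \<bullet> b m x \<partial>M) = 0" .
  \<comment> \<open>The residual \<open>h\<close> expanded in the original functions: removing
    \<open>t\<close> times \<open>r\<close> uses \<open>t\<close> times \<open>b m\<close> and
    lowers each earlier coefficient by \<open>t * c i\<close>.\<close>
  define a where "a i = (if i = m then t else d i - t * c i)" for i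
  have "f x - (\<Sum>i\<in>insert m J. a i *\<^sub>R b i x) = h x" for x
  proof -
    have "(\<Sum>i\<in>J. a i *\<^sub>R b i x) = (\<Sum>i\<in>J. d i *\<^sub>R b i x) - t *\<^sub>R (\<Sum>i\<in>J. c i *\<^sub>R b i x)"
      unfolding scaleR_sum_right sum_subtractf[symmetric]
      by (rule sum.cong) (use insert.hyps in \<open>auto simp: a_def scaleR_diff_left\<close>)
    then show ?thesis using insert.hyps
      by (simp add: h_def e_def r_def a_def algebra_simps)
  qed
  then show ?case using hb hm by (intro exI[of _ a]) auto
qed simp

lemma projection_on_range_exists:
  fixes b :: "'j \<Rightarrow> 'a \<Rightarrow> 'b::euclidean_space"
  assumes "finite J" and b: "\<And>j. j \<in> J \<Longrightarrow> continuous_on UNIV (b j)" and f: "continuous_on UNIV f"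
    and W: "W = {\<lambda>x. \<Sum>j\<in>J. c j *\<^sub>R b j x | c. True}"
  shows "\<exists>p\<in>W. \<forall>w\<in>W. (\<integral>x. (f x - p x) \<bullet> w x \<partial>M) = 0"
proof -
  obtain c where c: "\<forall>j\<in>J. (\<integral>x. (f x - (\<Sum>i\<in>J. c i *\<^sub>R b i x)) \<bullet> b j x \<partial>M) = 0"
    using projection_exists[OF assms(1), of b f] b f by blast
  define p where "p x = (\<Sum>i\<in>J. c i *\<^sub>R b i x)" for x
  have "continuous_on UNIV (\<lambda>x. f x - p x)"
    unfolding p_def using f b by (auto intro!: continuous_intros)
  from integrable_inner[OF this b]
  have int: "integrable M (\<lambda>x. (f x - p x) \<bullet> b j x)" if "j \<in> J" for j using that by blast
  have "(\<integral>x. (f x - p x) \<bullet> (\<Sum>j\<in>J. d j *\<^sub>R b j x) \<partial>M) = 0" for d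
  proof -
    have "(\<integral>x. (f x - p x) \<bullet> (\<Sum>j\<in>J. d j *\<^sub>R b j x) \<partial>M) =
        (\<Sum>j\<in>J. d j * (\<integral>x. (f x - p x) \<bullet> b j x \<partial>M))"
      using int by (simp add: inner_sum_right)
    also have "\<dots> = 0" using c by (simp add: p_def)
    finally show ?thesis .
  qed
  then show ?thesis unfolding W
    by (intro bexI[of _ p]) (auto simp: p_def[abs_def])
qed

lemma orthogonal_unique:
  fixes p q :: "'a \<Rightarrow> 'b::euclidean_space"
  assumes W: "continuous_subspace W" and "p \<in> W" "q \<in> W" "x \<in> X"
    and eq: "\<And>w. w \<in> W \<Longrightarrow> (\<integral>x. p x \<bullet> w x \<partial>M) = (\<integral>x. q x \<bullet> w x \<partial>M)"
  shows "p x = q x"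
proof -
  note cont = continuous_subspaceD(1)[OF W]
  define d where "d y = p y - q y" for y
  have d: "d \<in> W" unfolding d_def[abs_def] using continuous_subspaceD(5)[OF W assms(2,3)] .
  have "(\<integral>x. d x \<bullet> d x \<partial>M) = (\<integral>x. p x \<bullet> d x - q x \<bullet> d x \<partial>M)"
    by (simp add: d_def inner_diff_left)
  also have "\<dots> = 0"
    by (subst Bochner_Integration.integral_diff)
      (use eq[OF d] in \<open>auto intro!: integrable_inner cont[OF d] cont[OF assms(2)] cont[OF assms(3)]\<close>)
  finally show ?thesis
    using inner_zero_imp_zero[OF cont[OF d]] assms(4) by (auto simp: d_def)
qed

text \<open>Evaluates the definite description. Only the values of \<open>f\<close> on
  \<open>X\<close> enter its integrals, while integrability needs a function continuous on the whole
  space; \<open>f'\<close> supplies it, for instance when \<open>f\<close> is a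
  \<open>closure_ext\<close> or a restriction.\<close>

lemma L2_proj_eq:
  fixes f :: "'a \<Rightarrow> 'b::euclidean_space"
  assumes W: "continuous_subspace W" and p: "p \<in> W"
    and f: "continuous_on UNIV f'" "\<And>x. x \<in> X \<Longrightarrow> f x = f' x"
    and orth: "\<And>w. w \<in> W \<Longrightarrow> (\<integral>x. (f' x - p x) \<bullet> w x \<partial>M) = 0"
  shows "L2_proj M ((\<lambda>p. restrict p X) ` W) f = restrict p X"
  unfolding L2_proj_def
proof (rule the_equality, intro conjI ballI)
  show "restrict p X \<in> (\<lambda>p. restrict p X) ` W" using p by blast
next
  fix w assume "w \<in> (\<lambda>p. restrict p X) ` W"
  then obtain w' where w: "w = restrict w' X" "w' \<in> W" by blast
  have "(\<integral>x. (f x - restrict p X x) \<bullet> w x \<partial>M) = (\<integral>x. (f' x - p x) \<bullet> w' x \<partial>M)"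
    by (rule integral_cong_X) (simp add: w f)
  then show "(\<integral>x. (f x - restrict p X x) \<bullet> w x \<partial>M) = 0" using orth[OF w(2)] by simp
next
  fix q assume q: "q \<in> (\<lambda>p. restrict p X) ` W \<and>
    (\<forall>w\<in>(\<lambda>p. restrict p X) ` W. (\<integral>x. (f x - q x) \<bullet> w x \<partial>M) = 0)"
  then obtain q' where q': "q = restrict q' X" "q' \<in> W" by blast
  note cont = continuous_subspaceD(1)[OF W]
  define d where "d x = p x - q' x" for x
  have d: "d \<in> W" unfolding d_def[abs_def] using continuous_subspaceD(5)[OF W p q'(2)] .
  have "(\<integral>x. (f x - q x) \<bullet> restrict d X x \<partial>M) = (\<integral>x. (f' x - q' x) \<bullet> d x \<partial>M)"
    by (rule integral_cong_X) (simp add: q' f)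
  then have 1: "(\<integral>x. (f' x - q' x) \<bullet> d x \<partial>M) = 0" using q d by force
  have "(\<integral>x. d x \<bullet> d x \<partial>M) = (\<integral>x. (f' x - q' x) \<bullet> d x - (f' x - p x) \<bullet> d x \<partial>M)"
    by (simp add: d_def inner_diff_left)
  also have "\<dots> = 0"
    by (subst Bochner_Integration.integral_diff)
      (use 1 orth[OF d] in \<open>auto intro!: integrable_inner continuous_intros f cont[OF d] cont[OF p] cont[OF q'(2)]\<close>)
  finally have "d x = 0" if "x \<in> X" for x
    using inner_zero_imp_zero[OF cont[OF d]] that by blast
  then show "q = restrict p X" unfolding q'(1) by (auto simp: d_def)
qed

end

section \<open>The divergence theorem on a polyhedral domain\<close>

text \<open>In dimension one: the function that equals \<open>g\<close> on \<open>S\<close>, corrected by a jump of size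
  \<open>\<plusminus>g\<close> at each end point of \<open>S\<close>, is continuous and is a primitive of \<open>g'\<close> times the
  indicator function of \<open>S\<close>.\<close>

lemma integral_derivative_open_set:
  fixes S :: "real set" and g g' \<sigma> :: "real \<Rightarrow> real"
  assumes "open S" "bounded S" "finite A" "frontier S \<subseteq> A"
    and g: "\<And>x. (g has_real_derivative g' x) (at x)"
    and \<sigma>: "\<And>a. a \<in> A \<Longrightarrow> a \<notin> S \<and>
      (\<sigma> a = 1 \<and> (\<forall>\<^sub>F x in at_left a. x \<in> S) \<and> (\<forall>\<^sub>F x in at_right a. x \<notin> S) \<or>
       \<sigma> a = - 1 \<and> (\<forall>\<^sub>F x in at_left a. x \<notin> S) \<and> (\<forall>\<^sub>F x in at_right a. x \<in> S))"
  shows "((\<lambda>x. indicator S x * g' x) has_integral (\<Sum>a\<in>A. \<sigma> a * g a)) UNIV"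
proof -
  \<comment> \<open>The comparison is weak at a right end and strict at a left end because
    \<open>S\<close> omits its end points. At a right end the indicator is already 0 and the jump
    must supply the limit \<open>g a\<close>; at a left end the value 0 from outside must persist at
    \<open>a\<close> itself.\<close>
  define J where "J a x = (if \<sigma> a = 1 then (if a \<le> x then g a else 0) else
    (if a < x then - g a else 0))" for a x
  define H where "H x = indicator S x * g x + (\<Sum>a\<in>A. J a x)" for x
  have gcont: "(g \<longlongrightarrow> g x) (at x within U)" for x U
    using DERIV_isCont[OF g[of x]] by (auto simp: isCont_def intro: tendsto_within_subset)
  have Jloc: "\<forall>\<^sub>F y in nhds x. J a y = J a x" if "a \<noteq> x" for a x
  proof (cases "a < x")
    case True
    then have "\<forall>\<^sub>F y in nhds x. a < y" by (rule order_tendstoD(1)[OF filterlim_ident])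
    then show ?thesis by eventually_elim (use True in \<open>auto simp: J_def\<close>)
  next
    case False
    then have "\<forall>\<^sub>F y in nhds x. y < a" using that by (intro order_tendstoD(2)[OF filterlim_ident]) auto
    then show ?thesis by eventually_elim (use False that in \<open>auto simp: J_def\<close>)
  qed
  have Sloc: "\<forall>\<^sub>F y in nhds x. indicator S y = (indicator S x :: real)" if "x \<notin> A" for x
  proof -
    have "x \<notin> frontier S" using that assms by auto
    then consider "x \<in> S" | "x \<notin> closure S"
      using \<open>open S\<close> by (auto simp: frontier_def interior_open)
    then show ?thesis
    proof cases
      case 1
      then have "\<forall>\<^sub>F y in nhds x. y \<in> S" using \<open>open S\<close> by (intro eventually_nhds_in_open)
      then show ?thesis by eventually_elim (use 1 in auto)
    next
      case 2
      then have "\<forall>\<^sub>F y in nhds x. y \<in> - closure S" by (intro eventually_nhds_in_open) auto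
      then show ?thesis
        by eventually_elim (use 2 closure_subset[of S] in \<open>auto simp: indicator_def\<close>)
    qed
  qed
  have Hloc: "\<forall>\<^sub>F y in nhds x. H y = indicator S x * g y + (\<Sum>a\<in>A. J a x)" if "x \<notin> A" for x
  proof -
    have "\<forall>\<^sub>F y in nhds x. \<forall>a\<in>A. J a y = J a x"
      using that \<open>finite A\<close> by (intro eventually_ball_finite ballI Jloc) auto
    with Sloc[OF that] show ?thesis by eventually_elim (simp add: H_def)
  qed
  have Hder: "(H has_real_derivative indicator S x * g' x) (at x)" if "x \<notin> A" for x
  proof -
    have "((\<lambda>y. indicator S x * g y + (\<Sum>a\<in>A. J a x)) has_real_derivative indicator S x * g' x) (at x)"
      using g[of x] by (auto intro!: derivative_eq_intros)
    then show ?thesis using Hloc[OF that] DERIV_cong_ev[OF refl Hloc[OF that] refl] by simp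
  qed
  have Hcont: "isCont H x" for x
  proof (cases "x \<in> A")
    case False
    then show ?thesis using Hder DERIV_isCont by blast
  next
    case True
    have rest: "((\<lambda>y. \<Sum>a\<in>A - {x}. J a y) \<longlongrightarrow> (\<Sum>a\<in>A - {x}. J a x)) (at x within U)" for U
    proof -
      have "\<forall>\<^sub>F y in nhds x. \<forall>a\<in>A - {x}. J a y = J a x"
        using \<open>finite A\<close> by (intro eventually_ball_finite ballI Jloc) auto
      then have "\<forall>\<^sub>F y in nhds x. (\<Sum>a\<in>A - {x}. J a y) = (\<Sum>a\<in>A - {x}. J a x)"
        by eventually_elim simp
      then have "\<forall>\<^sub>F y in at x within U. (\<Sum>a\<in>A - {x}. J a y) = (\<Sum>a\<in>A - {x}. J a x)"
        by (auto simp: eventually_at_filter elim: eventually_mono)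
      then show ?thesis by (rule tendsto_eventually)
    qed
    have Hx: "H y = (indicator S y * g y + J x y) + (\<Sum>a\<in>A - {x}. J a y)" for y
      using True \<open>finite A\<close> by (simp add: H_def sum.remove[of A x])
    have lim: "((\<lambda>y. indicator S y * g y + J x y) \<longlongrightarrow> indicator S x * g x + J x x) (at_left x)"
      "((\<lambda>y. indicator S y * g y + J x y) \<longlongrightarrow> indicator S x * g x + J x x) (at_right x)"
    proof -
      have lt: "\<forall>\<^sub>F y in at_left x. y < x" and gt: "\<forall>\<^sub>F y in at_right x. x < y"
        by (auto simp: eventually_at_filter)
      from \<sigma>[OF True] consider
        "x \<notin> S" "\<sigma> x = 1" "\<forall>\<^sub>F y in at_left x. y \<in> S" "\<forall>\<^sub>F y in at_right x. y \<notin> S" |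
        "x \<notin> S" "\<sigma> x = - 1" "\<forall>\<^sub>F y in at_left x. y \<notin> S" "\<forall>\<^sub>F y in at_right x. y \<in> S" by blast
      then have "((\<lambda>y. indicator S y * g y + J x y) \<longlongrightarrow> indicator S x * g x + J x x) (at_left x) \<and>
        ((\<lambda>y. indicator S y * g y + J x y) \<longlongrightarrow> indicator S x * g x + J x x) (at_right x)"
      proof cases
        case 1
        have "\<forall>\<^sub>F y in at_left x. g y = indicator S y * g y + J x y"
          using 1(3) lt by eventually_elim (simp add: J_def 1)
        from Lim_transform_eventually[OF gcont this]
        have l: "((\<lambda>y. indicator S y * g y + J x y) \<longlongrightarrow> g x) (at_left x)" .
        have "\<forall>\<^sub>F y in at_right x. indicator S y * g y + J x y = g x"
          using 1(4) gt by eventually_elim (simp add: J_def 1)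
        from l tendsto_eventually[OF this] show ?thesis using 1 by (simp add: J_def)
      next
        case 2
        have l: "\<forall>\<^sub>F y in at_left x. indicator S y * g y + J x y = 0"
          using 2(3) lt by eventually_elim (simp add: J_def 2)
        have r: "\<forall>\<^sub>F y in at_right x. g y - g x = indicator S y * g y + J x y"
          using 2(4) gt by eventually_elim (simp add: J_def 2)
        have "((\<lambda>y. g y - g x) \<longlongrightarrow> g x - g x) (at_right x)"
          by (intro tendsto_intros gcont)
        from tendsto_eventually[OF l] Lim_transform_eventually[OF this r]
        show ?thesis using 2 by (simp add: J_def)
      qed
      then show "((\<lambda>y. indicator S y * g y + J x y) \<longlongrightarrow> indicator S x * g x + J x x) (at_left x)"
        "((\<lambda>y. indicator S y * g y + J x y) \<longlongrightarrow> indicator S x * g x + J x x) (at_right x)" by auto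
    qed
    have "(H \<longlongrightarrow> H x) (at_left x)" "(H \<longlongrightarrow> H x) (at_right x)"
      unfolding Hx[abs_def] by (intro tendsto_add lim rest)+
    then show ?thesis by (simp add: isCont_def filterlim_at_split)
  qed
  have "bounded (S \<union> A)" using assms by (simp add: finite_imp_bounded)
  then obtain R where R: "\<And>x. x \<in> S \<union> A \<Longrightarrow> \<bar>x\<bar> \<le> R"
    unfolding bounded_iff by (auto simp del: Un_iff)
  \<comment> \<open>\<open>B\<close> exceeds the modulus of every point of \<open>S\<close> and
    \<open>A\<close>: at \<open>- B\<close> no jump has occurred yet, at \<open>B\<close> all of
    them have.\<close>
  define B where "B = \<bar>R\<bar> + 1"
  have B: "- B < x \<and> x < B" if "x \<in> S \<union> A" for x using R[OF that] by (auto simp: B_def)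
  have SB: "- B \<notin> S" "B \<notin> S" using B[of B] B[of "-B"] by auto
  have "((\<lambda>x. indicator S x * g' x) has_integral (H B - H (- B))) {- B..B}"
  proof (rule fundamental_theorem_of_calculus_interior_strong[OF \<open>finite A\<close>])
    show "- B \<le> B" by (simp add: B_def)
    show "continuous_on {- B..B} H" using Hcont by (simp add: continuous_at_imp_continuous_on)
    show "(H has_vector_derivative indicator S x * g' x) (at x)" if "x \<in> {- B<..<B} - A" for x
      using Hder that by (simp add: has_real_derivative_iff_has_vector_derivative)
  qed
  moreover have "H (- B) = 0"
    using B SB by (force simp: H_def J_def intro!: sum.neutral)
  moreover have "H B = (\<Sum>a\<in>A. \<sigma> a * g a)"
  proof -
    have "J a B = \<sigma> a * g a" if "a \<in> A" for a
      using \<sigma>[OF that] B[of a] that by (auto simp: J_def)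
    then show ?thesis using SB by (simp add: H_def)
  qed
  ultimately have I: "((\<lambda>x. indicator S x * g' x) has_integral (\<Sum>a\<in>A. \<sigma> a * g a)) {- B..B}"
    by simp
  have "(\<lambda>x. if x \<in> {- B..B} then indicator S x * g' x else 0) = (\<lambda>x. indicator S x * g' x)"
    using B by (force simp: indicator_def)
  then show ?thesis
    using I has_integral_restrict_UNIV[of "{- B..B}" "\<lambda>x. indicator S x * g' x"] by metis
qed

text \<open>Subtracting the height from the Lipschitz function gives a continuous \<open>\<psi>\<close> with
  \<open>\<psi> (y + t e) = \<psi> y + t\<close>, negative exactly on \<open>T\<close> and zero on the face; so \<open>\<psi>\<close> is affine
  near \<open>x\<close>.\<close>

lemma half_ball:
  fixes T :: "'a::euclidean_space set"
  assumes "lipschitz_boundary T" "open T" "x \<in> F" "F \<subseteq> frontier T"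
    and plane: "0 < r" "\<And>y. dist x y < r \<Longrightarrow> (y - x) \<bullet> \<nu> = 0 \<Longrightarrow> y \<in> F"
  obtains \<rho> s where "\<rho> > 0" "s = 1 \<or> s = - 1"
    "\<And>y. dist x y < \<rho> \<Longrightarrow> y \<in> T \<longleftrightarrow> s * ((y - x) \<bullet> \<nu>) < 0"
proof -
  have "x \<in> frontier T" using assms by auto
  then obtain U e \<gamma> L where U: "open U" "x \<in> U" and e: "norm e = 1"
    and \<gamma>: "L-lipschitz_on {y. y \<bullet> e = 0} \<gamma>"
    and TU: "T \<inter> U = {y \<in> U. y \<bullet> e < \<gamma> (y - (y \<bullet> e) *\<^sub>R e)}"
    using assms(1) unfolding lipschitz_boundary_def by meson
  have ee: "e \<bullet> e = 1" using e by (simp add: dot_square_norm)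
  define \<psi> where "\<psi> y = y \<bullet> e - \<gamma> (y - (y \<bullet> e) *\<^sub>R e)" for y
  have \<psi>_shift: "\<psi> (y + t *\<^sub>R e) = \<psi> y + t" for y t
    by (simp add: \<psi>_def inner_add_left ee scaleR_add_left algebra_simps)
  have \<psi>_cont: "continuous_on UNIV \<psi>"
    unfolding \<psi>_def[abs_def]
    by (intro continuous_intros continuous_on_compose2[OF lipschitz_on_continuous_on[OF \<gamma>]])
      (auto simp: inner_diff_left ee)
  have TU': "y \<in> T \<longleftrightarrow> \<psi> y < 0" if "y \<in> U" for y using TU that by (auto simp: \<psi>_def)
  have \<psi>_zero: "\<psi> y = 0" if "y \<in> F" "y \<in> U" for y
  proof (rule antisym)
    have y: "y \<in> frontier T" using that assms by auto
    then have "y \<notin> T" using \<open>open T\<close> by (simp add: frontier_def interior_open)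
    then show "0 \<le> \<psi> y" using TU' that by force
    show "\<psi> y \<le> 0"
    proof (rule ccontr)
      assume "\<not> \<psi> y \<le> 0"
      then have "y \<in> U \<inter> \<psi> -` {0<..}" using that by auto
      moreover have "open (U \<inter> \<psi> -` {0<..})"
        using U(1) continuous_open_preimage[OF \<psi>_cont open_UNIV open_greaterThan[of 0]] by auto
      moreover have "y \<in> closure T" using y by (simp add: frontier_def)
      ultimately have "T \<inter> (U \<inter> \<psi> -` {0<..}) \<noteq> {}"
        using open_Int_closure_eq_empty[of "U \<inter> \<psi> -` {0<..}" T] by blast
      then show False using TU' by force
    qed
  qed
  obtain r1 where r1: "r1 > 0" "\<And>y. dist x y < r1 \<Longrightarrow> y \<in> U"
    using U unfolding open_contains_ball by (metis mem_ball subset_iff)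
  define d where "d = min r r1"
  have d: "d > 0" "\<And>y. dist x y < d \<Longrightarrow> y \<in> U" using r1 plane(1) by (auto simp: d_def)
  have dF: "y \<in> F" if "dist x y < d" "(y - x) \<bullet> \<nu> = 0" for y
    using plane(2)[of y] that by (auto simp: d_def)
  define c where "c = e \<bullet> \<nu>"
  \<comment> \<open>The direction \<open>e\<close> is not tangent to the face: a tangent step would
    stay in the face, where \<open>\<psi>\<close> is 0, although \<open>\<psi>\<close> grows at unit
    rate along \<open>e\<close>.\<close>
  have c: "c \<noteq> 0"
  proof
    assume "c = 0"
    define y where "y = x + (d / 2) *\<^sub>R e"
    have "dist x y < d" using d e by (simp add: y_def dist_norm)
    moreover have "(y - x) \<bullet> \<nu> = 0" using \<open>c = 0\<close> by (simp add: y_def c_def)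
    ultimately have "\<psi> y = 0" using d dF \<psi>_zero by blast
    moreover have "\<psi> y = d / 2" using \<psi>_shift \<psi>_zero[OF assms(3) U(2)] by (simp add: y_def)
    ultimately show False using d by simp
  qed
  have cauchy: "\<bar>(y - x) \<bullet> \<nu>\<bar> \<le> dist x y * norm \<nu>" for y
    using Cauchy_Schwarz_ineq2[of "y - x" \<nu>] by (simp add: dist_norm norm_minus_commute)
  \<comment> \<open>Moving \<open>y\<close> along \<open>e\<close> into the plane of the face costs
    at most \<open>norm \<nu> / \<bar>c\<bar>\<close> times its distance from \<open>x\<close>. The
    point reached is thus within \<open>K\<close> times that distance, and the radius
    \<open>d / K\<close> keeps it in the disc contained in \<open>F\<close>.\<close>
  define K where "K = 1 + norm \<nu> / \<bar>c\<bar>"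
  have K: "K \<ge> 1" by (simp add: K_def)
  define \<rho> where "\<rho> = d / K"
  have \<rho>: "\<rho> > 0" "\<rho> \<le> d" using d K by (auto simp: \<rho>_def divide_le_eq)
  have \<psi>: "\<psi> y = ((y - x) \<bullet> \<nu>) / c" if "dist x y < \<rho>" for y
  proof -
    define t where "t = - ((y - x) \<bullet> \<nu>) / c"
    define z where "z = y + t *\<^sub>R e"
    have "\<bar>t\<bar> \<le> dist x y * (norm \<nu> / \<bar>c\<bar>)"
      using cauchy[of y] c by (simp add: t_def abs_div divide_right_mono)
    moreover have "dist x z \<le> dist x y + \<bar>t\<bar>"
      using dist_triangle[of x z y] e by (simp add: z_def dist_norm)
    ultimately have "dist x z \<le> dist x y * K" by (simp add: K_def algebra_simps)
    also have "\<dots> < d" using that K by (simp add: \<rho>_def field_simps)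
    finally have zd: "dist x z < d" .
    have "(z - x) \<bullet> \<nu> = (y - x) \<bullet> \<nu> + t * c"
      by (simp add: z_def c_def inner_diff_left inner_add_left)
    also have "\<dots> = 0" using c by (simp add: t_def)
    finally have "\<psi> z = 0" using zd d dF \<psi>_zero by blast
    then show ?thesis using \<psi>_shift[of y t] by (simp add: z_def t_def)
  qed
  have mem: "y \<in> T \<longleftrightarrow> sgn c * ((y - x) \<bullet> \<nu>) < 0" if "dist x y < \<rho>" for y
  proof -
    have "y \<in> T \<longleftrightarrow> ((y - x) \<bullet> \<nu>) / c < 0" using TU'[of y] d(2)[of y] that \<rho>(2) \<psi>[OF that] by auto
    then show ?thesis using c by (auto simp: sgn_if divide_less_0_iff)
  qed
  show ?thesis
    by (rule that[of \<rho> "sgn c"]) (use \<rho> c mem in \<open>auto simp: sgn_if\<close>)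
qed

section \<open>Faces: their planes and the side on which the domain lies\<close>

text \<open>The relative interior is open in the affine hull of the triangles, so a nonempty face
  spans that same plane. It is contained in the plane given by the normal, and equal dimension makes
  the two coincide. Relative openness then becomes a disc around each point.\<close>

lemma face_plane:
  assumes F: "planar_polygon F" "unit_normal F \<nu>" "x \<in> F"
  shows "affine hull F = {y. (y - x) \<bullet> \<nu> = 0}"
    and "\<exists>r>0. \<forall>y. dist x y < r \<longrightarrow> (y - x) \<bullet> \<nu> = 0 \<longrightarrow> y \<in> F"
    and "openin (top_of_set (affine hull F)) F"
proof -
  obtain \<T> where \<T>: "aff_dim (\<Union>\<T>) = 2" "F = rel_interior (\<Union>\<T>)"
    using F(1) unfolding planar_polygon_def by auto
  have \<nu>: "\<nu> \<noteq> 0" "\<And>y. y \<in> F \<Longrightarrow> (y - x) \<bullet> \<nu> = 0"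
    using F(2,3) unfolding unit_normal_def by auto
  have op: "openin (top_of_set (affine hull \<Union>\<T>)) F" unfolding \<T>(2) by (rule openin_rel_interior)
  then have hull: "affine hull F = affine hull \<Union>\<T>"
    using affine_hull_openin[OF op] F(3) by (auto simp: hull_hull)
  have H: "{y. (y - x) \<bullet> \<nu> = 0} = {y. \<nu> \<bullet> y = \<nu> \<bullet> x}"
    by (auto simp: inner_diff_right inner_commute)
  show eq: "affine hull F = {y. (y - x) \<bullet> \<nu> = 0}"
  proof (rule affine_dim_equal)
    show "affine {y. (y - x) \<bullet> \<nu> = 0}" unfolding H by (rule affine_hyperplane)
    then show "affine hull F \<subseteq> {y. (y - x) \<bullet> \<nu> = 0}" using \<nu> by (intro hull_minimal) auto
    show "aff_dim (affine hull F) = aff_dim {y. (y - x) \<bullet> \<nu> = 0}"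
      unfolding H hull using \<T>(1) \<nu> by (simp add: aff_dim_affine_hull)
    show "affine hull F \<noteq> {}" using F(3) by auto
  qed auto
  show "openin (top_of_set (affine hull F)) F" using op hull by simp
  then show "\<exists>r>0. \<forall>y. dist x y < r \<longrightarrow> (y - x) \<bullet> \<nu> = 0 \<longrightarrow> y \<in> F"
    using F(3) unfolding openin_euclidean_subtopology_iff eq dist_commute[of x] by blast
qed

text \<open>The far side of the plane, within the ball, is open and misses \<open>T\<close>, hence
  misses the closure as well.\<close>

lemma half_ball_exterior:
  fixes T :: "'a::euclidean_space set"
  assumes "\<And>y. dist x y < \<rho> \<Longrightarrow> y \<in> T \<longleftrightarrow> s * ((y - x) \<bullet> \<nu>) < 0"
    and "dist x y < \<rho>" "s * ((y - x) \<bullet> \<nu>) > 0"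
  shows "y \<notin> closure T"
proof -
  define W where "W = ball x \<rho> \<inter> {y. s * ((y - x) \<bullet> \<nu>) > 0}"
  have "open W" unfolding W_def
    by (intro open_Int open_ball open_Collect_less continuous_intros)
  moreover have "W \<inter> T = {}" using assms(1) by (force simp: W_def)
  ultimately have "W \<inter> closure T = {}" using open_Int_closure_eq_empty by blast
  then show ?thesis using assms(2,3) by (auto simp: W_def)
qed

text \<open>\<open>half_ball\<close> yields a sign at each point separately. Moving within the face
  does not change the half-space, so the points with a given sign form a relatively open set; the
  two signs exclude each other, and a connected face carries only one. This permits the comparison
  with \<open>points_out\<close>, a condition on all points of the face.\<close>

lemma orientation_half_ball:
  assumes T: "lipschitz_boundary T" "open T"
    and F: "planar_polygon F" "F \<subseteq> frontier T" "unit_normal F (n F)" "x \<in> F"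
  shows "\<exists>\<rho>>0. \<forall>y. dist x y < \<rho> \<longrightarrow> (y \<in> T \<longleftrightarrow> orientation T n F * ((y - x) \<bullet> n F) < 0)"
proof -
  define \<nu> where "\<nu> = n F"
  have \<nu>: "norm \<nu> = 1" "\<And>x y. x \<in> F \<Longrightarrow> y \<in> F \<Longrightarrow> (y - x) \<bullet> \<nu> = 0"
    using F(3) by (auto simp: \<nu>_def unit_normal_def)
  define Q where "Q s z \<longleftrightarrow> (\<exists>\<rho>>0. \<forall>y. dist z y < \<rho> \<longrightarrow> (y \<in> T \<longleftrightarrow> s * ((y - z) \<bullet> \<nu>) < 0))"
    for s :: real and z
  have total: "Q 1 z \<or> Q (- 1) z" if z: "z \<in> F" for z
  proof -
    obtain r where "r > 0" "\<And>y. dist z y < r \<Longrightarrow> (y - z) \<bullet> \<nu> = 0 \<Longrightarrow> y \<in> F"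
      using face_plane(2)[OF F(1,3) z] unfolding \<nu>_def by blast
    then obtain \<rho> s where "\<rho> > 0" "s = 1 \<or> s = - 1"
      "\<And>y. dist z y < \<rho> \<Longrightarrow> y \<in> T \<longleftrightarrow> s * ((y - z) \<bullet> \<nu>) < 0"
      using half_ball[OF T z F(2), of r \<nu>] by metis
    then show ?thesis unfolding Q_def by blast
  qed
  have excl: "\<not> (Q 1 z \<and> Q (- 1) z)" for z
  proof
    assume "Q 1 z \<and> Q (- 1) z"
    then obtain \<rho>1 \<rho>2 where \<rho>: "\<rho>1 > 0" "\<rho>2 > 0"
      "\<And>y. dist z y < \<rho>1 \<Longrightarrow> y \<in> T \<longleftrightarrow> 1 * ((y - z) \<bullet> \<nu>) < 0"
      "\<And>y. dist z y < \<rho>2 \<Longrightarrow> y \<in> T \<longleftrightarrow> - 1 * ((y - z) \<bullet> \<nu>) < 0" unfolding Q_def by metis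
    define y where "y = z + (min \<rho>1 \<rho>2 / 2) *\<^sub>R \<nu>"
    have "dist z y = min \<rho>1 \<rho>2 / 2" using \<nu> \<rho> by (simp add: y_def dist_norm)
    moreover have "(y - z) \<bullet> \<nu> = min \<rho>1 \<rho>2 / 2" using \<nu> by (simp add: y_def dot_square_norm)
    ultimately show False using \<rho>(1,2) \<rho>(3,4)[of y] by (auto simp: min_def split: if_splits)
  qed
  have op: "openin (top_of_set F) {z \<in> F. Q s z}" for s
    unfolding openin_euclidean_subtopology_iff
  proof (intro conjI ballI)
    fix z assume "z \<in> {z \<in> F. Q s z}"
    then obtain \<rho> where z: "z \<in> F" and \<rho>: "\<rho> > 0"
      "\<And>y. dist z y < \<rho> \<Longrightarrow> y \<in> T \<longleftrightarrow> s * ((y - z) \<bullet> \<nu>) < 0" unfolding Q_def by blast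
    have "Q s w" if w: "w \<in> F" "dist w z < \<rho> / 2" for w
      unfolding Q_def
    proof (intro exI[of _ "\<rho> / 2"] conjI allI impI)
      fix y assume "dist w y < \<rho> / 2"
      then have "dist z y < \<rho>" using w dist_triangle[of z y w] by (simp add: dist_commute)
      moreover have "(y - w) \<bullet> \<nu> = (y - z) \<bullet> \<nu>"
        using \<nu>(2)[OF w(1) z] by (simp add: inner_diff_left)
      ultimately show "y \<in> T \<longleftrightarrow> s * ((y - w) \<bullet> \<nu>) < 0" using \<rho>(2) by simp
    qed (use \<rho> in simp)
    then show "\<exists>e>0. \<forall>x'\<in>F. dist x' z < e \<longrightarrow> x' \<in> {z \<in> F. Q s z}"
      using \<rho>(1) by (intro exI[of _ "\<rho> / 2"]) auto
  qed auto
  have "connected F" using F(1) by (simp add: planar_polygon_def)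
  then have "{z \<in> F. Q 1 z} = {} \<or> {z \<in> F. Q (- 1) z} = {}"
    unfolding connected_openin using op[of 1] op[of "- 1"] total excl by blast
  then consider "\<And>z. z \<in> F \<Longrightarrow> Q 1 z" | "\<And>z. z \<in> F \<Longrightarrow> Q (- 1) z" using total by blast
  then have "Q (orientation T n F) x"
  proof cases
    case 1
    have "\<forall>\<^sub>F t in at_right 0. z + t *\<^sub>R \<nu> \<notin> closure T" if z: "z \<in> F" for z
    proof -
      obtain \<rho> where \<rho>: "\<rho> > 0" "\<And>y. dist z y < \<rho> \<Longrightarrow> y \<in> T \<longleftrightarrow> 1 * ((y - z) \<bullet> \<nu>) < 0"
        using 1[OF z] unfolding Q_def by blast
      have "z + t *\<^sub>R \<nu> \<notin> closure T" if "0 < t" "t < \<rho>" for t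
        by (rule half_ball_exterior[OF \<rho>(2)]) (use \<nu> that in \<open>auto simp: dist_norm dot_square_norm\<close>)
      then show ?thesis using \<rho>(1) by (auto simp: eventually_at_right_field)
    qed
    then have "points_out T F (n F)" by (simp add: points_out_def \<nu>_def)
    then show ?thesis using 1 F(4) by (simp add: orientation_def)
  next
    case 2
    obtain \<rho> where \<rho>: "\<rho> > 0" "\<And>y. dist x y < \<rho> \<Longrightarrow> y \<in> T \<longleftrightarrow> - 1 * ((y - x) \<bullet> \<nu>) < 0"
      using 2[OF F(4)] unfolding Q_def by blast
    have "x + t *\<^sub>R \<nu> \<in> closure T" if "0 < t" "t < \<rho>" for t
    proof -
      have "x + t *\<^sub>R \<nu> \<in> T"
        using \<nu> that by (subst \<rho>(2)) (auto simp: dist_norm dot_square_norm)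
      then show ?thesis using closure_subset by blast
    qed
    then have "\<forall>\<^sub>F t in at_right 0. x + t *\<^sub>R \<nu> \<in> closure T"
      using \<rho>(1) by (auto simp: eventually_at_right_field)
    \<comment> \<open>Being eventually inside excludes being eventually outside only because the
      filter is nontrivial.\<close>
    moreover have "(at_right (0::real)) \<noteq> bot" by simp
    ultimately have "\<not> (\<forall>\<^sub>F t in at_right 0. x + t *\<^sub>R \<nu> \<notin> closure T)"
      using eventually_conj eventually_False by fastforce
    then have "\<not> points_out T F (n F)" using F(4) by (auto simp: points_out_def \<nu>_def)
    then show ?thesis using 2 F(4) by (simp add: orientation_def)
  qed
  then show ?thesis by (simp add: Q_def \<nu>_def)
qed

section \<open>Fubini's theorem in the direction of one coordinate\<close>

text \<open>Coordinate \<open>i\<close> is separated from the other two, which are kept as a point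
  of the plane; the third index is implicit, as whatever differs from \<open>i\<close> and
  \<open>j\<close>.\<close>

definition insert_coord :: "3 \<Rightarrow> 3 \<Rightarrow> real^2 \<Rightarrow> real \<Rightarrow> real^3" where
  "insert_coord i j s t = (\<chi> m. if m = i then t else if m = j then s $ 1 else s $ 2)"

definition drop_coord :: "3 \<Rightarrow> 3 \<Rightarrow> real^3 \<Rightarrow> real^2" where
  "drop_coord j k x = (\<chi> m. if m = 1 then x $ j else x $ k)"

lemma prod_Basis_cart:
  fixes f :: "real^'n \<Rightarrow> 'b::comm_monoid_mult"
  shows "(\<Prod>b\<in>Basis. f b) = (\<Prod>i\<in>UNIV. f (axis i 1))"
proof -
  have "(Basis::(real^'n) set) = (\<lambda>i. axis i 1) ` UNIV" by (auto simp: Basis_vec_def)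
  then have "(\<Prod>b\<in>Basis. f b) = (\<Prod>b\<in>(\<lambda>i. axis i 1) ` UNIV. f b)" by simp
  also have "\<dots> = (\<Prod>i\<in>UNIV. f (axis i 1))"
    by (subst prod.reindex) (auto simp: inj_on_def axis_eq_axis)
  finally show ?thesis .
qed

lemma mem_box_insert_coord:
  assumes "UNIV = {i, j, k :: 3}" "i \<noteq> j" "i \<noteq> k" "j \<noteq> k"
  shows "insert_coord i j s t \<in> box l u \<longleftrightarrow>
    s \<in> box (drop_coord j k l) (drop_coord j k u) \<and> t \<in> box (l $ i) (u $ i)"
proof -
  have all: "(\<forall>m. Q m) \<longleftrightarrow> Q i \<and> Q j \<and> Q k" for Q
    using assms(1) by (metis UNIV_I empty_iff insert_iff)
  show ?thesis
    using assms unfolding mem_box_cart all by (auto simp: insert_coord_def drop_coord_def forall_2)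
qed

lemma continuous_insert_coord [continuous_intros]:
  "continuous_on S f \<Longrightarrow> continuous_on S g \<Longrightarrow> continuous_on S (\<lambda>x. insert_coord i j (f x) (g x))"
  unfolding insert_coord_def
proof (rule continuous_on_vec_lambda)
  fix m assume "continuous_on S f" "continuous_on S g"
  then show "continuous_on S (\<lambda>x. if m = i then g x else if m = j then f x $ 1 else f x $ 2)"
    by (cases "m = i"; cases "m = j") (auto intro!: continuous_intros)
qed

lemma continuous_drop_coord [continuous_intros]:
  "continuous_on S f \<Longrightarrow> continuous_on S (\<lambda>x. drop_coord j k (f x))"
  unfolding drop_coord_def
proof (rule continuous_on_vec_lambda)
  fix m :: 2 assume "continuous_on S f"
  then show "continuous_on S (\<lambda>x. if m = 1 then f x $ j else f x $ k)"
    by (cases "m = 1") (auto intro!: continuous_intros)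
qed

text \<open>Boxes determine Lebesgue measure, and a box is the product of its shadow and an
  interval, in whichever order the coordinates are taken.\<close>

lemma distr_insert_coord:
  assumes "UNIV = {i, j, k :: 3}" "i \<noteq> j" "i \<noteq> k" "j \<noteq> k"
  shows "lborel = distr (lborel :: ((real^2) \<times> real) measure) borel (\<lambda>(s, t). insert_coord i j s t)"
proof (rule lborel_eqI)
  fix l u :: "real^3" assume le: "\<And>b. b \<in> Basis \<Longrightarrow> l \<bullet> b \<le> u \<bullet> b"
  have le': "l $ m \<le> u $ m" for m
    using le[of "axis m 1"] by (auto simp: inner_axis Basis_vec_def)
  have meas: "(\<lambda>(s, t). insert_coord i j s t) \<in> borel_measurable borel"
    unfolding case_prod_beta by (intro borel_measurable_continuous_onI continuous_intros)
  have "(\<lambda>(s, t). insert_coord i j s t) -` box l u =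
      box (drop_coord j k l) (drop_coord j k u) \<times> box (l $ i) (u $ i)"
    using mem_box_insert_coord[OF assms] by auto
  then have "emeasure (distr lborel borel (\<lambda>(s, t). insert_coord i j s t)) (box l u) =
      emeasure lborel (box (drop_coord j k l) (drop_coord j k u) \<times> box (l $ i) (u $ i))"
    using meas by (subst emeasure_distr) (simp_all add: measurable_lborel1)
  also have "\<dots> = emeasure lborel (box (drop_coord j k l) (drop_coord j k u)) *
      emeasure lborel (box (l $ i) (u $ i))"
    unfolding lborel_prod[symmetric] by (rule lborel.emeasure_pair_measure_Times) auto
  also have "\<dots> = ennreal ((u $ j - l $ j) * (u $ k - l $ k)) * ennreal (u $ i - l $ i)"
  proof -
    have "\<forall>b\<in>Basis. drop_coord j k l \<bullet> b \<le> drop_coord j k u \<bullet> b"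
      using le' by (auto simp: Basis_vec_def inner_axis drop_coord_def)
    then show ?thesis using le'[of i]
      by (simp add: prod_Basis_cart inner_axis UNIV_2 drop_coord_def box_real)
  qed
  also have "\<dots> = ennreal (\<Prod>b\<in>Basis. (u - l) \<bullet> b)"
  proof -
    have "(\<Prod>m\<in>UNIV. (u - l) $ m) = (u - l) $ i * ((u - l) $ j * (u - l) $ k)"
      unfolding assms(1) using assms(2-4) by simp
    then show ?thesis using le'
      by (simp add: prod_Basis_cart inner_axis ennreal_mult'[symmetric] mult.commute)
  qed
  finally show "emeasure (distr lborel borel (\<lambda>(s, t). insert_coord i j s t)) (box l u) =
    ennreal (\<Prod>b\<in>Basis. (u - l) \<bullet> b)" .
qed simp

lemma Fubini_insert_coord:
  fixes f :: "real^3 \<Rightarrow> real"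
  assumes "UNIV = {i, j, k :: 3}" "i \<noteq> j" "i \<noteq> k" "j \<noteq> k" and f: "integrable lborel f"
  shows "AE s in lborel. integrable lborel (\<lambda>t. f (insert_coord i j s t))"
    and "(\<integral>s. (\<integral>t. f (insert_coord i j s t) \<partial>lborel) \<partial>lborel) = (\<integral>x. f x \<partial>lborel)"
    and "integrable lborel (\<lambda>s. \<integral>t. f (insert_coord i j s t) \<partial>lborel)"
proof -
  have "(\<lambda>(s, t). insert_coord i j s t) \<in> borel_measurable borel"
    unfolding case_prod_beta by (intro borel_measurable_continuous_onI continuous_intros)
  then have meas: "(\<lambda>(s, t). insert_coord i j s t) \<in> lborel \<rightarrow>\<^sub>M borel" by simp
  have fm: "f \<in> borel_measurable borel" using f by auto
  have eq: "(\<lambda>z. f ((\<lambda>(s, t). insert_coord i j s t) z)) = (\<lambda>z. f (insert_coord i j (fst z) (snd z)))"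
    by (simp add: case_prod_beta)
  have int: "integrable (lborel \<Otimes>\<^sub>M lborel) (\<lambda>z. f (insert_coord i j (fst z) (snd z)))"
    using f integrable_distr_eq[OF meas fm] distr_insert_coord[OF assms(1-4)]
    unfolding lborel_prod eq by simp
  show "AE s in lborel. integrable lborel (\<lambda>t. f (insert_coord i j s t))"
    using lborel_pair.AE_integrable_fst'[OF int] by simp
  show "integrable lborel (\<lambda>s. \<integral>t. f (insert_coord i j s t) \<partial>lborel)"
    using lborel_pair.integrable_fst'[OF int] by simp
  show "(\<integral>s. (\<integral>t. f (insert_coord i j s t) \<partial>lborel) \<partial>lborel) = (\<integral>x. f x \<partial>lborel)"
    using lborel_pair.integral_fst'[OF int] integral_distr[OF meas fm]
      distr_insert_coord[OF assms(1-4)] unfolding lborel_prod eq by simp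
qed

lemma integrable_indicator_continuous:
  fixes f :: "'a::euclidean_space \<Rightarrow> real"
  assumes "A \<in> sets borel" "bounded A" "continuous_on UNIV f"
  shows "integrable lborel (\<lambda>x. indicator A x * f x)"
proof -
  obtain a r where A: "A \<subseteq> cball a r" using assms(2) by (meson bounded_subset_cball)
  have "integrable lborel (\<lambda>x. indicator (cball a r) x *\<^sub>R f x)"
    by (intro borel_integrable_compact compact_cball continuous_on_subset[OF assms(3)]) auto
  then have "integrable lborel (\<lambda>x. indicator A x *\<^sub>R (indicator (cball a r) x *\<^sub>R f x))"
    using assms(1) by (rule_tac integrable_mult_indicator) auto
  moreover have "(\<lambda>x. indicator A x *\<^sub>R (indicator (cball a r) x *\<^sub>R f x)) = (\<lambda>x. indicator A x * f x)"
    using A by (fastforce simp: indicator_def)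
  ultimately show ?thesis by metis
qed

section \<open>Linear changes of variables and isometries\<close>

text \<open>The preimage of a box is its image under the inverse map, which scales volume by the
  reciprocal determinant; the density compensates for that. As an identity of measures it serves
  every Borel integrand at once.\<close>

lemma lborel_distr_linear:
  fixes M :: "real^'n::{finite,wellorder} \<Rightarrow> real^'n::_"
  assumes M: "linear M" "det (matrix M) \<noteq> 0"
  shows "lborel = density (distr lborel borel M) (\<lambda>_. ennreal \<bar>det (matrix M)\<bar>)"
proof (rule lborel_eqI)
  fix l u :: "real^'n::_" assume le: "\<And>b. b \<in> Basis \<Longrightarrow> l \<bullet> b \<le> u \<bullet> b"
  have Mm: "M \<in> borel_measurable borel"
    using M(1) by (intro borel_measurable_continuous_onI) (simp add: linear_continuous_on linear_conv_bounded_linear)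
  have "inj M" using M det_nz_iff_inj by blast
  then obtain N where N: "linear N" "\<And>x. N (M x) = x" "\<And>x. M (N x) = x"
    using linear_injective_isomorphism[OF M(1)] by metis
  have "matrix N ** matrix M = mat 1"
    using matrix_compose[OF M(1) N(1)] N(2) by (simp add: o_def matrix_id_mat_1[unfolded id_def])
  then have detN: "det (matrix N) * det (matrix M) = 1" by (metis det_mul det_I)
  have pre: "M -` box l u = N ` box l u"
  proof
    show "M -` box l u \<subseteq> N ` box l u" using N(2) by (metis imageI subsetI vimageD)
    show "N ` box l u \<subseteq> M -` box l u" using N(3) by auto
  qed
  have "emeasure (distr lborel borel M) (box l u) = emeasure lborel (M -` box l u)"
    using Mm by (subst emeasure_distr) auto
  also have "\<dots> = emeasure lebesgue (N ` box l u)"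
    unfolding pre[symmetric] using measurable_sets[OF Mm, of "box l u"] by simp
  also have "\<dots> = ennreal (\<bar>det (matrix N)\<bar> * measure lebesgue (box l u))"
    using measurable_linear_image[OF N(1), of "box l u"] measure_linear_image[OF N(1), of "box l u"]
    by (simp add: emeasure_eq_measure2)
  finally have "emeasure (distr lborel borel M) (box l u) = ennreal (\<bar>det (matrix N)\<bar> * measure lebesgue (box l u))" .
  then have "emeasure (density (distr lborel borel M) (\<lambda>_. ennreal \<bar>det (matrix M)\<bar>)) (box l u) =
      ennreal (\<bar>det (matrix M)\<bar> * (\<bar>det (matrix N)\<bar> * measure lebesgue (box l u)))"
    by (subst emeasure_density) (auto simp: nn_integral_cmult_indicator ennreal_mult')
  also have "\<bar>det (matrix M)\<bar> * (\<bar>det (matrix N)\<bar> * measure lebesgue (box l u)) = measure lebesgue (box l u)"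
    using detN by (simp add: abs_mult[symmetric] mult.assoc[symmetric] mult.commute)
  also have "\<dots> = (\<Prod>b\<in>Basis. (u - l) \<bullet> b)"
    using le by (simp add: measure_def prod_nonneg inner_diff_left)
  finally show "emeasure (density (distr lborel borel M) (\<lambda>_. ennreal \<bar>det (matrix M)\<bar>)) (box l u) =
    ennreal (\<Prod>b\<in>Basis. (u - l) \<bullet> b)" .
qed simp

lemma lborel_integral_affine:
  fixes g :: "real^'n::{finite,wellorder} \<Rightarrow> real" and M :: "real^'n::_ \<Rightarrow> real^'n::_"
  assumes g: "g \<in> borel_measurable borel" and M: "linear M" "det (matrix M) \<noteq> 0"
  shows "(\<integral>u. g u \<partial>lborel) = \<bar>det (matrix M)\<bar> * (\<integral>s. g (c + M s) \<partial>lborel)"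
proof -
  have "M \<in> borel_measurable borel"
    using M(1) by (intro borel_measurable_continuous_onI) (simp add: linear_continuous_on linear_conv_bounded_linear)
  then have Mm: "M \<in> lborel \<rightarrow>\<^sub>M borel" by simp
  define h where "h u = g (c + u)" for u
  have plus: "(+) c \<in> borel_measurable lborel" by simp
  have hm: "h \<in> borel_measurable borel" unfolding h_def[abs_def] using g by simp
  have "(\<integral>u. g u \<partial>lborel) = (\<integral>u. h u \<partial>lborel)"
    using integral_distr[OF plus g] by (simp add: lborel_distr_plus h_def[abs_def])
  also have "\<dots> = (\<integral>u. h u \<partial>density (distr lborel borel M) (\<lambda>_. ennreal \<bar>det (matrix M)\<bar>))"
    using lborel_distr_linear[OF M] by simp
  also have "\<dots> = (\<integral>u. \<bar>det (matrix M)\<bar> *\<^sub>R h u \<partial>distr lborel borel M)"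
    using hm by (subst integral_density) auto
  also have "\<dots> = \<bar>det (matrix M)\<bar> * (\<integral>s. h (M s) \<partial>lborel)"
    using integral_distr[OF Mm hm] by simp
  finally show ?thesis by (simp add: h_def)
qed

text \<open>Distances to 0 give norms, and norms of differences give inner products. The defect of
  additivity or of homogeneity, expanded by inner products, then has norm zero.\<close>

lemma isometry_zero:
  fixes A :: "'a::real_inner \<Rightarrow> 'b::real_inner"
  assumes "A 0 = 0" and dist: "\<And>s t. dist (A s) (A t) = dist s t"
  shows "A s \<bullet> A t = s \<bullet> t" and "linear A"
proof -
  have norm: "norm (A s) = norm s" for s using dist[of s 0] assms(1) by simp
  show inner: "A s \<bullet> A t = s \<bullet> t" for s t
    using dist[of s t] by (simp add: dot_norm_neg dist_norm norm)
  have "(A (s + t) - A s - A t) \<bullet> (A (s + t) - A s - A t) = 0" for s t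
    by (simp add: inner_diff_left inner_diff_right inner)
      (simp add: inner_add_left inner_add_right algebra_simps inner_commute)
  then have add: "A (s + t) = A s + A t" for s t
    by (metis inner_eq_zero_iff diff_diff_eq eq_iff_diff_eq_0)
  have "(A (c *\<^sub>R s) - c *\<^sub>R A s) \<bullet> (A (c *\<^sub>R s) - c *\<^sub>R A s) = 0" for c s
    by (simp add: inner_diff_left inner_diff_right inner)
  then have "A (c *\<^sub>R s) = c *\<^sub>R A s" for c s
    by (metis inner_eq_zero_iff eq_iff_diff_eq_0)
  then show "linear A" using add by (rule_tac linearI)
qed

section \<open>The area measure of a face\<close>

text \<open>\<open>plane_param\<close> is a choice, so its properties rest on the existence of one
  isometric parametrisation: a linear isometry from \<open>real^2\<close> onto the orthogonal
  complement of the normal, translated to a point of the face.\<close>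

lemma plane_param_isometry:
  assumes F: "planar_polygon F" "unit_normal F \<nu>" "x \<in> F"
  shows "dist (plane_param F s) (plane_param F t) = dist s t"
    and "range (plane_param F) = affine hull F"
proof -
  have "\<nu> \<noteq> 0" using F(2) by (auto simp: unit_normal_def)
  define S where "S = {y. \<nu> \<bullet> y = 0}"
  have "subspace S" "dim (UNIV :: (real^2) set) = dim S"
    using dim_hyperplane[OF \<open>\<nu> \<noteq> 0\<close>] subspace_hyperplane by (auto simp: S_def)
  then obtain f :: "real^2 \<Rightarrow> real^3" where f: "linear f" "range f = S" "\<And>x. norm (f x) = norm x"
    using isometries_subspaces[OF subspace_UNIV] by (metis UNIV_I)
  define \<phi> where "\<phi> s = x + f s" for s
  have "dist (\<phi> s) (\<phi> t) = dist s t" for s t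
    using f(3)[of "s - t"] linear_diff[OF f(1)] by (simp add: \<phi>_def dist_norm)
  moreover have "range \<phi> = affine hull F"
  proof -
    have "range \<phi> = (+) x ` S" unfolding f(2)[symmetric] by (auto simp: \<phi>_def)
    also have "\<dots> = {y. (y - x) \<bullet> \<nu> = 0}"
      by (force simp: S_def inner_commute intro: image_eqI[of _ _ "_ - x"])
    finally show ?thesis using face_plane(1)[OF F] by simp
  qed
  ultimately have "\<exists>\<phi> :: real^2 \<Rightarrow> real^3. (\<forall>s t. dist (\<phi> s) (\<phi> t) = dist s t) \<and> range \<phi> = affine hull F"
    by blast
  from someI_ex[OF this]
  show "dist (plane_param F s) (plane_param F t) = dist s t" "range (plane_param F) = affine hull F"
    unfolding plane_param_def by blast+
qed

lemma bounded_planar_polygon: "planar_polygon F \<Longrightarrow> bounded F"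
proof -
  assume "planar_polygon F"
  then obtain \<T> where \<T>: "finite \<T>" "\<forall>S\<in>\<T>. 2 simplex S" "F = rel_interior (\<Union>\<T>)"
    by (auto simp: planar_polygon_def)
  then have "bounded (\<Union>\<T>)" by (meson bounded_Union compact_imp_bounded compact_simplex)
  then show "bounded F" using \<T>(3) rel_interior_subset bounded_subset by metis
qed

lemma borel_face:
  fixes F :: "'a::euclidean_space set"
  assumes "openin (top_of_set (affine hull F)) F"
  shows "F \<in> sets borel"
proof -
  obtain U where "open U" "F = affine hull F \<inter> U" using assms unfolding openin_open by auto
  moreover have "closed (affine hull F)" by (rule closed_affine_hull)
  ultimately show ?thesis by (metis borel_closed borel_open sets.Int)
qed

text \<open>Otherwise \<open>h\<close> is nonzero on a nonempty open subset of \<open>A\<close>,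
  which is not negligible, while a nonnegative function with integral 0 vanishes almost everywhere.
  This is the source of definiteness for cells and faces alike.\<close>

lemma zero_of_integral_zero:
  fixes h :: "'a::euclidean_space \<Rightarrow> real"
  assumes A: "open A" and h: "continuous_on UNIV h" "\<And>x. 0 \<le> h x"
    and int: "integrable lborel (\<lambda>x. indicator A x * h x)" "(\<integral>x. indicator A x * h x \<partial>lborel) = 0"
    and x: "x \<in> A"
  shows "h x = 0"
proof (rule ccontr)
  assume "h x \<noteq> 0"
  define W where "W = A \<inter> {y. h y \<noteq> 0}"
  have "open {y. h y \<noteq> 0}" by (intro open_Collect_neq h continuous_intros)
  then have "open W" "x \<in> W" using A x \<open>h x \<noteq> 0\<close> by (auto simp: W_def)
  have "AE y in lborel. indicator A y * h y = 0"
    using int h(2) by (subst integral_nonneg_eq_0_iff_AE[symmetric]) auto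
  then have "AE y in lborel. y \<notin> W" by eventually_elim (auto simp: W_def)
  then have "W \<in> null_sets lborel"
    using \<open>open W\<close> by (simp add: AE_iff_null_sets[symmetric])
  then have "negligible W" by (simp add: negligible_iff_null_sets null_sets_completionI)
  then show False using open_not_negligible[OF \<open>open W\<close>] \<open>x \<in> W\<close> by blast
qed

context
  fixes F :: "(real^3) set" and \<nu> x0 :: "real^3"
  assumes F: "planar_polygon F" "unit_normal F \<nu>" "x0 \<in> F"
begin

text \<open>Isolates the linear part of the chosen parametrisation. It preserves inner products and
  is tangent to the plane, which is why the Jacobian of a projection will depend on the normal
  alone.\<close>

lemma plane_param_affine:
  obtains A where "linear A" "\<And>s t. A s \<bullet> A t = s \<bullet> t" "\<And>s. plane_param F s = plane_param F 0 + A s"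
    "\<And>s. A s \<bullet> \<nu> = 0"
proof -
  define A where "A s = plane_param F s - plane_param F 0" for s
  have A: "linear A" "\<And>s t. A s \<bullet> A t = s \<bullet> t"
    by (rule isometry_zero[of A]; simp add: A_def plane_param_isometry(1)[OF F] dist_norm
        plane_param_isometry(1)[OF F, unfolded dist_norm])+
  have "plane_param F s \<in> {y. (y - x0) \<bullet> \<nu> = 0}" for s
    using plane_param_isometry(2)[OF F] face_plane(1)[OF F] by blast
  then have plane: "(plane_param F s - x0) \<bullet> \<nu> = 0" for s by blast
  have "A s \<bullet> \<nu> = (plane_param F s - x0) \<bullet> \<nu> - (plane_param F 0 - x0) \<bullet> \<nu>" for s
    by (simp add: A_def inner_diff_left)
  then have "A s \<bullet> \<nu> = 0" for s using plane by simp
  then show ?thesis using A by (intro that[of A]) (auto simp: A_def)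
qed

lemma continuous_plane_param: "continuous_on S (plane_param F)"
  by (rule continuous_on_subset[OF _ subset_UNIV], unfold continuous_on_iff)
    (auto simp: plane_param_isometry(1)[OF F])

text \<open>\<open>plane_param F\<close> maps into the plane of \<open>F\<close>, in which
  \<open>F\<close> is cut out by an open set. Pulled back, a face is therefore open, as
  \<open>zero_of_integral_zero\<close> requires.\<close>

lemma open_vimage_plane_param: "open (plane_param F -` F)"
proof -
  obtain U where U: "open U" "F = affine hull F \<inter> U"
    using face_plane(3)[OF F] unfolding openin_open by auto
  have "plane_param F s \<in> affine hull F" for s using plane_param_isometry(2)[OF F] by blast
  then have "plane_param F -` F = plane_param F -` U" using U(2) by (metis IntD2 IntI subsetI subset_antisym vimageE vimageI2)
  then show ?thesis using U(1) continuous_plane_param by (simp add: open_vimage)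
qed

lemma bounded_vimage_plane_param: "bounded (plane_param F -` F)"
proof -
  obtain R where "\<And>y. y \<in> F \<Longrightarrow> dist (plane_param F 0) y \<le> R"
    using bounded_planar_polygon[OF F(1)] unfolding bounded_any_center[of F "plane_param F 0"] by blast
  then show ?thesis unfolding bounded_any_center[of _ 0]
    using plane_param_isometry(1)[OF F, of 0] by (intro exI[of _ R]) (metis vimageE)
qed

lemma area_integral:
  fixes f :: "real^3 \<Rightarrow> real"
  assumes "f \<in> borel_measurable borel"
  shows "(\<integral>x. f x \<partial>area_on F) = (\<integral>s. indicator (plane_param F -` F) s * f (plane_param F s) \<partial>lborel)"
    and "integrable (area_on F) f \<longleftrightarrow>
      integrable lborel (\<lambda>s. indicator (plane_param F -` F) s * f (plane_param F s))"
proof -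
  have \<phi>: "plane_param F \<in> lborel \<rightarrow>\<^sub>M borel"
    using borel_measurable_continuous_onI[OF continuous_plane_param] by simp
  have "F \<in> sets borel" by (rule borel_face[OF face_plane(3)[OF F]])
  then have Fb: "F \<inter> space (distr lborel borel (plane_param F)) \<in> sets (distr lborel borel (plane_param F))"
    and Fm: "F \<in> sets borel" by simp_all
  have ind: "indicator F (plane_param F s) = (indicator (plane_param F -` F) s :: real)" for s
    by (simp add: indicator_def)
  show "(\<integral>x. f x \<partial>area_on F) = (\<integral>s. indicator (plane_param F -` F) s * f (plane_param F s) \<partial>lborel)"
    unfolding area_on_def using Fm assms
    by (simp add: integral_restrict_space[OF Fb] integral_distr[OF \<phi>] ind)
  show "integrable (area_on F) f \<longleftrightarrow>
      integrable lborel (\<lambda>s. indicator (plane_param F -` F) s * f (plane_param F s))"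
    unfolding area_on_def using Fm assms
    by (simp add: integrable_restrict_space[OF Fb] integrable_distr_eq[OF \<phi>] ind)
qed

lemma closure_face_subset: "closure F \<subseteq> {y. (y - x0) \<bullet> \<nu> = 0}"
proof -
  have "F \<subseteq> {y. (y - x0) \<bullet> \<nu> = 0}" using face_plane(1)[OF F] hull_subset[of F] by metis
  moreover have "closed {y. (y - x0) \<bullet> \<nu> = 0}" by (intro closed_Collect_eq continuous_intros)
  ultimately show ?thesis by (rule closure_minimal)
qed

lemma continuous_L2_area_on: "continuous_L2 (area_on F) F"
proof
  show "space (area_on F) = F" by (simp add: area_on_def space_restrict_space)
next
  fix g :: "real^3 \<Rightarrow> real" assume g: "continuous_on UNIV g"
  have int: "integrable lborel (\<lambda>s. indicator (plane_param F -` F) s * g (plane_param F s))"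
    by (intro integrable_indicator_continuous bounded_vimage_plane_param borel_open
        open_vimage_plane_param continuous_on_compose2[OF g continuous_plane_param]) auto
  have gm: "g \<in> borel_measurable borel" using g by (rule borel_measurable_continuous_onI)
  show "integrable (area_on F) g" using int area_integral(2)[OF gm] by simp
  fix x assume "\<And>y. 0 \<le> g y" "(\<integral>y. g y \<partial>area_on F) = 0" "x \<in> F"
  moreover obtain s where "x = plane_param F s"
    using \<open>x \<in> F\<close> plane_param_isometry(2)[OF F] hull_subset[of F] by blast
  moreover have "continuous_on UNIV (\<lambda>s. g (plane_param F s))"
    by (rule continuous_on_compose2[OF g continuous_plane_param]) auto
  ultimately show "g x = 0"
    using zero_of_integral_zero[OF open_vimage_plane_param _ _ int, of s] area_integral(1)[OF gm] by simp
qed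

end

section \<open>Projecting a face along a coordinate axis\<close>

lemma linear_drop_coord: "linear (drop_coord j k)"
  by (rule linearI) (simp_all add: drop_coord_def vec_eq_iff)

context
  fixes i j k :: 3
  assumes idx: "UNIV = {i, j, k}" "i \<noteq> j" "i \<noteq> k" "j \<noteq> k"
begin

lemma all_coord: "(\<forall>m. Q m) \<longleftrightarrow> Q i \<and> Q j \<and> Q k"
  using idx(1) by (metis UNIV_I empty_iff insert_iff)

lemma inner_coord: "x \<bullet> y = x $ i * y $ i + x $ j * y $ j + x $ k * y $ k"
  for x y :: "real^3"
  unfolding inner_vec_def idx(1) using idx(2-4) by simp

lemma dist_drop_coord_le: "dist (drop_coord j k x) (drop_coord j k y) \<le> dist x y"
proof -
  have "norm (drop_coord j k z) \<le> norm z" for z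
    unfolding norm_eq_sqrt_inner inner_coord
    by (simp add: inner_vec_def UNIV_2 drop_coord_def)
  from this[of "x - y"] show ?thesis
    by (simp add: dist_norm linear_diff[OF linear_drop_coord])
qed

lemma drop_insert_coord: "drop_coord j k (insert_coord i j s t) = s"
  using idx(2-4) by (auto simp: drop_coord_def insert_coord_def vec_eq_iff forall_2)

text \<open>A square matrix with orthonormal rows has orthonormal columns, so the products of
  columns \<open>j\<close> and \<open>k\<close> over the rows \<open>u\<close> and \<open>w\<close>
  are known from \<open>\<nu>\<close>. Geometrically, the cross product of \<open>u\<close> and
  \<open>w\<close> is plus or minus \<open>\<nu>\<close>.\<close>

lemma jacobian_orthonormal:
  fixes u w \<nu> :: "real^3"
  assumes "u \<bullet> u = 1" "w \<bullet> w = 1" "\<nu> \<bullet> \<nu> = 1" "u \<bullet> w = 0" "u \<bullet> \<nu> = 0" "w \<bullet> \<nu> = 0"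
  shows "\<bar>u $ j * w $ k - w $ j * u $ k\<bar> = \<bar>\<nu> $ i\<bar>"
proof -
  define Q :: "real^3^3" where "Q = (\<chi> m. if m = i then u else if m = j then w else \<nu>)"
  have Q: "Q $ i = u" "Q $ j = w" "Q $ k = \<nu>" using idx(2-4) by (auto simp: Q_def)
  have "(Q ** transpose Q) $ a $ b = Q $ a \<bullet> Q $ b" for a b
    by (simp add: matrix_matrix_mult_def transpose_def inner_vec_def)
  then have "Q ** transpose Q = mat 1"
    unfolding vec_eq_iff all_coord using idx(2-4) assms
    by (simp add: Q mat_def inner_commute)
  then have "transpose Q ** Q = mat 1" using matrix_left_right_inverse by blast
  moreover have ent: "(transpose Q ** Q) $ a $ b = u $ a * u $ b + w $ a * w $ b + \<nu> $ a * \<nu> $ b" for a b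
    unfolding matrix_matrix_mult_def transpose_def idx(1) using idx(2-4) by (simp add: Q)
  ultimately have "u $ a * u $ b + w $ a * w $ b + \<nu> $ a * \<nu> $ b = (if a = b then 1 else 0)" for a b
    using ent[of a b] by (simp add: mat_def)
  from this[of j j] this[of k k] this[of j k] this[of i i]
  have col: "u $ j * u $ j + w $ j * w $ j = 1 - \<nu> $ j * \<nu> $ j"
    "u $ k * u $ k + w $ k * w $ k = 1 - \<nu> $ k * \<nu> $ k"
    "u $ j * u $ k + w $ j * w $ k = - (\<nu> $ j * \<nu> $ k)" using idx(2-4) by auto
  have \<nu>: "\<nu> $ i * \<nu> $ i = 1 - \<nu> $ j * \<nu> $ j - \<nu> $ k * \<nu> $ k"
    using assms(3) unfolding inner_coord by simp
  \<comment> \<open>Lagrange's identity: the square of a 2 by 2 determinant is the Gram determinant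
    of its columns.\<close>
  have "(u $ j * w $ k - w $ j * u $ k)\<^sup>2 =
      (u $ j * u $ j + w $ j * w $ j) * (u $ k * u $ k + w $ k * w $ k) -
      (u $ j * u $ k + w $ j * w $ k)\<^sup>2" by (simp add: power2_eq_square algebra_simps)
  also have "\<dots> = (\<nu> $ i)\<^sup>2"
    unfolding col power2_eq_square \<nu> by (simp add: algebra_simps)
  finally show ?thesis by (simp add: power2_eq_iff abs_eq_iff)
qed

text \<open>The \<open>i\<close>-th coordinate of the point above \<open>s\<close> in the plane through \<open>x0\<close> with normal \<open>\<nu>\<close>;
  meaningless if that plane is parallel to the \<open>i\<close>-th axis.\<close>

definition plane_height :: "real^3 \<Rightarrow> real^3 \<Rightarrow> real^2 \<Rightarrow> real" where
  "plane_height \<nu> x0 s = (x0 \<bullet> \<nu> - \<nu> $ j * s $ 1 - \<nu> $ k * s $ 2) / \<nu> $ i"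

lemma continuous_plane_height [continuous_intros]: "continuous_on S (plane_height \<nu> x0)"
  unfolding plane_height_def divide_inverse by (intro continuous_intros)

lemma plane_height_iff:
  assumes "\<nu> $ i \<noteq> 0"
  shows "(insert_coord i j s t - x0) \<bullet> \<nu> = 0 \<longleftrightarrow> t = plane_height \<nu> x0 s"
proof -
  have "insert_coord i j s t \<bullet> \<nu> = t * \<nu> $ i + s $ 1 * \<nu> $ j + s $ 2 * \<nu> $ k"
    unfolding inner_coord using idx(2-4) by (simp add: insert_coord_def)
  then show ?thesis using assms by (auto simp: inner_diff_left plane_height_def field_simps)
qed

lemma insert_drop_coord: "insert_coord i j (drop_coord j k y) (y $ i) = y"
  unfolding vec_eq_iff all_coord using idx(2-4) by (simp add: insert_coord_def drop_coord_def)

lemma plane_point: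
  assumes "\<nu> $ i \<noteq> 0" "(y - x0) \<bullet> \<nu> = 0"
  shows "insert_coord i j (drop_coord j k y) (plane_height \<nu> x0 (drop_coord j k y)) = y"
  using plane_height_iff[OF assms(1), of "drop_coord j k y" "y $ i" x0] assms(2)
    insert_drop_coord[of y] by metis

context
  fixes F :: "(real^3) set" and \<nu> x0 :: "real^3"
  assumes F: "planar_polygon F" "unit_normal F \<nu>" "x0 \<in> F"
begin

text \<open>Following the parametrisation by the projection gives an affine map of
  \<open>real^2\<close> whose determinant has modulus \<open>\<bar>\<nu> $ i\<bar>\<close>, and
  \<open>L\<close> undoes the projection. The change of variables thus turns the integral over the
  shadow into one over the face.\<close>

lemma area_projection:
  fixes f :: "real^3 \<Rightarrow> real"
  assumes "\<nu> $ i \<noteq> 0" and f: "continuous_on UNIV f"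
  defines "L \<equiv> \<lambda>s. insert_coord i j s (plane_height \<nu> x0 s)"
  shows "integrable lborel (\<lambda>s. indicator F (L s) * f (L s))"
    and "(\<integral>s. indicator F (L s) * f (L s) \<partial>lborel) = \<bar>\<nu> $ i\<bar> * (\<integral>x. f x \<partial>area_on F)"
proof -
  have Lc: "continuous_on UNIV L" unfolding L_def by (intro continuous_intros)
  have Fb: "F \<in> sets borel" by (rule borel_face[OF face_plane(3)[OF F]])
  have Lm: "L \<in> borel_measurable borel" using Lc by (rule borel_measurable_continuous_onI)
  have ind: "indicator F (L s) = (indicator (L -` F) s :: real)" for s by (simp add: indicator_def)
  have pre: "L -` F \<in> sets borel" using measurable_sets[OF Lm Fb] by simp
  have "L -` F \<subseteq> drop_coord j k ` F"
    by (force simp: L_def drop_insert_coord intro: image_eqI[of _ _ "L _"])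
  moreover have "bounded (drop_coord j k ` F)"
    using bounded_planar_polygon[OF F(1)] linear_drop_coord
    by (intro bounded_linear_image) (auto simp: linear_conv_bounded_linear)
  ultimately have "bounded (L -` F)" using bounded_subset by blast
  then show int: "integrable lborel (\<lambda>s. indicator F (L s) * f (L s))"
    unfolding ind using pre
    by (intro integrable_indicator_continuous continuous_on_compose2[OF f Lc]) auto
  obtain A where A: "linear A" "\<And>s t. A s \<bullet> A t = s \<bullet> t"
    "\<And>s. plane_param F s = plane_param F 0 + A s" "\<And>s. A s \<bullet> \<nu> = 0"
    using plane_param_affine[OF F] by blast
  define M where "M s = drop_coord j k (A s)" for s
  have M: "linear M" unfolding M_def[abs_def]
    using linear_compose[OF A(1) linear_drop_coord] by (simp add: o_def)
  have drop: "drop_coord j k (plane_param F 0) + M s = drop_coord j k (plane_param F s)" for s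
    using A(3)[of s] linear_add[OF linear_drop_coord] by (simp add: M_def)
  have "plane_param F s \<in> {y. (y - x0) \<bullet> \<nu> = 0}" for s
    using plane_param_isometry(2)[OF F] face_plane(1)[OF F] by blast
  then have Ldrop: "L (drop_coord j k (plane_param F s)) = plane_param F s" for s
    unfolding L_def by (intro plane_point assms(1)) blast
  have "\<nu> \<bullet> \<nu> = 1" using F(2) by (simp add: unit_normal_def dot_square_norm)
  \<comment> \<open>The two tangent vectors are images of an orthonormal basis; with
    \<open>\<nu>\<close> they form the triple of \<open>jacobian_orthonormal\<close>.\<close>
  then have "\<bar>A (axis 1 1) $ j * A (axis 2 1) $ k - A (axis 2 1) $ j * A (axis 1 1) $ k\<bar> = \<bar>\<nu> $ i\<bar>"
    by (intro jacobian_orthonormal) (simp_all add: A(2,4) inner_axis_axis)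
  then have det: "\<bar>det (matrix M)\<bar> = \<bar>\<nu> $ i\<bar>"
    by (simp add: det_2 matrix_def M_def drop_coord_def)
  have gm: "(\<lambda>s. indicator F (L s) * f (L s)) \<in> borel_measurable borel" using int by auto
  have "(\<integral>s. indicator F (L s) * f (L s) \<partial>lborel) =
      \<bar>\<nu> $ i\<bar> * (\<integral>s. indicator F (plane_param F s) * f (plane_param F s) \<partial>lborel)"
    using lborel_integral_affine[OF gm M, of "drop_coord j k (plane_param F 0)"] det assms(1)
    by (simp add: drop Ldrop)
  also have "(\<lambda>s. indicator F (plane_param F s) * f (plane_param F s)) =
      (\<lambda>s. indicator (plane_param F -` F) s * f (plane_param F s))"
    by (simp add: indicator_def)
  finally show "(\<integral>s. indicator F (L s) * f (L s) \<partial>lborel) = \<bar>\<nu> $ i\<bar> * (\<integral>x. f x \<partial>area_on F)"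
    using area_integral(1)[OF F borel_measurable_continuous_onI[OF f]] by simp
qed

text \<open>A plane parallel to the \<open>i\<close>-th axis has a line as its shadow.\<close>

lemma negligible_projection_vertical:
  assumes "\<nu> $ i = 0" shows "negligible (drop_coord j k ` closure F)"
proof (rule negligible_subset)
  have "\<nu> \<bullet> \<nu> = 1" using F(2) by (simp add: unit_normal_def dot_square_norm)
  then have "\<nu> $ j \<noteq> 0 \<or> \<nu> $ k \<noteq> 0" unfolding inner_coord using assms by auto
  then have "drop_coord j k \<nu> \<noteq> 0" by (auto simp: drop_coord_def vec_eq_iff forall_2)
  then show "negligible {s. drop_coord j k \<nu> \<bullet> s = x0 \<bullet> \<nu>}" by (intro negligible_hyperplane) auto
  have "drop_coord j k \<nu> \<bullet> drop_coord j k y = y \<bullet> \<nu>" for y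
    unfolding inner_coord using assms by (simp add: inner_vec_def UNIV_2 drop_coord_def mult.commute)
  then show "drop_coord j k ` closure F \<subseteq> {s. drop_coord j k \<nu> \<bullet> s = x0 \<bullet> \<nu>}"
    using closure_face_subset[OF F] by (auto simp: inner_diff_left)
qed

text \<open>The closure of a face is covered by finitely many triangles. A point over the interior
  of the shadow of its triangle has a planar neighbourhood inside that triangle, as the projection
  is injective on the plane, and so belongs to the face. The remaining points of the closure lie
  over the frontiers of convex sets.\<close>

lemma negligible_projection_boundary:
  assumes "\<nu> $ i \<noteq> 0" shows "negligible (drop_coord j k ` (closure F - F))"
proof -
  obtain \<T> where \<T>: "finite \<T>" "\<And>S. S \<in> \<T> \<Longrightarrow> 2 simplex S" "F = rel_interior (\<Union>\<T>)"
    using F(1) by (auto simp: planar_polygon_def)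
  have "affine hull F = affine hull \<Union>\<T>"
    using affine_hull_openin[of "\<Union>\<T>" F] openin_rel_interior[of "\<Union>\<T>"] F(3) \<T>(3) by auto
  then have hull: "affine hull \<Union>\<T> = {y. (y - x0) \<bullet> \<nu> = 0}" using face_plane(1)[OF F] by simp
  have "closed (\<Union>\<T>)" using \<T>(1,2) by (meson closed_Union compact_imp_closed compact_simplex)
  then have clF: "closure F \<subseteq> \<Union>\<T>" using \<T>(3) rel_interior_subset by (metis closure_minimal)
  have "drop_coord j k ` (closure F - F) \<subseteq> (\<Union>S\<in>\<T>. frontier (drop_coord j k ` S))"
  proof
    fix s assume "s \<in> drop_coord j k ` (closure F - F)"
    then obtain y S where y: "s = drop_coord j k y" "y \<notin> F" "y \<in> S" "S \<in> \<T>" using clF by blast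
    have "s \<notin> interior (drop_coord j k ` S)"
    proof
      assume "s \<in> interior (drop_coord j k ` S)"
      then obtain e where e: "e > 0" "ball s e \<subseteq> drop_coord j k ` S" by (auto simp: mem_interior)
      have "ball y e \<inter> affine hull \<Union>\<T> \<subseteq> \<Union>\<T>"
      proof
        fix z assume z: "z \<in> ball y e \<inter> affine hull \<Union>\<T>"
        then have "drop_coord j k z \<in> ball s e"
          using dist_drop_coord_le[of y z] by (auto simp: y(1))
        then obtain z' where z': "z' \<in> S" "drop_coord j k z = drop_coord j k z'" using e by blast
        have "z' \<in> affine hull \<Union>\<T>" using z'(1) y(4) by (intro hull_inc) blast
        then have plane: "(z - x0) \<bullet> \<nu> = 0" "(z' - x0) \<bullet> \<nu> = 0" using z unfolding hull by auto
        have "z = z'"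
          using plane_point[OF assms plane(1)] unfolding z'(2) plane_point[OF assms plane(2)] by (rule sym)
        then show "z \<in> \<Union>\<T>" using z'(1) y(4) by blast
      qed
      then have "y \<in> F" using e(1) y(3,4) unfolding \<T>(3) mem_rel_interior_ball by blast
      then show False using y by blast
    qed
    moreover have "s \<in> closure (drop_coord j k ` S)"
      unfolding y(1) using y(3) by (intro subsetD[OF closure_subset] imageI)
    ultimately have "s \<in> frontier (drop_coord j k ` S)" unfolding frontier_def by (rule_tac DiffI)
    then show "s \<in> (\<Union>S\<in>\<T>. frontier (drop_coord j k ` S))" using y(4) by (rule_tac UN_I)
  qed
  moreover have "negligible (frontier (drop_coord j k ` S))" if "S \<in> \<T>" for S
    by (intro negligible_convex_frontier convex_linear_image linear_drop_coord
        convex_simplex[OF \<T>(2)[OF that]])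
  then have "negligible (\<Union>S\<in>\<T>. frontier (drop_coord j k ` S))"
    using \<T>(1) by (intro negligible_Union) auto
  ultimately show ?thesis using negligible_subset by blast
qed

end

end

section \<open>Integrals over the domain and crossings of its boundary by lines\<close>

lemma polyhedral_domain_bounded_open:
  assumes "polyhedral_domain T"
  shows "open T" "bounded T" "T \<noteq> {}" "lipschitz_boundary T"
proof -
  obtain \<T> where \<T>: "finite \<T>" "\<And>S. S \<in> \<T> \<Longrightarrow> 3 simplex S" "T = interior (\<Union>\<T>)"
    using assms unfolding polyhedral_domain_def by blast
  show "open T" using \<T>(3) by simp
  have "bounded (\<Union>\<T>)" using \<T>(1,2) by (meson bounded_Union compact_imp_bounded compact_simplex)
  then show "bounded T" using \<T>(3) interior_subset bounded_subset by metis
  show "T \<noteq> {}" "lipschitz_boundary T" using assms unfolding polyhedral_domain_def by auto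
qed

text \<open>Links the completed measure of the definitions with the Borel measure, in which Fubini's
  theorem and the changes of variables are carried out.\<close>

lemma integral_lebesgue_on_open:
  fixes f :: "'a::euclidean_space \<Rightarrow> real"
  assumes T: "open T" "bounded T" and f: "continuous_on UNIV f"
  shows "(\<integral>x. f x \<partial>lebesgue_on T) = (\<integral>x. indicator T x * f x \<partial>lborel)"
    and "integrable (lebesgue_on T) f"
proof -
  have int: "integrable lborel (\<lambda>x. indicator T x * f x)"
    using assms by (intro integrable_indicator_continuous) auto
  have Ts: "T \<inter> space lebesgue \<in> sets lebesgue" using T(1) by simp
  show "(\<integral>x. f x \<partial>lebesgue_on T) = (\<integral>x. indicator T x * f x \<partial>lborel)"
    unfolding integral_restrict_space[OF Ts] using int by (simp add: integral_completion)
  show "integrable (lebesgue_on T) f"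
    unfolding integrable_restrict_space[OF Ts] using int by (simp add: integrable_completion)
qed

lemma continuous_L2_lebesgue_on:
  fixes T :: "'a::euclidean_space set"
  assumes T: "open T" "bounded T"
  shows "continuous_L2 (lebesgue_on T) T"
proof
  show "space (lebesgue_on T) = T" by simp
next
  fix g :: "'a \<Rightarrow> real" assume g: "continuous_on UNIV g"
  show "integrable (lebesgue_on T) g" using integral_lebesgue_on_open[OF T g] by simp
  fix x assume "\<And>y. 0 \<le> g y" "(\<integral>y. g y \<partial>lebesgue_on T) = 0" "x \<in> T"
  then show "g x = 0"
    using zero_of_integral_zero[OF T(1) g, of x] integral_lebesgue_on_open[OF T g]
      integrable_indicator_continuous[OF borel_open[OF T(1)] T(2) g] by simp
qed

lemma insert_coord_line: "insert_coord i j s t = insert_coord i j s a + (t - a) *\<^sub>R axis i 1"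
  by (simp add: insert_coord_def vec_eq_iff axis_def)

lemma DERIV_along_line:
  assumes "\<And>x. GDERIV f x :> g x"
  shows "((\<lambda>t. f (insert_coord i j s t)) has_real_derivative g (insert_coord i j s t) $ i) (at t)"
proof -
  have "((\<lambda>t. insert_coord i j s 0 + (t - 0) *\<^sub>R axis i 1) has_derivative (\<lambda>h. h *\<^sub>R axis i 1)) (at t)"
    by (auto intro!: derivative_eq_intros)
  then have line: "((\<lambda>t. insert_coord i j s t) has_derivative (\<lambda>h. h *\<^sub>R axis i 1)) (at t)"
    by (subst insert_coord_line[of i j s _ 0])
  have "(\<lambda>h. (h *\<^sub>R axis i 1) \<bullet> g (insert_coord i j s t)) = (*) (g (insert_coord i j s t) $ i)"
    by (simp add: fun_eq_iff inner_axis' mult.commute)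
  with has_derivative_compose[OF line assms[unfolded gderiv_def, of "insert_coord i j s t"]]
  show ?thesis by (simp add: has_field_derivative_def)
qed

lemma orientation_cases: "orientation T n F = 1 \<or> orientation T n F = - 1"
  by (simp add: orientation_def)

text \<open>Brings the crossing of a half-space by a line into the form of the sign condition that
  \<open>integral_derivative_open_set\<close> imposes on an end point.\<close>

lemma half_line_sides:
  fixes S :: "real set"
  assumes "\<rho> > 0" "c \<noteq> 0" and S: "\<And>t. \<bar>t - a\<bar> < \<rho> \<Longrightarrow> t \<in> S \<longleftrightarrow> c * (t - a) < 0"
  shows "a \<notin> S \<and>
      (sgn c = 1 \<and> (\<forall>\<^sub>F x in at_left a. x \<in> S) \<and> (\<forall>\<^sub>F x in at_right a. x \<notin> S) \<or>
       sgn c = - 1 \<and> (\<forall>\<^sub>F x in at_left a. x \<notin> S) \<and> (\<forall>\<^sub>F x in at_right a. x \<in> S))"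
proof -
  have l: "\<forall>\<^sub>F x in at_left a. x \<in> S \<longleftrightarrow> c > 0"
    unfolding eventually_at_left_field using assms(1)
    by (intro exI[of _ "a - \<rho>"]) (auto simp: S mult_less_0_iff)
  have r: "\<forall>\<^sub>F x in at_right a. x \<in> S \<longleftrightarrow> c < 0"
    unfolding eventually_at_right_field using assms(1)
    by (intro exI[of _ "a + \<rho>"]) (auto simp: S mult_less_0_iff)
  have a: "a \<notin> S" using S[of a] assms(1) by simp
  show ?thesis
  proof (cases "c > 0")
    case True
    with l r a show ?thesis by simp
  next
    case False
    with assms(2) have "c < 0" by simp
    with l r a show ?thesis by simp
  qed
qed

lemma ex_other_coords: "\<exists>j k. UNIV = {i, j, k} \<and> i \<noteq> j \<and> i \<noteq> k \<and> j \<noteq> k" for i :: 3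
proof -
  have ne: "(1::3) \<noteq> 2" "(1::3) \<noteq> 3" "(2::3) \<noteq> 3" by simp_all
  have "UNIV = {2, 1, 3 :: 3}" "UNIV = {3, 1, 2 :: 3}" using UNIV_3 by blast+
  with UNIV_3 ne exhaust_3[of i] show ?thesis by metis
qed

text \<open>An empty set contributes nothing to a sum over faces, so every appeal to a point of a
  face can be confined to nonempty ones.\<close>

lemma integral_area_empty: "(\<integral>x. f x \<partial>area_on {}) = (0::real)"
proof -
  have "(\<integral>x. f x \<partial>area_on {}) = (\<integral>x. 0 \<partial>area_on {})"
    by (rule Bochner_Integration.integral_cong) (simp_all add: area_on_def space_restrict_space)
  then show ?thesis by simp
qed

lemma integral_area_cong:
  "(\<And>x. x \<in> F \<Longrightarrow> f x = g x) \<Longrightarrow> (\<integral>x. f x \<partial>area_on F) = (\<integral>x. g x \<partial>area_on F)"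
  by (rule Bochner_Integration.integral_cong) (auto simp: area_on_def space_restrict_space)

section \<open>Assembling the divergence theorem from the lines in one direction\<close>

locale polyhedral_mesh =
  fixes T :: "(real^3) set" and \<F> :: "(real^3) set set" and n :: "(real^3) set \<Rightarrow> real^3"
  assumes domain: "polyhedral_domain T"
    and faces: "face_set T \<F>"
    and normals: "\<forall>F\<in>\<F>. unit_normal F (n F)"
begin

lemmas T = polyhedral_domain_bounded_open[OF domain]

lemma face:
  assumes "F \<in> \<F>"
  shows "planar_polygon F" "unit_normal F (n F)" "F \<subseteq> frontier T"
  using faces normals assms closure_subset unfolding face_set_def by blast+

lemma finite_faces: "finite \<F>"
  using faces by (simp add: face_set_def)

definition base_point :: "(real^3) set \<Rightarrow> real^3" where
  "base_point F = (SOME x. x \<in> F)"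

lemma base_point: "F \<noteq> {} \<Longrightarrow> base_point F \<in> F"
  unfolding base_point_def by (rule some_in_eq[THEN iffD2])

context
  fixes i j k :: 3 and f :: "real^3 \<Rightarrow> real" and g :: "real^3 \<Rightarrow> real^3"
  assumes idx: "UNIV = {i, j, k}" "i \<noteq> j" "i \<noteq> k" "j \<noteq> k"
    and f: "\<And>x. GDERIV f x :> g x" and g: "continuous_on UNIV g"
begin

abbreviation "transversal_faces \<equiv> {F \<in> \<F>. F \<noteq> {} \<and> n F $ i \<noteq> 0}"

abbreviation "height F s \<equiv> plane_height i j k (n F) (base_point F) s"

abbreviation "lift F s \<equiv> insert_coord i j s (height F s)"

text \<open>The shadow of all places where a line may meet the boundary badly: whole faces parallel
  to the axis, and the relative boundaries of the others. Elsewhere every boundary point on the line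
  is inside a face that is crossed transversally.\<close>

definition exceptional :: "(real^2) set" where
  "exceptional = (\<Union>F\<in>{F \<in> \<F>. F \<noteq> {}}. drop_coord j k ` (if n F $ i = 0 then closure F else closure F - F))"

lemma negligible_exceptional: "negligible exceptional"
  unfolding exceptional_def
proof (rule negligible_Union)
  have "negligible (drop_coord j k ` (if n F $ i = 0 then closure F else closure F - F))"
    if F: "F \<in> \<F>" "F \<noteq> {}" for F
    using negligible_projection_vertical[OF idx face(1,2)[OF F(1)] base_point[OF F(2)]]
      negligible_projection_boundary[OF idx face(1,2)[OF F(1)] base_point[OF F(2)]] by simp
  then show "negligible S"
    if "S \<in> (\<lambda>F. drop_coord j k ` (if n F $ i = 0 then closure F else closure F - F)) ` {F \<in> \<F>. F \<noteq> {}}" for S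
    using that by auto
qed (use finite_faces in auto)

lemma frontier_on_line:
  assumes "s \<notin> exceptional" "insert_coord i j s t \<in> frontier T"
  obtains F where "F \<in> transversal_faces" "insert_coord i j s t \<in> F" "t = height F s"
proof -
  obtain F where F: "F \<in> \<F>" "insert_coord i j s t \<in> closure F"
    using assms(2) faces unfolding face_set_def by blast
  then have ne: "F \<noteq> {}" by auto
  have s: "s = drop_coord j k (insert_coord i j s t)" by (simp add: drop_insert_coord[OF idx])
  have "n F $ i \<noteq> 0 \<and> insert_coord i j s t \<in> F"
  proof (rule ccontr)
    assume "\<not> (n F $ i \<noteq> 0 \<and> insert_coord i j s t \<in> F)"
    then have "insert_coord i j s t \<in> (if n F $ i = 0 then closure F else closure F - F)" using F by auto
    then have "s \<in> drop_coord j k ` (if n F $ i = 0 then closure F else closure F - F)"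
      using s by (rule_tac image_eqI)
    then show False using assms(1) F ne unfolding exceptional_def by blast
  qed
  moreover have "(insert_coord i j s t - base_point F) \<bullet> n F = 0"
    using closure_face_subset[OF face(1,2)[OF F(1)] base_point[OF ne]] F(2) by blast
  ultimately show ?thesis
    using that[of F] F ne plane_height_iff[OF idx, of "n F" s t "base_point F"] by blast
qed

text \<open>The end points on the line correspond to the transversal faces that it hits. The sum
  nevertheless runs over all transversal faces, with an indicator, so that its index set does not
  depend on \<open>s\<close> and the formula can be integrated over \<open>s\<close>.\<close>

lemma integral_on_line:
  assumes s: "s \<notin> exceptional"
  shows "((\<lambda>t. indicator T (insert_coord i j s t) * g (insert_coord i j s t) $ i) has_integral
    (\<Sum>F\<in>transversal_faces. orientation T n F * sgn (n F $ i) * (indicator F (lift F s) * f (lift F s)))) UNIV"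
proof -
  define S where "S = {t. insert_coord i j s t \<in> T}"
  define \<F>s where "\<F>s = {F \<in> transversal_faces. lift F s \<in> F}"
  define c where "c F = orientation T n F * sgn (n F $ i)" for F
  define A where "A = (\<lambda>F. height F s) ` \<F>s"
  \<comment> \<open>Signs belong to faces, whereas the one-dimensional lemma wants one at each end
    point; the inverse makes sense because disjoint faces are hit at different heights.\<close>
  define \<sigma> where "\<sigma> a = c (inv_into \<F>s (\<lambda>F. height F s) a)" for a
  have cont: "continuous_on UNIV (insert_coord i j s)" by (intro continuous_intros)
  have S_vimage: "S = insert_coord i j s -` T" by (auto simp: S_def)
  have inj: "inj_on (\<lambda>F. height F s) \<F>s"
  proof (rule inj_onI)
    fix F F' assume F: "F \<in> \<F>s" "F' \<in> \<F>s" "height F s = height F' s"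
    then have "lift F s \<in> F" "lift F s \<in> F'" by (auto simp: \<F>s_def)
    moreover have "pairwise disjnt \<F>" using faces by (simp add: face_set_def)
    ultimately show "F = F'" using F unfolding \<F>s_def pairwise_def disjnt_iff by blast
  qed
  have "((\<lambda>t. indicator S t * g (insert_coord i j s t) $ i) has_integral
    (\<Sum>a\<in>A. \<sigma> a * f (insert_coord i j s a))) UNIV"
  proof (rule integral_derivative_open_set)
    show "open S" unfolding S_vimage using T(1) cont by (simp add: open_vimage)
    obtain R where R: "\<And>x. x \<in> T \<Longrightarrow> norm x \<le> R" using T(2) by (auto simp: bounded_iff)
    have "\<bar>t\<bar> \<le> R" if "t \<in> S" for t
    proof -
      have "\<bar>t\<bar> = \<bar>insert_coord i j s t $ i\<bar>" by (simp add: insert_coord_def)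
      also have "\<dots> \<le> norm (insert_coord i j s t)" by (rule component_le_norm_cart)
      also have "\<dots> \<le> R" using R that by (simp add: S_def)
      finally show ?thesis .
    qed
    then show "bounded S" unfolding bounded_iff by auto
    show "finite A" unfolding A_def \<F>s_def using finite_faces by simp
    show "frontier S \<subseteq> A"
    proof
      fix t assume t: "t \<in> frontier S"
      have "insert_coord i j s ` closure S \<subseteq> closure T"
        by (rule image_closure_subset) (use cont closure_subset[of T] in \<open>auto simp: S_def intro: continuous_on_subset\<close>)
      then have "insert_coord i j s t \<in> closure T" using t by (auto simp: frontier_def)
      moreover have "insert_coord i j s t \<notin> T"
        using t \<open>open S\<close> by (auto simp: frontier_def interior_open S_def)
      ultimately have "insert_coord i j s t \<in> frontier T" using T(1) by (simp add: frontier_def interior_open)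
      then obtain F where "F \<in> transversal_faces" "insert_coord i j s t \<in> F" "t = height F s"
        using frontier_on_line[OF s] by blast
      then show "t \<in> A" unfolding A_def \<F>s_def by blast
    qed
    show "((\<lambda>t. f (insert_coord i j s t)) has_real_derivative g (insert_coord i j s t) $ i) (at t)" for t
      by (rule DERIV_along_line[OF f])
    fix a assume "a \<in> A"
    then obtain F where F: "F \<in> \<F>s" "a = height F s" by (auto simp: A_def)
    then have F': "F \<in> \<F>" "n F $ i \<noteq> 0" "lift F s \<in> F" by (auto simp: \<F>s_def)
    obtain \<rho> where \<rho>: "\<rho> > 0" "\<And>y. dist (lift F s) y < \<rho> \<Longrightarrow>
        (y \<in> T \<longleftrightarrow> orientation T n F * ((y - lift F s) \<bullet> n F) < 0)"
      using orientation_half_ball[where n = n and F = F, OF T(4,1) face(1,3,2)[OF F'(1)] F'(3)] by blast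
    \<comment> \<open>A step of \<open>t - a\<close> along the axis changes the inner product with
      the normal by \<open>(t - a) * n F $ i\<close>, so orientation and normal component together
      decide where the line leaves \<open>T\<close>.\<close>
    have "t \<in> S \<longleftrightarrow> (orientation T n F * n F $ i) * (t - a) < 0" if "\<bar>t - a\<bar> < \<rho>" for t
    proof -
      have line: "insert_coord i j s t - lift F s = (t - a) *\<^sub>R axis i 1"
        using insert_coord_line[of i j s t a] F(2) by simp
      then have "dist (lift F s) (insert_coord i j s t) < \<rho>"
        using that unfolding dist_norm norm_minus_commute[of "lift F s"] by simp
      from \<rho>(2)[OF this] show ?thesis
        unfolding line S_def by (simp add: inner_axis' mult_ac)
    qed
    note half_line_sides[OF \<rho>(1) _ this]
    moreover have "orientation T n F * n F $ i \<noteq> 0" using F'(2) orientation_cases[of T n F] by auto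
    moreover have "\<sigma> a = sgn (orientation T n F * n F $ i)"
      using inv_into_f_f[OF inj F(1)] orientation_cases[of T n F] F(2)
      by (auto simp: \<sigma>_def c_def sgn_mult)
    ultimately show "a \<notin> S \<and>
      (\<sigma> a = 1 \<and> (\<forall>\<^sub>F x in at_left a. x \<in> S) \<and> (\<forall>\<^sub>F x in at_right a. x \<notin> S) \<or>
       \<sigma> a = - 1 \<and> (\<forall>\<^sub>F x in at_left a. x \<notin> S) \<and> (\<forall>\<^sub>F x in at_right a. x \<in> S))" by simp
  qed
  moreover have "(\<Sum>a\<in>A. \<sigma> a * f (insert_coord i j s a)) = (\<Sum>F\<in>\<F>s. c F * f (lift F s))"
    unfolding A_def sum.reindex[OF inj] by (rule sum.cong) (simp_all add: \<sigma>_def inv_into_f_f[OF inj])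
  moreover have "\<dots> = (\<Sum>F\<in>transversal_faces. c F * (indicator F (lift F s) * f (lift F s)))"
    by (rule sum.mono_neutral_cong_left) (use finite_faces in \<open>auto simp: \<F>s_def indicator_def\<close>)
  moreover have "(\<lambda>t. indicator S t * g (insert_coord i j s t) $ i) =
      (\<lambda>t. indicator T (insert_coord i j s t) * g (insert_coord i j s t) $ i)"
    by (simp add: S_def indicator_def)
  ultimately show ?thesis by (simp only: c_def)
qed

lemma divergence_coord_aux:
  "(\<integral>x. g x $ i \<partial>lebesgue_on T) = (\<Sum>F\<in>\<F>. orientation T n F * (n F $ i * (\<integral>x. f x \<partial>area_on F)))"
proof -
  have gi: "continuous_on UNIV (\<lambda>x. g x $ i)" using g by (intro continuous_intros)
  have fc: "continuous_on UNIV f"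
    using f unfolding gderiv_def by (intro differentiable_imp_continuous_on) (auto simp: differentiable_on_def differentiable_def intro: has_derivative_at_withinI)
  define G where "G x = indicator T x * g x $ i" for x
  define B where "B s = (\<Sum>F\<in>transversal_faces.
    orientation T n F * sgn (n F $ i) * (indicator F (lift F s) * f (lift F s)))" for s
  have G: "integrable lborel G" unfolding G_def
    using T gi by (intro integrable_indicator_continuous) auto
  have area: "integrable lborel (\<lambda>s. indicator F (lift F s) * f (lift F s))"
    "(\<integral>s. indicator F (lift F s) * f (lift F s) \<partial>lborel) = \<bar>n F $ i\<bar> * (\<integral>x. f x \<partial>area_on F)"
    if "F \<in> transversal_faces" for F
    using area_projection[OF idx face(1,2)[of F] base_point _ fc] that by auto
  have "exceptional \<in> null_sets (completion lborel)"
    using negligible_exceptional by (simp add: negligible_iff_null_sets)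
  then have "AE s in completion lborel. s \<notin> exceptional" by (rule AE_not_in)
  then have "AE s in lborel. s \<notin> exceptional" by (simp add: AE_completion_iff)
  with Fubini_insert_coord(1)[OF idx G]
  have AE: "AE s in lborel. (\<integral>t. G (insert_coord i j s t) \<partial>lborel) = B s"
  proof eventually_elim
    case (elim s)
    \<comment> \<open>The slice integral is a Lebesgue integral and the one-dimensional formula a
      gauge integral; they agree because almost every slice is integrable.\<close>
    show ?case
      using has_integral_integral_lborel[OF elim(1)] integral_on_line[OF elim(2)]
      unfolding G_def B_def by (rule has_integral_unique)
  qed
  have Bint: "integrable lborel B" unfolding B_def
    using area(1) by (intro Bochner_Integration.integrable_sum integrable_mult_right) auto
  have "(\<integral>x. g x $ i \<partial>lebesgue_on T) = (\<integral>x. G x \<partial>lborel)"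
    unfolding G_def by (rule integral_lebesgue_on_open(1)[OF T(1,2) gi])
  also have "\<dots> = (\<integral>s. (\<integral>t. G (insert_coord i j s t) \<partial>lborel) \<partial>lborel)"
    using Fubini_insert_coord(2)[OF idx G] by simp
  also have "\<dots> = (\<integral>s. B s \<partial>lborel)"
    using Fubini_insert_coord(3)[OF idx G] Bint AE
    by (intro integral_cong_AE borel_measurable_integrable)
  also have "\<dots> = (\<Sum>F\<in>transversal_faces. orientation T n F * sgn (n F $ i) *
      (\<integral>s. indicator F (lift F s) * f (lift F s) \<partial>lborel))"
    unfolding B_def using area(1) by (subst Bochner_Integration.integral_sum) auto
  also have "\<dots> = (\<Sum>F\<in>transversal_faces. orientation T n F * (n F $ i * (\<integral>x. f x \<partial>area_on F)))"
  proof (rule sum.cong)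
    fix F assume F: "F \<in> transversal_faces"
    \<comment> \<open>The projection contributes the modulus of the normal component and the
      crossing its sign; together they are the component itself.\<close>
    have "orientation T n F * sgn (n F $ i) * (\<bar>n F $ i\<bar> * I) =
        orientation T n F * ((sgn (n F $ i) * \<bar>n F $ i\<bar>) * I)" for I
      by (simp only: mult_ac)
    then show "orientation T n F * sgn (n F $ i) * (\<integral>s. indicator F (lift F s) * f (lift F s) \<partial>lborel) =
        orientation T n F * (n F $ i * (\<integral>x. f x \<partial>area_on F))"
      unfolding area(2)[OF F] by (simp only: sgn_mult_abs)
  qed simp
  also have "\<dots> = (\<Sum>F\<in>\<F>. orientation T n F * (n F $ i * (\<integral>x. f x \<partial>area_on F)))"
  \<comment> \<open>The faces left aside so far, parallel to the axis or empty, have zero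
    terms.\<close>
  proof (rule sum.mono_neutral_left)
    show "\<forall>F\<in>\<F> - transversal_faces. orientation T n F * (n F $ i * (\<integral>x. f x \<partial>area_on F)) = 0"
      by (auto simp: integral_area_empty)
  qed (use finite_faces in auto)
  finally show ?thesis .
qed

end

lemma divergence_coord:
  fixes f :: "real^3 \<Rightarrow> real" and g :: "real^3 \<Rightarrow> real^3"
  assumes "\<And>x. GDERIV f x :> g x" "continuous_on UNIV g"
  shows "(\<integral>x. g x $ i \<partial>lebesgue_on T) = (\<Sum>F\<in>\<F>. orientation T n F * (n F $ i * (\<integral>x. f x \<partial>area_on F)))"
proof -
  obtain j k where "UNIV = {i, j, k}" "i \<noteq> j" "i \<noteq> k" "j \<noteq> k" using ex_other_coords by blast
  then show ?thesis using assms by (rule divergence_coord_aux)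
qed

end

section \<open>The polynomial spaces as restrictions of subspaces\<close>

text \<open>This and the next two definitions are the global counterparts of \<open>Pvec\<close>,
  \<open>G\<close> and \<open>Gperp\<close>, which are their images under \<open>restrict\<close>
  when \<open>T\<close> is open. Gradients are described by a relation, so that no derivative has to
  be chosen.\<close>

definition polyvec :: "int \<Rightarrow> (real^3 \<Rightarrow> real^3) set" where
  "polyvec l = {v. \<forall>i. (\<lambda>x. v x $ i) \<in> polys l}"

definition gradients :: "int \<Rightarrow> (real^3 \<Rightarrow> real^3) set" where
  "gradients l = {v. \<exists>p\<in>polys (l + 1). \<forall>x. GDERIV p x :> v x}"

definition gradients_perp :: "int \<Rightarrow> (real^3) set \<Rightarrow> (real^3 \<Rightarrow> real^3) set" where
  "gradients_perp l T = {w \<in> polyvec l. \<forall>g\<in>gradients l. (\<integral>x. w x \<bullet> g x \<partial>lebesgue_on T) = 0}"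

lemma continuous_subspace_polys: "continuous_subspace (polys l)"
  unfolding continuous_subspace_def
  by (auto simp: polys_continuous polys_zero polys_add polys_cmult)

lemma continuous_subspace_polyvec: "continuous_subspace (polyvec l)"
proof -
  have "continuous_on UNIV v" if "v \<in> polyvec l" for v
  proof -
    have "continuous_on UNIV (\<lambda>x. \<chi> i. v x $ i)"
      by (rule continuous_on_vec_lambda) (use that polys_continuous in \<open>auto simp: polyvec_def\<close>)
    then show ?thesis by simp
  qed
  then show ?thesis
    unfolding continuous_subspace_def
    by (auto simp: polyvec_def polys_zero polys_add polys_cmult)
qed

lemma gradients_subset: "gradients l \<subseteq> polyvec l"
proof
  fix v assume "v \<in> gradients l"
  then obtain p where p: "p \<in> polys (l + 1)" "\<And>x. GDERIV p x :> v x" by (auto simp: gradients_def)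
  obtain g where g: "\<forall>i. (\<lambda>x. g x $ i) \<in> polys l" "\<forall>x. GDERIV p x :> g x"
    using polys_gderiv[OF p(1)] by auto
  then have "v = g" using p(2) GDERIV_unique by blast
  then show "v \<in> polyvec l" using g(1) by (simp add: polyvec_def)
qed

lemma gradients_mono: "l \<le> m \<Longrightarrow> gradients l \<subseteq> gradients m"
  unfolding gradients_def using polys_mono by fastforce

lemma GDERIV_cmult: "GDERIV f x :> D \<Longrightarrow> GDERIV (\<lambda>x. c * f x) x :> c *\<^sub>R D" for c :: real
  using GDERIV_mult[OF GDERIV_const, of f x D c] by simp

lemma GDERIV_sum:
  "(\<And>j. j \<in> J \<Longrightarrow> GDERIV (f j) x :> D j) \<Longrightarrow> GDERIV (\<lambda>x. \<Sum>j\<in>J. f j x) x :> (\<Sum>j\<in>J. D j)"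
  unfolding gderiv_def inner_sum_right by (rule has_derivative_sum)

lemma continuous_subspace_gradients: "continuous_subspace (gradients l)"
  unfolding continuous_subspace_def
proof (intro conjI ballI allI)
  show "continuous_on UNIV v" if "v \<in> gradients l" for v
    using that gradients_subset continuous_subspaceD(1)[OF continuous_subspace_polyvec] by blast
  show "(\<lambda>x. 0) \<in> gradients l"
    unfolding gradients_def using polys_zero GDERIV_const by blast
  fix v assume "v \<in> gradients l"
  then obtain p where p: "p \<in> polys (l + 1)" "\<And>x. GDERIV p x :> v x" by (auto simp: gradients_def)
  show "(\<lambda>x. c *\<^sub>R v x) \<in> gradients l" for c
    unfolding gradients_def using polys_cmult[OF p(1)] GDERIV_cmult[OF p(2)] by blast
  fix w assume "w \<in> gradients l"
  then obtain q where q: "q \<in> polys (l + 1)" "\<And>x. GDERIV q x :> w x" by (auto simp: gradients_def)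
  show "(\<lambda>x. v x + w x) \<in> gradients l"
    unfolding gradients_def using polys_add[OF p(1) q(1)] GDERIV_add[OF p(2) q(2)] by blast
qed

text \<open>The generators are the gradients of the monomials. They may be dependent, the constant
  monomial giving 0, which \<open>projection_on_range_exists\<close> allows.\<close>

lemma gradients_span:
  obtains J :: "(3 \<Rightarrow> nat) set" and b where "finite J" "\<And>\<alpha>. \<alpha> \<in> J \<Longrightarrow> continuous_on UNIV (b \<alpha>)"
    "gradients l = {\<lambda>x. \<Sum>\<alpha>\<in>J. c \<alpha> *\<^sub>R b \<alpha> x | c. True}"
proof -
  define m where "m \<alpha> x = (\<Prod>i\<in>UNIV. (x $ i) ^ \<alpha> i)" for \<alpha> :: "3 \<Rightarrow> nat" and x :: "real^3"
  define J where "J = {\<alpha>::3 \<Rightarrow> nat. int (\<Sum>i\<in>UNIV. \<alpha> i) \<le> l + 1}"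
  have m: "m \<alpha> \<in> polys (l + 1)" if "\<alpha> \<in> J" for \<alpha>
    using polys_monom[of \<alpha> "l + 1" 1] that by (simp add: J_def m_def[abs_def])
  have "\<exists>g. (\<forall>i. (\<lambda>x. g x $ i) \<in> polys l) \<and> (\<forall>x. GDERIV (m \<alpha>) x :> g x)" if "\<alpha> \<in> J" for \<alpha>
    using polys_gderiv[OF m[OF that]] by simp
  then obtain b where b: "\<And>\<alpha> i. \<alpha> \<in> J \<Longrightarrow> (\<lambda>x. b \<alpha> x $ i) \<in> polys l"
    "\<And>\<alpha> x. \<alpha> \<in> J \<Longrightarrow> GDERIV (m \<alpha>) x :> b \<alpha> x" by metis
  have polys: "polys (l + 1) = {\<lambda>x. \<Sum>\<alpha>\<in>J. c \<alpha> * m \<alpha> x | c. True}"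
    unfolding polys_def J_def m_def by auto
  have der: "GDERIV (\<lambda>x. \<Sum>\<alpha>\<in>J. c \<alpha> * m \<alpha> x) x :> (\<Sum>\<alpha>\<in>J. c \<alpha> *\<^sub>R b \<alpha> x)" for c x
    by (intro GDERIV_sum GDERIV_cmult b(2))
  have "gradients l = {\<lambda>x. \<Sum>\<alpha>\<in>J. c \<alpha> *\<^sub>R b \<alpha> x | c. True}"
  proof (intro equalityI subsetI)
    fix v assume "v \<in> gradients l"
    then obtain c where "\<And>x. GDERIV (\<lambda>x. \<Sum>\<alpha>\<in>J. c \<alpha> * m \<alpha> x) x :> v x"
      unfolding gradients_def polys by auto
    then have "v = (\<lambda>x. \<Sum>\<alpha>\<in>J. c \<alpha> *\<^sub>R b \<alpha> x)" using GDERIV_unique[OF _ der] by blast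
    then show "v \<in> {\<lambda>x. \<Sum>\<alpha>\<in>J. c \<alpha> *\<^sub>R b \<alpha> x | c. True}" by blast
  next
    fix v assume "v \<in> {\<lambda>x. \<Sum>\<alpha>\<in>J. c \<alpha> *\<^sub>R b \<alpha> x | c. True}"
    then show "v \<in> gradients l" unfolding gradients_def polys using der by blast
  qed
  moreover have "continuous_on UNIV (b \<alpha>)" if "\<alpha> \<in> J" for \<alpha>
    by (rule continuous_subspaceD(1)[OF continuous_subspace_polyvec[of l]])
      (use b(1)[OF that] in \<open>auto simp: polyvec_def\<close>)
  moreover have "finite J" unfolding J_def by (rule finite_multiindices)
  ultimately show ?thesis using that[of J b] by blast
qed

lemma Pvec_eq: "Pvec l T = (\<lambda>v. restrict v T) ` polyvec l"
proof (intro equalityI subsetI)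
  fix v assume v: "v \<in> Pvec l T"
  then have "\<forall>i. \<exists>p. p \<in> polys l \<and> (\<lambda>x\<in>T. v x $ i) = restrict p T"
    unfolding Pvec_def P_def by blast
  then obtain p where p: "\<And>i. p i \<in> polys l" "\<And>i. (\<lambda>x\<in>T. v x $ i) = restrict (p i) T" by metis
  have "v x $ i = p i x" if "x \<in> T" for x i using p(2)[of i] that by (metis restrict_apply')
  then have "v = restrict (\<lambda>x. \<chi> i. p i x) T"
    using v by (intro extensionalityI[of _ T]) (auto simp: Pvec_def vec_eq_iff)
  moreover have "(\<lambda>x. \<chi> i. p i x) \<in> polyvec l" using p(1) by (simp add: polyvec_def)
  ultimately show "v \<in> (\<lambda>v. restrict v T) ` polyvec l" by blast
next
  fix v assume "v \<in> (\<lambda>v. restrict v T) ` polyvec l"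
  then obtain w where w: "w \<in> polyvec l" "v = restrict w T" by blast
  have "(\<lambda>x\<in>T. v x $ i) = restrict (\<lambda>x. w x $ i) T" for i by (auto simp: w(2))
  then show "v \<in> Pvec l T" using w unfolding Pvec_def P_def polyvec_def by auto
qed

text \<open>Derivatives are local and \<open>T\<close> is open, so extension by
  \<open>undefined\<close> does not disturb them at points of \<open>T\<close>.\<close>

lemma grad_restrict:
  assumes "open T" "\<And>x. GDERIV p x :> g x"
  shows "grad T (restrict p T) = restrict g T"
  unfolding grad_def
proof (rule restrict_ext)
  fix x assume "x \<in> T"
  have "GDERIV (restrict p T) x :> g x"
    using assms(2)[of x] unfolding gderiv_def
    by (rule has_derivative_transform_within_open[OF _ assms(1) \<open>x \<in> T\<close>]) simp
  then show "(THE D. GDERIV (restrict p T) x :> D) = g x"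
    using GDERIV_unique by blast
qed

lemma G_eq:
  assumes "open T"
  shows "G l T = (\<lambda>v. restrict v T) ` gradients l"
proof (intro equalityI subsetI)
  fix v assume "v \<in> G l T"
  then obtain p where p: "p \<in> polys (l + 1)" "v = grad T (restrict p T)" by (auto simp: G_def P_def)
  obtain g where "\<forall>x. GDERIV p x :> g x" using polys_gderiv[OF p(1)] by auto
  then show "v \<in> (\<lambda>v. restrict v T) ` gradients l"
    using p grad_restrict[OF assms, of p g] by (auto simp: gradients_def)
next
  fix v assume "v \<in> (\<lambda>v. restrict v T) ` gradients l"
  then obtain p g where "p \<in> polys (l + 1)" "\<And>x. GDERIV p x :> g x" "v = restrict g T"
    by (auto simp: gradients_def)
  moreover from this have "v = grad T (restrict p T)" using grad_restrict[OF assms, of p g] by simp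
  ultimately show "v \<in> G l T" unfolding G_def P_def by blast
qed

lemma integral_lebesgue_on_cong:
  "(\<And>x. x \<in> T \<Longrightarrow> f x = g x) \<Longrightarrow> (\<integral>x. f x \<partial>lebesgue_on T) = (\<integral>x. g x \<partial>lebesgue_on T)"
  by (rule Bochner_Integration.integral_cong) auto

lemma Gperp_eq:
  assumes "open T"
  shows "Gperp l T = (\<lambda>v. restrict v T) ` gradients_perp l T"
proof -
  have "(\<integral>x. restrict w T x \<bullet> restrict g T x \<partial>lebesgue_on T) = (\<integral>x. w x \<bullet> g x \<partial>lebesgue_on T)"
    for w g :: "real^3 \<Rightarrow> real^3" by (rule integral_lebesgue_on_cong) simp
  then show ?thesis unfolding Gperp_def gradients_perp_def Pvec_eq G_eq[OF assms] by auto
qed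

text \<open>Each point of the closure of an open set is a limit point of it, so \<open>Lim\<close>
  is determined, and continuity gives its value.\<close>

lemma closure_ext_restrict:
  fixes f :: "real^3 \<Rightarrow> 'b::t2_space"
  assumes "open T" "continuous_on UNIV f" "x \<in> closure T"
  shows "closure_ext T (restrict f T) x = f x"
proof -
  have "x islimpt T" using assms by (metis Un_iff closure_def interior_limit_point interior_open mem_Collect_eq)
  then have nt: "\<not> trivial_limit (at x within T)" by (simp add: trivial_limit_within)
  have "(f \<longlongrightarrow> f x) (at x within T)"
    using assms(2) by (meson UNIV_I continuous_on_def subset_UNIV tendsto_within_subset)
  moreover have "\<forall>\<^sub>F y in at x within T. f y = restrict f T y"
    by (simp add: eventually_at_filter)
  ultimately have "(restrict f T \<longlongrightarrow> f x) (at x within T)" by (rule Lim_transform_eventually)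
  from tendsto_Lim[OF nt this] show ?thesis using assms(3) by (simp add: closure_ext_def)
qed

section \<open>Existence of projections and uniqueness of the decomposition on a cell\<close>

locale open_domain =
  fixes T :: "(real^3) set"
  assumes T_open: "open T" and T_bounded: "bounded T"
begin

sublocale L2: continuous_L2 "lebesgue_on T" T
  using T_open T_bounded by (rule continuous_L2_lebesgue_on)

lemma integral_add_continuous:
  fixes f g :: "real^3 \<Rightarrow> real"
  assumes "continuous_on UNIV f" "continuous_on UNIV g"
  shows "(\<integral>x. f x + g x \<partial>lebesgue_on T) = (\<integral>x. f x \<partial>lebesgue_on T) + (\<integral>x. g x \<partial>lebesgue_on T)"
    and "(\<integral>x. f x - g x \<partial>lebesgue_on T) = (\<integral>x. f x \<partial>lebesgue_on T) - (\<integral>x. g x \<partial>lebesgue_on T)"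
  by (intro Bochner_Integration.integral_add Bochner_Integration.integral_diff L2.integrable assms)+

lemma continuous_subspace_gradients_perp: "continuous_subspace (gradients_perp l T)"
  unfolding continuous_subspace_def
proof (intro conjI ballI allI)
  note vec = continuous_subspaceD[OF continuous_subspace_polyvec]
  note grd = continuous_subspaceD(1)[OF continuous_subspace_gradients]
  show "(\<lambda>x. 0) \<in> gradients_perp l T" unfolding gradients_perp_def using vec(2) by simp
  fix v assume v: "v \<in> gradients_perp l T"
  then show cv: "continuous_on UNIV v" unfolding gradients_perp_def using vec(1) by blast
  show "(\<lambda>x. c *\<^sub>R v x) \<in> gradients_perp l T" for c
    using v vec(4) unfolding gradients_perp_def by simp
  fix w assume w: "w \<in> gradients_perp l T"
  then have cw: "continuous_on UNIV w" unfolding gradients_perp_def using vec(1) by blast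
  have "(\<integral>x. (v x + w x) \<bullet> g x \<partial>lebesgue_on T) =
      (\<integral>x. v x \<bullet> g x \<partial>lebesgue_on T) + (\<integral>x. w x \<bullet> g x \<partial>lebesgue_on T)" if "g \<in> gradients l" for g
    unfolding inner_add_left using cv cw grd[OF that]
    by (intro integral_add_continuous continuous_intros)
  then show "(\<lambda>x. v x + w x) \<in> gradients_perp l T"
    using v w vec(3) unfolding gradients_perp_def by simp
qed

text \<open>One polynomial satisfies both forms of orthogonality: the component-wise form identifies
  \<open>proj_Pvec\<close>, the vector form is compared with the conditions on
  \<open>P_div\<close>.\<close>

lemma polyvec_projection_exists:
  fixes v :: "real^3 \<Rightarrow> real^3"
  assumes v: "continuous_on UNIV v"
  shows "\<exists>p\<in>polyvec l.
    (\<forall>i. \<forall>q\<in>polys l. (\<integral>x. (v x $ i - p x $ i) * q x \<partial>lebesgue_on T) = 0) \<and>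
    (\<forall>w\<in>polyvec l. (\<integral>x. (v x - p x) \<bullet> w x \<partial>lebesgue_on T) = 0)"
proof -
  have polys: "polys l = {\<lambda>x. \<Sum>\<alpha> | int (\<Sum>i\<in>UNIV. \<alpha> i) \<le> l. c \<alpha> *\<^sub>R (\<Prod>i\<in>UNIV. (x $ i) ^ \<alpha> i) | c. True}"
    unfolding polys_def by auto
  have "\<exists>p\<in>polys l. \<forall>w\<in>polys l. (\<integral>x. (v x $ i - p x) \<bullet> w x \<partial>lebesgue_on T) = 0" for i
    by (rule L2.projection_on_range_exists[OF finite_multiindices _ _ polys])
      (auto intro!: continuous_intros v)
  then obtain p where p: "\<And>i. p i \<in> polys l"
    "\<And>i q. q \<in> polys l \<Longrightarrow> (\<integral>x. (v x $ i - p i x) * q x \<partial>lebesgue_on T) = 0"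
    unfolding inner_real_def by metis
  have "(\<integral>x. (v x - (\<chi> i. p i x)) \<bullet> w x \<partial>lebesgue_on T) = 0" if w: "w \<in> polyvec l" for w
  proof -
    have wi: "(\<lambda>x. w x $ i) \<in> polys l" for i using w by (simp add: polyvec_def)
    have "(\<integral>x. (v x - (\<chi> i. p i x)) \<bullet> w x \<partial>lebesgue_on T) =
        (\<integral>x. (\<Sum>i\<in>UNIV. (v x $ i - p i x) * w x $ i) \<partial>lebesgue_on T)"
      by (simp add: inner_vec_def)
    also have "\<dots> = (\<Sum>i\<in>UNIV. (\<integral>x. (v x $ i - p i x) * w x $ i \<partial>lebesgue_on T))"
      by (rule Bochner_Integration.integral_sum)
        (intro L2.integrable continuous_intros v polys_continuous[OF p(1)] polys_continuous[OF wi])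
    also have "\<dots> = 0" using p(2)[OF wi] by simp
    finally show ?thesis .
  qed
  then show ?thesis using p by (intro bexI[of _ "\<lambda>x. \<chi> i. p i x"]) (auto simp: polyvec_def)
qed

lemma gradients_projection_exists:
  assumes v: "continuous_on UNIV v"
  shows "\<exists>a\<in>gradients l. \<forall>w\<in>gradients l. (\<integral>x. (v x - a x) \<bullet> w x \<partial>lebesgue_on T) = 0"
proof -
  obtain J :: "(3 \<Rightarrow> nat) set" and b where "finite J" "\<And>\<alpha>. \<alpha> \<in> J \<Longrightarrow> continuous_on UNIV (b \<alpha>)"
    "gradients l = {\<lambda>x. \<Sum>\<alpha>\<in>J. c \<alpha> *\<^sub>R b \<alpha> x | c. True}"
    using gradients_span by blast
  then show ?thesis using v by (intro L2.projection_on_range_exists)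
qed

text \<open>Instead of generators of the complement, two known projections are used: onto
  \<open>polyvec l\<close>, and then onto gradients, which is subtracted. The difference lies in the
  complement, and neither correction is seen by its elements.\<close>

lemma gradients_perp_projection_exists:
  assumes v: "continuous_on UNIV v"
  shows "\<exists>b\<in>gradients_perp l T. \<forall>w\<in>gradients_perp l T. (\<integral>x. (v x - b x) \<bullet> w x \<partial>lebesgue_on T) = 0"
proof -
  note vec = continuous_subspaceD[OF continuous_subspace_polyvec]
  obtain p where p: "p \<in> polyvec l"
    and p_orth: "\<And>w. w \<in> polyvec l \<Longrightarrow> (\<integral>x. (v x - p x) \<bullet> w x \<partial>lebesgue_on T) = 0"
    using polyvec_projection_exists[OF v, of l] by blast
  obtain a where a: "a \<in> gradients l"
    "\<And>w. w \<in> gradients l \<Longrightarrow> (\<integral>x. (p x - a x) \<bullet> w x \<partial>lebesgue_on T) = 0"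
    using gradients_projection_exists[OF vec(1)[OF p]] by blast
  have av: "a \<in> polyvec l" using a(1) gradients_subset by blast
  have "(\<lambda>x. p x - a x) \<in> gradients_perp l T"
    unfolding gradients_perp_def using vec(5)[OF p av] a(2) by simp
  moreover have "(\<integral>x. (v x - (p x - a x)) \<bullet> w x \<partial>lebesgue_on T) = 0" if w: "w \<in> gradients_perp l T" for w
  proof -
    have wv: "w \<in> polyvec l" "(\<integral>x. w x \<bullet> a x \<partial>lebesgue_on T) = 0"
      using w a(1) by (auto simp: gradients_perp_def)
    have "(v x - (p x - a x)) \<bullet> w x = (v x - p x) \<bullet> w x + w x \<bullet> a x" for x
      unfolding inner_diff_left inner_commute[of "w x"] by simp
    then have "(\<integral>x. (v x - (p x - a x)) \<bullet> w x \<partial>lebesgue_on T) =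
        (\<integral>x. (v x - p x) \<bullet> w x + w x \<bullet> a x \<partial>lebesgue_on T)" by presburger
    also have "\<dots> = (\<integral>x. (v x - p x) \<bullet> w x \<partial>lebesgue_on T) + (\<integral>x. w x \<bullet> a x \<partial>lebesgue_on T)"
      by (intro integral_add_continuous continuous_intros v vec(1)[OF p] vec(1)[OF wv(1)] vec(1)[OF av])
    finally show ?thesis using p_orth[OF wv(1)] wv(2) by simp
  qed
  ultimately show ?thesis by (intro bexI[of _ "\<lambda>x. p x - a x"] ballI)
qed

text \<open>Two decompositions of the same field differ, on \<open>T\<close>, by an element of the
  complement that is also in \<open>gradients (k - 1)\<close>, hence in \<open>gradients k\<close>;
  being orthogonal to itself, it vanishes.\<close>

lemma Gperp_part_eq:
  assumes "a \<in> gradients (k - 1)" "b \<in> gradients_perp k T"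
  shows "Gperp_part k T (\<lambda>x\<in>T. a x + b x) = restrict b T"
  unfolding Gperp_part_def Gperp_eq[OF T_open] G_eq[OF T_open]
proof (rule the_equality)
  have "(\<lambda>x\<in>T. a x + b x) = (\<lambda>x\<in>T. restrict a T x + restrict b T x)" by (rule restrict_ext) simp
  then show "restrict b T \<in> (\<lambda>v. restrict v T) ` gradients_perp k T \<and>
      (\<exists>a'\<in>(\<lambda>v. restrict v T) ` gradients (k - 1). (\<lambda>x\<in>T. a x + b x) = (\<lambda>x\<in>T. a' x + restrict b T x))"
    using assms by blast
next
  fix b0 assume "b0 \<in> (\<lambda>v. restrict v T) ` gradients_perp k T \<and>
      (\<exists>a'\<in>(\<lambda>v. restrict v T) ` gradients (k - 1). (\<lambda>x\<in>T. a x + b x) = (\<lambda>x\<in>T. a' x + b0 x))"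
  then obtain a' b' where b': "b' \<in> gradients_perp k T" "b0 = restrict b' T" and a': "a' \<in> gradients (k - 1)"
    and "(\<lambda>x\<in>T. a x + b x) = (\<lambda>x\<in>T. restrict a' T x + b0 x)" by blast
  then have eq: "b' x - b x = a x - a' x" if "x \<in> T" for x
    using that by (auto simp: fun_eq_iff algebra_simps dest!: spec[of _ x])
  define d where "d x = b' x - b x" for x
  have d: "d \<in> gradients_perp k T" unfolding d_def[abs_def]
    using continuous_subspaceD(5)[OF continuous_subspace_gradients_perp b'(1) assms(2)] .
  have "(\<lambda>x. a x - a' x) \<in> gradients k"
    using continuous_subspaceD(5)[OF continuous_subspace_gradients assms(1) a'] gradients_mono[of "k - 1" k] by auto
  then have "(\<integral>x. d x \<bullet> (a x - a' x) \<partial>lebesgue_on T) = 0" using d by (simp add: gradients_perp_def)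
  moreover have "(\<integral>x. d x \<bullet> d x \<partial>lebesgue_on T) = (\<integral>x. d x \<bullet> (a x - a' x) \<partial>lebesgue_on T)"
    by (rule integral_lebesgue_on_cong) (simp add: d_def eq)
  ultimately have dd: "(\<integral>x. d x \<bullet> d x \<partial>lebesgue_on T) = 0" by (rule trans[rotated])
  have "d x = 0" if "x \<in> T" for x
    by (rule L2.inner_zero_imp_zero[OF continuous_subspaceD(1)[OF continuous_subspace_gradients_perp d] dd that])
  then show "b0 = restrict b T" unfolding b'(2) by (auto simp: d_def)
qed

end

section \<open>The commutation property\<close>

context polyhedral_mesh
begin

sublocale open_domain T
  by unfold_locales (use T in auto)

lemma frontier_subset: "F \<in> \<F> \<Longrightarrow> F \<subseteq> closure T"
  using face(3)[of F] Diff_subset[of "closure T" "interior T"] unfolding frontier_def by (rule_tac subset_trans)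

lemma area_L2: "F \<in> \<F> \<Longrightarrow> F \<noteq> {} \<Longrightarrow> continuous_L2 (area_on F) F"
  by (rule continuous_L2_area_on[OF face(1,2) base_point])

lemma integration_by_parts:
  fixes V :: "real^3 \<Rightarrow> real^3" and q :: "real^3 \<Rightarrow> real"
  assumes V: "\<And>i x. GDERIV (\<lambda>x. V x $ i) x :> h i x" "\<And>i. continuous_on UNIV (h i)"
    and q: "\<And>x. GDERIV q x :> g x" "continuous_on UNIV g"
    and cont: "continuous_on UNIV V" "continuous_on UNIV q"
  shows "(\<integral>x. (\<Sum>i\<in>UNIV. h i x $ i) * q x \<partial>lebesgue_on T) + (\<integral>x. V x \<bullet> g x \<partial>lebesgue_on T) =
    (\<Sum>F\<in>\<F>. orientation T n F * (\<integral>x. (V x \<bullet> n F) * q x \<partial>area_on F))"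
proof -
  \<comment> \<open>\<open>D i\<close> is the gradient of \<open>V x $ i * q x\<close>; the
    \<open>i\<close>-th entries of the \<open>D i\<close> add up to the two integrands on the
    left.\<close>
  define D where "D i x = (V x $ i) *\<^sub>R g x + q x *\<^sub>R h i x" for i x
  have Dc: "continuous_on UNIV (D i)" for i
    unfolding D_def using V(2) q(2) cont by (intro continuous_intros)
  have Di: "continuous_on UNIV (\<lambda>x. D i x $ i)" for i
    using Dc by (intro continuous_intros)
  have coord: "(\<integral>x. D i x $ i \<partial>lebesgue_on T) =
      (\<Sum>F\<in>\<F>. orientation T n F * (n F $ i * (\<integral>x. V x $ i * q x \<partial>area_on F)))" for i
    by (rule divergence_coord[OF _ Dc]) (unfold D_def, rule GDERIV_mult[OF V(1) q(1)])
  have area: "(\<Sum>i\<in>UNIV. n F $ i * (\<integral>x. V x $ i * q x \<partial>area_on F)) =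
      (\<integral>x. (V x \<bullet> n F) * q x \<partial>area_on F)" if "F \<in> \<F>" for F
  proof (cases "F = {}")
    case False
    then interpret A: continuous_L2 "area_on F" F using area_L2 that by blast
    have int: "integrable (area_on F) (\<lambda>x. V x $ i * q x)" for i
      using cont by (intro A.integrable continuous_intros)
    have "(\<integral>x. (V x \<bullet> n F) * q x \<partial>area_on F) = (\<integral>x. (\<Sum>i\<in>UNIV. n F $ i * (V x $ i * q x)) \<partial>area_on F)"
      by (simp add: inner_vec_def sum_distrib_right sum_distrib_left mult_ac)
    also have "\<dots> = (\<Sum>i\<in>UNIV. n F $ i * (\<integral>x. V x $ i * q x \<partial>area_on F))"
      using int by simp
    finally show ?thesis by simp
  qed (simp add: integral_area_empty)
  have "(\<integral>x. (\<Sum>i\<in>UNIV. h i x $ i) * q x \<partial>lebesgue_on T) + (\<integral>x. V x \<bullet> g x \<partial>lebesgue_on T) =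
      (\<integral>x. (\<Sum>i\<in>UNIV. h i x $ i) * q x + V x \<bullet> g x \<partial>lebesgue_on T)"
    using V(2) q(2) cont by (intro integral_add_continuous(1)[symmetric] continuous_intros)
  also have "\<dots> = (\<integral>x. (\<Sum>i\<in>UNIV. D i x $ i) \<partial>lebesgue_on T)"
    by (simp add: D_def inner_vec_def sum.distrib sum_distrib_left mult.commute add.commute)
  also have "\<dots> = (\<Sum>i\<in>UNIV. \<integral>x. D i x $ i \<partial>lebesgue_on T)"
    using Di by (intro Bochner_Integration.integral_sum L2.integrable)
  also have "\<dots> = (\<Sum>F\<in>\<F>. \<Sum>i\<in>UNIV. orientation T n F * (n F $ i * (\<integral>x. V x $ i * q x \<partial>area_on F)))"
    unfolding coord by (rule sum.swap)
  also have "\<dots> = (\<Sum>F\<in>\<F>. orientation T n F * (\<integral>x. (V x \<bullet> n F) * q x \<partial>area_on F))"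
    by (rule sum.cong) (simp_all add: sum_distrib_left[symmetric] area)
  finally show ?thesis .
qed

text \<open>\<open>P_div\<close> tests with zero-average polynomials only. Subtracting the mean,
  which makes sense because a nonempty open cell has nonzero volume, leaves the gradient unchanged,
  so no gradient is lost.\<close>

lemma polys_zero_average:
  assumes "q \<in> polys l" "0 \<le> l"
  obtains m where "(\<lambda>x. q x - m) \<in> polys l" "(\<integral>x. q x - m \<partial>lebesgue_on T) = 0"
proof -
  define m where "m = (\<integral>x. q x \<partial>lebesgue_on T) / (\<integral>x. 1 \<partial>lebesgue_on T)"
  have "(\<integral>x. 1 \<partial>lebesgue_on T) \<noteq> (0::real)"
  proof
    assume "(\<integral>x. 1 \<partial>lebesgue_on T) = (0::real)"
    moreover obtain x where "x \<in> T" using T(3) by blast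
    ultimately show False using L2.definite[of "\<lambda>_. 1" x] by simp
  qed
  moreover have "(\<integral>x. q x - m \<partial>lebesgue_on T) = (\<integral>x. q x \<partial>lebesgue_on T) - (\<integral>x. m * 1 \<partial>lebesgue_on T)"
    using integral_add_continuous(2)[OF polys_continuous[OF assms(1)], of "\<lambda>_. m"] by simp
  ultimately have "(\<integral>x. q x - m \<partial>lebesgue_on T) = 0"
    unfolding m_def by (simp only: integral_mult_right_zero) simp
  then show ?thesis using that polys_diff[OF assms(1) polys_const[OF assms(2)]] by blast
qed

context
  fixes k :: int and p :: "real^3 \<Rightarrow> real^3" and r :: "real^3 \<Rightarrow> real" and c :: "real^3"
  assumes k: "0 \<le> k" and p: "p \<in> polyvec k" and r: "r \<in> polys k"
begin

definition rt_field :: "real^3 \<Rightarrow> real^3" where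
  "rt_field x = p x + r x *\<^sub>R (x - c)"

definition interpolant :: ddr_div where
  "interpolant = I_div k T \<F> n (closure_ext T (restrict rt_field T))"

lemma continuous_rt_field: "continuous_on S rt_field"
proof -
  have "continuous_on UNIV p" using continuous_subspaceD(1)[OF continuous_subspace_polyvec p] .
  then have "continuous_on UNIV rt_field" unfolding rt_field_def[abs_def]
    by (intro continuous_intros polys_continuous[OF r])
  then show ?thesis by (rule continuous_on_subset) simp
qed

text \<open>Differentiation lowers the degrees of \<open>p\<close> and \<open>r\<close> by one, and
  the factor \<open>x - c\<close> raises the latter again: the sum stays in degree
  \<open>k\<close>.\<close>

lemma rt_field_divergence:
  obtains h d where "\<And>i x. GDERIV (\<lambda>x. rt_field x $ i) x :> h i x" "\<And>i. continuous_on UNIV (h i)"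
    "d \<in> polys k" "\<And>x. d x = (\<Sum>i\<in>UNIV. h i x $ i)"
proof -
  obtain s where s: "\<And>i. (\<lambda>x. s x $ i) \<in> polys (k - 1)" "\<And>x. GDERIV r x :> s x"
    using polys_gderiv[OF r] by blast
  have "\<forall>i. \<exists>g. (\<forall>j. (\<lambda>x. g x $ j) \<in> polys (k - 1)) \<and> (\<forall>x. GDERIV (\<lambda>x. p x $ i) x :> g x)"
    using p polys_gderiv unfolding polyvec_def by blast
  then obtain g where g: "\<And>i j. (\<lambda>x. g i x $ j) \<in> polys (k - 1)"
    "\<And>i x. GDERIV (\<lambda>x. p x $ i) x :> g i x" by metis
  \<comment> \<open>\<open>axis i 1 - 0\<close> is the form in which the rule for differences
    returns the gradient of \<open>x $ i - c $ i\<close>.\<close>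
  define h where "h i x = g i x + (r x *\<^sub>R (axis i 1 - 0) + (x $ i - c $ i) *\<^sub>R s x)" for i x
  have vec: "continuous_on UNIV v" if "\<And>i. (\<lambda>x. v x $ i) \<in> polys (k - 1)" for v :: "real^3 \<Rightarrow> real^3"
    using that continuous_subspaceD(1)[OF continuous_subspace_polyvec[of "k - 1"], of v] by (simp add: polyvec_def)
  have "GDERIV (\<lambda>x. rt_field x $ i) x :> h i x" for i x
  proof -
    have "GDERIV (\<lambda>x. p x $ i + r x * (x $ i - c $ i)) x :> h i x"
      unfolding h_def
      by (intro GDERIV_add GDERIV_mult GDERIV_diff GDERIV_coord GDERIV_const g(2) s(2))
    then show ?thesis by (simp add: rt_field_def)
  qed
  moreover have "continuous_on UNIV (h i)" for i
    unfolding h_def[abs_def]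
    by (intro continuous_intros vec[OF g(1)] vec[OF s(1)] polys_continuous[OF r])
  moreover have "(\<lambda>x. \<Sum>i\<in>UNIV. h i x $ i) \<in> polys k"
  proof (rule polys_sum)
    fix i
    have "(\<lambda>x. g i x $ i + (r x + (x $ i * s x $ i - c $ i * s x $ i))) \<in> polys k"
      using polys_coord[OF s(1), of i i]
      by (intro polys_add polys_diff r polys_mono[OF g(1)] polys_mono[OF polys_cmult[OF s(1)]]) auto
    then show "(\<lambda>x. h i x $ i) \<in> polys k"
      by (simp add: h_def left_diff_distrib)
  qed
  ultimately show ?thesis using that[of h "\<lambda>x. \<Sum>i\<in>UNIV. h i x $ i"] by blast
qed

lemma face_component:
  assumes "F \<in> \<F>" "F \<noteq> {}"
  shows "\<exists>u\<in>polys k. snd interpolant F = restrict u F \<and> (\<forall>x\<in>F. u x = rt_field x \<bullet> n F)"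
proof -
  \<comment> \<open>The factor \<open>(x - c) \<bullet> n F\<close> is frozen at its value in the
    base point. The result has degree \<open>k\<close> on the whole space and agrees with the normal
    component on \<open>F\<close>.\<close>
  define u where "u x = (\<Sum>i\<in>UNIV. n F $ i * p x $ i) + ((base_point F - c) \<bullet> n F) * r x" for x
  have u: "u \<in> polys k" unfolding u_def[abs_def]
    using p r by (intro polys_add polys_sum polys_cmult) (auto simp: polyvec_def)
  have eq: "u x = rt_field x \<bullet> n F" if "x \<in> F" for x
  proof -
    have "(x - base_point F) \<bullet> n F = 0"
      using face(2)[OF assms(1)] base_point[OF assms(2)] that by (auto simp: unit_normal_def)
    then have "(x - c) \<bullet> n F = (base_point F - c) \<bullet> n F" by (simp add: inner_diff_left)
    then show ?thesis
      by (simp add: u_def rt_field_def inner_add_left inner_vec_def[of "p x"] mult.commute)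
  qed
  interpret A: continuous_L2 "area_on F" F using area_L2 assms by blast
  have "L2_proj (area_on F) (P k F) (\<lambda>x. closure_ext T (restrict rt_field T) x \<bullet> n F) = restrict u F"
    unfolding P_def
  proof (rule A.L2_proj_eq[OF continuous_subspace_polys u polys_continuous[OF u]])
    fix x assume "x \<in> F"
    then show "closure_ext T (restrict rt_field T) x \<bullet> n F = u x"
      using frontier_subset[OF assms(1)] eq
      by (subst closure_ext_restrict[OF T_open continuous_rt_field]) auto
  qed simp
  then show ?thesis using assms(1) u eq by (auto simp: interpolant_def I_div_def)
qed

text \<open>The face unknowns equal the normal components pointwise, not only when tested in degree
  \<open>k\<close>; hence \<open>q\<close> may be any continuous function, in particular a
  polynomial of degree \<open>k + 1\<close>.\<close>

lemma boundary_term_interpolant: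
  assumes q: "continuous_on UNIV q"
  shows "boundary_term T \<F> n interpolant (restrict q T) =
    (\<Sum>F\<in>\<F>. orientation T n F * (\<integral>x. (rt_field x \<bullet> n F) * q x \<partial>area_on F))"
  unfolding boundary_term_def
proof (rule sum.cong)
  fix F assume F: "F \<in> \<F>"
  have "(\<integral>x. snd interpolant F x * closure_ext T (restrict q T) x \<partial>area_on F) =
      (\<integral>x. (rt_field x \<bullet> n F) * q x \<partial>area_on F)"
  proof (rule integral_area_cong)
    fix x assume x: "x \<in> F"
    then have "snd interpolant F x = rt_field x \<bullet> n F" using face_component[OF F] by fastforce
    moreover have "closure_ext T (restrict q T) x = q x"
      using x frontier_subset[OF F] by (intro closure_ext_restrict[OF T_open q]) auto
    ultimately show "snd interpolant F x * closure_ext T (restrict q T) x = (rt_field x \<bullet> n F) * q x" by simp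
  qed
  then show "orientation T n F * (\<integral>x. snd interpolant F x * closure_ext T (restrict q T) x \<partial>area_on F) =
      orientation T n F * (\<integral>x. (rt_field x \<bullet> n F) * q x \<partial>area_on F)" by simp
qed simp

lemma cell_component:
  "\<exists>a\<in>gradients (k - 1). \<exists>b\<in>gradients_perp k T. fst interpolant = (\<lambda>x\<in>T. a x + b x) \<and>
    (\<forall>w\<in>gradients (k - 1). (\<integral>x. (rt_field x - a x) \<bullet> w x \<partial>lebesgue_on T) = 0) \<and>
    (\<forall>w\<in>gradients_perp k T. (\<integral>x. (rt_field x - b x) \<bullet> w x \<partial>lebesgue_on T) = 0)"
proof -
  obtain a where a: "a \<in> gradients (k - 1)"
    "\<And>w. w \<in> gradients (k - 1) \<Longrightarrow> (\<integral>x. (rt_field x - a x) \<bullet> w x \<partial>lebesgue_on T) = 0"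
    using gradients_projection_exists[OF continuous_rt_field] by blast
  obtain b where b: "b \<in> gradients_perp k T"
    "\<And>w. w \<in> gradients_perp k T \<Longrightarrow> (\<integral>x. (rt_field x - b x) \<bullet> w x \<partial>lebesgue_on T) = 0"
    using gradients_perp_projection_exists[OF continuous_rt_field] by blast
  have ext: "closure_ext T (restrict rt_field T) x = rt_field x" if "x \<in> T" for x
    using closure_ext_restrict[OF T_open continuous_rt_field] closure_subset that by blast
  have "L2_proj (lebesgue_on T) (G (k - 1) T) (closure_ext T (restrict rt_field T)) = restrict a T"
    unfolding G_eq[OF T_open]
    by (rule L2.L2_proj_eq[OF continuous_subspace_gradients a(1) continuous_rt_field ext a(2)])
  moreover have "L2_proj (lebesgue_on T) (Gperp k T) (closure_ext T (restrict rt_field T)) = restrict b T"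
    unfolding Gperp_eq[OF T_open]
    by (rule L2.L2_proj_eq[OF continuous_subspace_gradients_perp b(1) continuous_rt_field ext b(2)])
  ultimately have "fst interpolant = (\<lambda>x\<in>T. a x + b x)"
    unfolding interpolant_def I_div_def by (auto intro!: restrict_ext)
  then show ?thesis using a b by blast
qed

text \<open>The identity is recorded for tests of degree \<open>k + 1\<close>, one more than the
  definition of \<open>D_div\<close> provides, because \<open>P_div\<close> uses that degree. It
  holds since \<open>d\<close> is the actual divergence.\<close>

lemma D_div_interpolant:
  "\<exists>d\<in>polys k. D_div k T \<F> n interpolant = restrict d T \<and>
    (\<forall>q\<in>polys (k + 1). \<forall>g. (\<forall>x. GDERIV q x :> g x) \<longrightarrow>
      (\<integral>x. d x * q x \<partial>lebesgue_on T) + (\<integral>x. rt_field x \<bullet> g x \<partial>lebesgue_on T) =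
      boundary_term T \<F> n interpolant (restrict q T))"
proof -
  obtain h d where h: "\<And>i x. GDERIV (\<lambda>x. rt_field x $ i) x :> h i x" "\<And>i. continuous_on UNIV (h i)"
    and d: "d \<in> polys k" "\<And>x. d x = (\<Sum>i\<in>UNIV. h i x $ i)"
    using rt_field_divergence by blast
  obtain a b where a: "a \<in> gradients (k - 1)" and b: "b \<in> gradients_perp k T"
    and cell: "fst interpolant = (\<lambda>x\<in>T. a x + b x)"
    and a_orth: "\<And>w. w \<in> gradients (k - 1) \<Longrightarrow> (\<integral>x. (rt_field x - a x) \<bullet> w x \<partial>lebesgue_on T) = 0"
    using cell_component by blast
  have grd: "continuous_on UNIV g" if "g \<in> gradients l" for g l
    using continuous_subspaceD(1)[OF continuous_subspace_gradients that] .
  have parts: "(\<integral>x. d x * q x \<partial>lebesgue_on T) + (\<integral>x. rt_field x \<bullet> g x \<partial>lebesgue_on T) =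
      boundary_term T \<F> n interpolant (restrict q T)"
    if q: "q \<in> polys (k + 1)" "\<And>x. GDERIV q x :> g x" for q g
  proof -
    have "g \<in> gradients k" using q by (auto simp: gradients_def)
    from integration_by_parts[OF h q(2) grd[OF this] continuous_rt_field polys_continuous[OF q(1)]]
    show ?thesis unfolding d(2) boundary_term_interpolant[OF polys_continuous[OF q(1)]] .
  qed
  \<comment> \<open>For a candidate \<open>d'\<close> the defining equation amounts to equal moments
    of \<open>d'\<close> and \<open>d\<close>, which serves existence and uniqueness
    together.\<close>
  have D_eq: "(\<integral>x. restrict d' T x * restrict q T x \<partial>lebesgue_on T) =
        - (\<integral>x. fst interpolant x \<bullet> grad T (restrict q T) x \<partial>lebesgue_on T) +
        boundary_term T \<F> n interpolant (restrict q T) \<longleftrightarrow>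
      (\<integral>x. d' x * q x \<partial>lebesgue_on T) = (\<integral>x. d x * q x \<partial>lebesgue_on T)"
    if q: "q \<in> polys k" for d' q
  proof -
    obtain g where g: "\<And>x. GDERIV q x :> g x" using polys_gderiv[OF q] by blast
    have g1: "g \<in> gradients (k - 1)" unfolding gradients_def using q g by auto
    then have gk: "g \<in> gradients k" using gradients_mono[of "k - 1" k] by auto
    have bc: "continuous_on UNIV b" using continuous_subspaceD(1)[OF continuous_subspace_gradients_perp b] .
    \<comment> \<open>The cell unknown may be replaced by the field: \<open>rt_field - a\<close> is
      orthogonal to \<open>gradients (k - 1)\<close> and \<open>b\<close> to
      \<open>gradients k\<close>, and \<open>g\<close> belongs to both.\<close>
    have "(\<integral>x. fst interpolant x \<bullet> grad T (restrict q T) x \<partial>lebesgue_on T) =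
        (\<integral>x. rt_field x \<bullet> g x - (rt_field x - a x) \<bullet> g x + b x \<bullet> g x \<partial>lebesgue_on T)"
      unfolding cell grad_restrict[OF T_open g]
      by (rule integral_lebesgue_on_cong) (simp add: inner_add_left inner_diff_left)
    also have "\<dots> = (\<integral>x. rt_field x \<bullet> g x \<partial>lebesgue_on T) -
        (\<integral>x. (rt_field x - a x) \<bullet> g x \<partial>lebesgue_on T) + (\<integral>x. b x \<bullet> g x \<partial>lebesgue_on T)"
      by (subst integral_add_continuous(1) integral_add_continuous(2);
          (intro continuous_intros continuous_rt_field bc grd[OF gk] grd[OF a])?)+ simp
    also have "\<dots> = (\<integral>x. rt_field x \<bullet> g x \<partial>lebesgue_on T)"
      using a_orth[OF g1] b gk by (simp add: gradients_perp_def)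
    finally have "(\<integral>x. fst interpolant x \<bullet> grad T (restrict q T) x \<partial>lebesgue_on T) =
      (\<integral>x. rt_field x \<bullet> g x \<partial>lebesgue_on T)" .
    moreover have "(\<integral>x. restrict d' T x * restrict q T x \<partial>lebesgue_on T) = (\<integral>x. d' x * q x \<partial>lebesgue_on T)"
      by (rule integral_lebesgue_on_cong) simp
    ultimately show ?thesis using parts[OF polys_mono[OF q] g] by auto
  qed
  have "D_div k T \<F> n interpolant = restrict d T"
    unfolding D_div_def P_def
  proof (rule the_equality)
    show "restrict d T \<in> (\<lambda>p. restrict p T) ` polys k \<and>
      (\<forall>q\<in>(\<lambda>p. restrict p T) ` polys k. (\<integral>x. restrict d T x * q x \<partial>lebesgue_on T) =
        - (\<integral>x. fst interpolant x \<bullet> grad T q x \<partial>lebesgue_on T) + boundary_term T \<F> n interpolant q)"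
      using d(1) D_eq by auto
  next
    fix d0 assume d0: "d0 \<in> (\<lambda>p. restrict p T) ` polys k \<and>
      (\<forall>q\<in>(\<lambda>p. restrict p T) ` polys k. (\<integral>x. d0 x * q x \<partial>lebesgue_on T) =
        - (\<integral>x. fst interpolant x \<bullet> grad T q x \<partial>lebesgue_on T) + boundary_term T \<F> n interpolant q)"
    then obtain d' where d': "d' \<in> polys k" "d0 = restrict d' T" by blast
    have "(\<integral>x. d' x \<bullet> q x \<partial>lebesgue_on T) = (\<integral>x. d x \<bullet> q x \<partial>lebesgue_on T)" if "q \<in> polys k" for q
      using d0 D_eq[OF that, of d'] that unfolding d'(2) by auto
    then have "d' x = d x" if "x \<in> T" for x
      using L2.orthogonal_unique[OF continuous_subspace_polys d'(1) d(1) that] by blast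
    then show "d0 = restrict d T" unfolding d'(2) by (auto intro: restrict_ext)
  qed
  then show ?thesis using d(1) parts by blast
qed

text \<open>Both conditions on the potential say that its moments, against gradients and against
  their complement, are those of the field. \<open>grad_eq\<close> and \<open>perp_eq\<close> make
  this explicit for an arbitrary candidate, so they apply to the projection \<open>u\<close> and to
  any competitor.\<close>

lemma P_div_interpolant: "P_div k T \<F> n interpolant = proj_Pvec k T (restrict rt_field T)"
proof -
  note vec = continuous_subspaceD[OF continuous_subspace_polyvec]
  obtain u where u: "u \<in> polyvec k"
    and u_coord: "\<And>i q. q \<in> polys k \<Longrightarrow> (\<integral>x. (rt_field x $ i - u x $ i) * q x \<partial>lebesgue_on T) = 0"
    and u_vec: "\<And>w. w \<in> polyvec k \<Longrightarrow> (\<integral>x. (rt_field x - u x) \<bullet> w x \<partial>lebesgue_on T) = 0"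
    using polyvec_projection_exists[OF continuous_rt_field, of k] by blast
  obtain a b where a: "a \<in> gradients (k - 1)" and b: "b \<in> gradients_perp k T"
    and cell: "fst interpolant = (\<lambda>x\<in>T. a x + b x)"
    and b_orth: "\<And>w. w \<in> gradients_perp k T \<Longrightarrow> (\<integral>x. (rt_field x - b x) \<bullet> w x \<partial>lebesgue_on T) = 0"
    using cell_component by blast
  obtain d where d: "d \<in> polys k" "D_div k T \<F> n interpolant = restrict d T"
    and parts: "\<And>q g. q \<in> polys (k + 1) \<Longrightarrow> (\<And>x. GDERIV q x :> g x) \<Longrightarrow>
      (\<integral>x. d x * q x \<partial>lebesgue_on T) + (\<integral>x. rt_field x \<bullet> g x \<partial>lebesgue_on T) =
      boundary_term T \<F> n interpolant (restrict q T)"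
    using D_div_interpolant by blast
  have proj: "proj_Pvec k T (restrict rt_field T) = restrict u T"
    unfolding proj_Pvec_def
  proof (rule restrict_ext)
    fix x assume x: "x \<in> T"
    have "L2_proj (lebesgue_on T) (P k T) (\<lambda>y. restrict rt_field T y $ i) = restrict (\<lambda>y. u y $ i) T" for i
      unfolding P_def
    proof (rule L2.L2_proj_eq[OF continuous_subspace_polys])
      show "(\<lambda>y. u y $ i) \<in> polys k" using u by (simp add: polyvec_def)
      show "continuous_on UNIV (\<lambda>y. rt_field y $ i)" using continuous_rt_field by (intro continuous_intros)
    qed (use u_coord in auto)
    then show "(\<chi> i. L2_proj (lebesgue_on T) (P k T) (\<lambda>y. restrict rt_field T y $ i) x) = u x"
      using x by (simp add: vec_eq_iff)
  qed
  have split: "(\<integral>x. (rt_field x - z x) \<bullet> w x \<partial>lebesgue_on T) =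
      (\<integral>x. rt_field x \<bullet> w x \<partial>lebesgue_on T) - (\<integral>x. z x \<bullet> w x \<partial>lebesgue_on T)"
    if "z \<in> polyvec k" "w \<in> polyvec k" for z w
    unfolding inner_diff_left
    by (intro integral_add_continuous(2) continuous_intros continuous_rt_field vec(1)[OF that(1)] vec(1)[OF that(2)])
  have bp: "b \<in> polyvec k" using b by (simp add: gradients_perp_def)
  have u_eq: "(\<integral>x. u x \<bullet> w x \<partial>lebesgue_on T) = (\<integral>x. rt_field x \<bullet> w x \<partial>lebesgue_on T)"
    if "w \<in> polyvec k" for w using split[OF u that] u_vec[OF that] by simp
  have b_eq: "(\<integral>x. b x \<bullet> w x \<partial>lebesgue_on T) = (\<integral>x. rt_field x \<bullet> w x \<partial>lebesgue_on T)"
    if "w \<in> gradients_perp k T" for w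
    using split[OF bp, of w] b_orth[OF that] that by (simp add: gradients_perp_def)
  have grad_eq: "(\<integral>x. restrict z T x \<bullet> grad T (restrict q T) x \<partial>lebesgue_on T) =
        - (\<integral>x. D_div k T \<F> n interpolant x * restrict q T x \<partial>lebesgue_on T) +
        boundary_term T \<F> n interpolant (restrict q T) \<longleftrightarrow>
      (\<integral>x. z x \<bullet> g x \<partial>lebesgue_on T) = (\<integral>x. rt_field x \<bullet> g x \<partial>lebesgue_on T)"
    if q: "q \<in> polys (k + 1)" "\<And>x. GDERIV q x :> g x" for z q g
  proof -
    have "(\<integral>x. restrict z T x \<bullet> grad T (restrict q T) x \<partial>lebesgue_on T) = (\<integral>x. z x \<bullet> g x \<partial>lebesgue_on T)"
      unfolding grad_restrict[OF T_open q(2)] by (rule integral_lebesgue_on_cong) simp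
    moreover have "(\<integral>x. D_div k T \<F> n interpolant x * restrict q T x \<partial>lebesgue_on T) = (\<integral>x. d x * q x \<partial>lebesgue_on T)"
      unfolding d(2) by (rule integral_lebesgue_on_cong) simp
    ultimately show ?thesis using parts[OF q] by auto
  qed
  have perp_eq: "(\<integral>x. restrict z T x \<bullet> restrict w T x \<partial>lebesgue_on T) =
        (\<integral>x. Gperp_part k T (fst interpolant) x \<bullet> restrict w T x \<partial>lebesgue_on T) \<longleftrightarrow>
      (\<integral>x. z x \<bullet> w x \<partial>lebesgue_on T) = (\<integral>x. rt_field x \<bullet> w x \<partial>lebesgue_on T)"
    if "w \<in> gradients_perp k T" for z w
  proof -
    have "(\<integral>x. restrict z T x \<bullet> restrict w T x \<partial>lebesgue_on T) = (\<integral>x. z x \<bullet> w x \<partial>lebesgue_on T)"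
      by (rule integral_lebesgue_on_cong) simp
    moreover have "(\<integral>x. Gperp_part k T (fst interpolant) x \<bullet> restrict w T x \<partial>lebesgue_on T) =
        (\<integral>x. b x \<bullet> w x \<partial>lebesgue_on T)"
      unfolding cell Gperp_part_eq[OF a b] by (rule integral_lebesgue_on_cong) simp
    ultimately show ?thesis using b_eq[OF that] by simp
  qed
  have P0: "q \<in> P0 (k + 1) T \<longleftrightarrow> (\<exists>q'\<in>polys (k + 1). q = restrict q' T \<and> (\<integral>x. q' x \<partial>lebesgue_on T) = 0)" for q
  proof -
    have eq: "integral\<^sup>L (lebesgue_on T) (restrict q' T) = integral\<^sup>L (lebesgue_on T) q'" for q' :: "real^3 \<Rightarrow> real"
      by (rule integral_lebesgue_on_cong) simp
    show ?thesis by (auto simp: P0_def P_def eq)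
  qed
  show ?thesis
    unfolding P_div_def proj Pvec_eq Gperp_eq[OF T_open]
  proof (rule the_equality, intro conjI ballI)
    show "restrict u T \<in> (\<lambda>v. restrict v T) ` polyvec k" using u by blast
  next
    fix q assume "q \<in> P0 (k + 1) T"
    then obtain q' where q': "q' \<in> polys (k + 1)" "q = restrict q' T" unfolding P0 by blast
    obtain g where g: "\<And>x. GDERIV q' x :> g x" using polys_gderiv[OF q'(1)] by blast
    then have "g \<in> gradients k" using q'(1) by (auto simp: gradients_def)
    then have "g \<in> polyvec k" using gradients_subset by blast
    then show "(\<integral>x. restrict u T x \<bullet> grad T q x \<partial>lebesgue_on T) =
        - (\<integral>x. D_div k T \<F> n interpolant x * q x \<partial>lebesgue_on T) + boundary_term T \<F> n interpolant q"
      unfolding q'(2) grad_eq[OF q'(1) g] by (rule u_eq)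
  next
    fix w assume "w \<in> (\<lambda>v. restrict v T) ` gradients_perp k T"
    then obtain w' where w': "w' \<in> gradients_perp k T" "w = restrict w' T" by blast
    show "(\<integral>x. restrict u T x \<bullet> w x \<partial>lebesgue_on T) =
        (\<integral>x. Gperp_part k T (fst interpolant) x \<bullet> w x \<partial>lebesgue_on T)"
      unfolding w'(2) perp_eq[OF w'(1)] using w'(1) by (intro u_eq) (simp add: gradients_perp_def)
  next
    fix z0 assume z0: "z0 \<in> (\<lambda>v. restrict v T) ` polyvec k \<and>
      (\<forall>q\<in>P0 (k + 1) T. (\<integral>x. z0 x \<bullet> grad T q x \<partial>lebesgue_on T) =
        - (\<integral>x. D_div k T \<F> n interpolant x * q x \<partial>lebesgue_on T) + boundary_term T \<F> n interpolant q) \<and>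
      (\<forall>w\<in>(\<lambda>v. restrict v T) ` gradients_perp k T. (\<integral>x. z0 x \<bullet> w x \<partial>lebesgue_on T) =
        (\<integral>x. Gperp_part k T (fst interpolant) x \<bullet> w x \<partial>lebesgue_on T))"
    then obtain z where z: "z \<in> polyvec k" "z0 = restrict z T" by blast
    \<comment> \<open>Every gradient has a zero-average potential, so the tests allowed in
      \<open>P_div\<close> reach all of \<open>gradients k\<close>.\<close>
    have z_grad: "(\<integral>x. z x \<bullet> g x \<partial>lebesgue_on T) = (\<integral>x. rt_field x \<bullet> g x \<partial>lebesgue_on T)"
      if g: "g \<in> gradients k" for g
    proof -
      obtain q where q: "q \<in> polys (k + 1)" "\<And>x. GDERIV q x :> g x" using g by (auto simp: gradients_def)
      have "0 \<le> k + 1" using k by simp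
      then obtain m where m: "(\<lambda>x. q x - m) \<in> polys (k + 1)" "(\<integral>x. q x - m \<partial>lebesgue_on T) = 0"
        by (rule polys_zero_average[OF q(1)])
      have der: "GDERIV (\<lambda>x. q x - m) x :> g x" for x using GDERIV_diff[OF q(2) GDERIV_const] by simp
      have "restrict (\<lambda>x. q x - m) T \<in> P0 (k + 1) T" unfolding P0 using m by blast
      then show ?thesis using z0 grad_eq[OF m(1) der, of z] unfolding z(2) by blast
    qed
    have z_perp: "(\<integral>x. z x \<bullet> w x \<partial>lebesgue_on T) = (\<integral>x. rt_field x \<bullet> w x \<partial>lebesgue_on T)"
      if "w \<in> gradients_perp k T" for w
      using z0 perp_eq[OF that, of z] that unfolding z(2) by blast
    \<comment> \<open>Orthogonality to gradients places \<open>e\<close> in the complement, to which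
      it is orthogonal as well; so \<open>e\<close> is orthogonal to itself.\<close>
    define e where "e x = z x - u x" for x
    have e: "e \<in> polyvec k" unfolding e_def[abs_def] using vec(5)[OF z(1) u] .
    have e_inner: "(\<integral>x. e x \<bullet> w x \<partial>lebesgue_on T) =
        (\<integral>x. z x \<bullet> w x \<partial>lebesgue_on T) - (\<integral>x. rt_field x \<bullet> w x \<partial>lebesgue_on T)"
      if "w \<in> polyvec k" for w
      unfolding e_def inner_diff_left u_eq[OF that, symmetric]
      by (intro integral_add_continuous(2) continuous_intros vec(1)[OF z(1)] vec(1)[OF u] vec(1)[OF that])
    have "e \<in> gradients_perp k T"
      unfolding gradients_perp_def using e e_inner[OF subsetD[OF gradients_subset]] z_grad by simp
    then have ee: "(\<integral>x. e x \<bullet> e x \<partial>lebesgue_on T) = 0" using e_inner[OF e] z_perp by simp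
    have "e x = 0" if "x \<in> T" for x
      by (rule L2.inner_zero_imp_zero[OF vec(1)[OF e] ee that])
    then show "z0 = restrict u T" unfolding z(2) by (auto simp: e_def intro: restrict_ext)
  qed
qed

end

end

theorem proposition28:
  fixes k :: int and T :: "(real^3) set" and \<F> :: "(real^3) set set"
    and n :: "(real^3) set \<Rightarrow> real^3"
  assumes "k \<ge> 0"
    and "polyhedral_domain T"
    and "face_set T \<F>"
    and "\<forall>F\<in>\<F>. unit_normal F (n F)"
  shows "\<forall>v\<in>RT k T. P_div k T \<F> n (I_div k T \<F> n (closure_ext T v)) = proj_Pvec k T v"
proof
  interpret polyhedral_mesh T \<F> n using assms(2-4) by (rule polyhedral_mesh.intro)
  fix v assume "v \<in> RT k T"
  then obtain p q where p: "p \<in> polyvec k" and q: "q \<in> polys k"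
    and v: "v = (\<lambda>x\<in>T. restrict p T x + restrict q T x *\<^sub>R (x - barycenter T))"
    unfolding RT_def Pvec_eq P_def by blast
  have "v = restrict (rt_field p q (barycenter T)) T"
    unfolding v by (rule restrict_ext) (simp add: rt_field_def[OF assms(1) p q])
  then show "P_div k T \<F> n (I_div k T \<F> n (closure_ext T v)) = proj_Pvec k T v"
    using P_div_interpolant[OF assms(1) p q, of "barycenter T"]
    by (simp add: interpolant_def[OF assms(1) p q])
qed

end
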